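(* Let $n\ge1$ and let $\lambda^*$ be the supremum of all $\lambda\ge0$ for which $(1.1)_\lambda$ (see context) possesses a weak solution. For $\lambda\in(0,\lambda^* )$ let $\underline{u}_\lambda$ be the minimal solution of $(1.1)_\lambda$ and let $$V_\lambda(x)=\frac{\lambda}{8n(n+2)}\big[1-|x|^2\big]^2 .$$ Then $\underline{u}_\lambda(x)>V_\lambda(x)$ for all $\lambda\in(0,\lambda^* )$ and all $|x|<1$, and $$\lim_{\lambda\to0^+}\frac{\underline{u}_\lambda(x)}{V_\lambda(x)}=1\quad\text{uniformly with respect to }x\in\mathbb{B}.$$
   Context: $\mathbb{B}$ is the (open) unit ball of $\mathbb{R}^n$, centered at the origin, and $\partial/\partial n$ denotes the exterior normal derivative on $\partial\mathbb{B}$. For $\lambda\ge0$, $(1.1)_\lambda$ is the problem $$\Delta^2u=\frac{\lambda}{1-u}\ \text{in }\mathbb{B},\qquad 0<u\le 1\ \text{in }\mathbb{B},\qquad u=\frac{\partial u}{\partial n}=0\ \text{on }\partial\mathbb{B}.$$ A classical solution is a function $u\in C^4(\overline{\mathbb{B}})$ satisfying $(1.1)_\lambda$. A weak solution is a function $u\in L^1(\mathbb{B})$ with $0\le u\le1$ a.e., $\frac1{1-u}\in L^1(\mathbb{B})$ and $\int_{\mathbb{B}}u\,\Delta^2\varphi\,dx=\lambda\int_{\mathbb{B}}\frac{\varphi}{1-u}\,dx$ for all $\varphi\in C^4(\overline{\mathbb{B}})\cap H_0^2(\mathbb{B})$. The minimal solution $\underline{u}_\lambda$ is the solution satisfying $\underline{u}_\lambda\le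 v$ a.e. in $\mathbb{B}$ for any further (weak) solution $v$ of $(1.1)_\lambda$; for every $\lambda\in(0,\lambda^* )$ it exists and is a classical solution. *)

theory Defs
  imports "HOL-Analysis.Analysis"
begin

definition partial :: "'n::finite \<Rightarrow> (real ^ 'n \<Rightarrow> real) \<Rightarrow> real ^ 'n \<Rightarrow> real" where
  "partial i f x = deriv (\<lambda>t. f (x + t *\<^sub>R axis i 1)) 0"

text \<open>Mixed partial derivatives are indexed by lists of coordinate directions, so that the order
  of the derivative is the length of the list.\<close>

definition partials :: "'n::finite list \<Rightarrow> (real ^ 'n \<Rightarrow> real) \<Rightarrow> real ^ 'n \<Rightarrow> real" where
  "partials is f = foldr partial is f"

definition laplacian :: "(real ^ 'n::finite \<Rightarrow> real) \<Rightarrow> real ^ 'n \<Rightarrow> real" where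
  "laplacian f x = (\<Sum>i\<in>UNIV. partial i (partial i f) x)"

definition bilaplacian :: "(real ^ 'n::finite \<Rightarrow> real) \<Rightarrow> real ^ 'n \<Rightarrow> real" where
  "bilaplacian f = laplacian (laplacian f)"

text \<open>The space \<open>C\<^sup>k\<close> of the closure of an open set \<open>\<Omega>\<close>: all partial derivatives of order at most
  \<open>k\<close> exist in \<open>\<Omega>\<close> and extend continuously to the closure. Since \<^const>\<open>deriv\<close> is total, existence
  is expressed by differentiability of the derivatives of order less than \<open>k\<close>. The values of \<open>f\<close>
  outside the closure play no role.\<close>

definition C_closure :: "nat \<Rightarrow> (real ^ 'n::finite) set \<Rightarrow> (real ^ 'n \<Rightarrow> real) set" where
  "C_closure k \<Omega> = {f. continuous_on (closure \<Omega>) f \<and>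
     (\<forall>is. length is < k \<longrightarrow> partials is f differentiable_on \<Omega>) \<and>
     (\<forall>is. length is \<le> k \<longrightarrow>
        (\<exists>g. continuous_on (closure \<Omega>) g \<and> (\<forall>x\<in>\<Omega>. g x = partials is f x)))}"

text \<open>Smooth functions on the whole space with compact support in \<open>\<Omega>\<close>.\<close>

definition test_functions :: "(real ^ 'n::finite) set \<Rightarrow> (real ^ 'n \<Rightarrow> real) set" where
  "test_functions \<Omega> = {\<psi>. (\<forall>is. partials is \<psi> differentiable_on UNIV) \<and>
     (\<exists>K. compact K \<and> K \<subseteq> \<Omega> \<and> (\<forall>x. x \<notin> K \<longrightarrow> \<psi> x = 0))}"

definition L2 :: "(real ^ 'n::finite) set \<Rightarrow> (real ^ 'n \<Rightarrow> real) set" where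
  "L2 \<Omega> = {f. f \<in> borel_measurable (lebesgue_on \<Omega>) \<and> integrable (lebesgue_on \<Omega>) (\<lambda>x. (f x)\<^sup>2)}"

definition weak_derivative ::
    "(real ^ 'n::finite) set \<Rightarrow> 'n list \<Rightarrow> (real ^ 'n \<Rightarrow> real) \<Rightarrow> (real ^ 'n \<Rightarrow> real) \<Rightarrow> bool" where
  "weak_derivative \<Omega> is f g \<longleftrightarrow> (\<forall>\<psi>\<in>test_functions \<Omega>.
     (LINT x|lebesgue_on \<Omega>. f x * partials is \<psi> x)
       = (- 1) ^ length is * (LINT x|lebesgue_on \<Omega>. g x * \<psi> x))"

text \<open>The Sobolev space \<open>H\<^sub>0\<^sup>k(\<Omega>)\<close>: the closure of the test functions with respect to the norm of
  \<open>H\<^sup>k(\<Omega>)\<close>; \<open>g is\<close> are the weak derivatives of \<open>f\<close>.\<close>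

definition H0 :: "nat \<Rightarrow> (real ^ 'n::finite) set \<Rightarrow> (real ^ 'n \<Rightarrow> real) set" where
  "H0 k \<Omega> = {f. f \<in> L2 \<Omega> \<and>
     (\<exists>g. (\<forall>is. length is \<le> k \<longrightarrow> g is \<in> L2 \<Omega> \<and> weak_derivative \<Omega> is f (g is)) \<and>
        (\<exists>\<psi> :: nat \<Rightarrow> real ^ 'n \<Rightarrow> real. (\<forall>m. \<psi> m \<in> test_functions \<Omega>) \<and>
           (\<forall>is. length is \<le> k \<longrightarrow>
              (\<lambda>m. LINT x|lebesgue_on \<Omega>. (partials is (\<psi> m) x - g is x)\<^sup>2) \<longlonglongrightarrow> 0)))}"

abbreviation unit_ball :: "(real ^ 'n::finite) set" where
  "unit_ball \<equiv> ball 0 1"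

text \<open>At a point \<open>x\<close> of the unit sphere the exterior normal is \<open>x\<close> itself; the derivative is
  one-sided because \<open>u\<close> is only relevant on the closed ball.\<close>

definition has_normal_derivative ::
    "(real ^ 'n::finite \<Rightarrow> real) \<Rightarrow> real \<Rightarrow> real ^ 'n \<Rightarrow> bool" where
  "has_normal_derivative u d x \<longleftrightarrow> ((\<lambda>t. u (x + t *\<^sub>R x)) has_real_derivative d) (at_left 0)"

text \<open>In both notions of solution \<open>u x \<noteq> 1\<close> is required (everywhere, respectively almost everywhere)
  because \<open>1 / (1 - u)\<close> is understood as \<open>\<infinity>\<close>, not as \<open>0\<close>, where \<open>u = 1\<close>.\<close>

definition classical_solution :: "real \<Rightarrow> (real ^ 'n::finite \<Rightarrow> real) \<Rightarrow> bool" where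
  "classical_solution lam u \<longleftrightarrow> u \<in> C_closure 4 unit_ball \<and>
     (\<forall>x\<in>unit_ball. 0 < u x \<and> u x \<le> 1 \<and> u x \<noteq> 1 \<and> bilaplacian u x = lam / (1 - u x)) \<and>
     (\<forall>x\<in>sphere 0 1. u x = 0 \<and> has_normal_derivative u 0 x)"

definition weak_solution :: "real \<Rightarrow> (real ^ 'n::finite \<Rightarrow> real) \<Rightarrow> bool" where
  "weak_solution lam u \<longleftrightarrow>
     integrable (lebesgue_on unit_ball) u \<and>
     (AE x in lebesgue_on unit_ball. 0 \<le> u x \<and> u x \<le> 1 \<and> u x \<noteq> 1) \<and>
     integrable (lebesgue_on unit_ball) (\<lambda>x. 1 / (1 - u x)) \<and>
     (\<forall>\<phi> \<in> C_closure 4 unit_ball \<inter> H0 2 unit_ball.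
        (LINT x|lebesgue_on unit_ball. u x * bilaplacian \<phi> x)
          = lam * (LINT x|lebesgue_on unit_ball. \<phi> x / (1 - u x)))"

definition minimal_solution :: "real \<Rightarrow> (real ^ 'n::finite \<Rightarrow> real) \<Rightarrow> bool" where
  "minimal_solution lam u \<longleftrightarrow> weak_solution lam u \<and>
     (\<forall>v. weak_solution lam v \<longrightarrow> (AE x in lebesgue_on unit_ball. u x \<le> v x))"

text \<open>The supremum is taken in the extended reals, so that it is meaningful without a proof that
  the set is bounded. The dimension is passed as a type.\<close>

definition lambda_star :: "'n::finite itself \<Rightarrow> ereal" where
  "lambda_star _ = Sup {ereal lam |lam. 0 \<le> lam \<and> (\<exists>u :: real ^ 'n \<Rightarrow> real. weak_solution lam u)}"

definition V :: "real \<Rightarrow> real ^ 'n::finite \<Rightarrow> real" where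
  "V lam x = lam / (8 * real CARD('n) * (real CARD('n) + 2)) * (1 - (norm x)\<^sup>2)\<^sup>2"

end

theory Submission
  imports Defs
begin

text \<open>For radial data the Dirichlet problem for \<open>\<Delta>\<^sup>2\<close> on the ball is solved by iterated integration, and
  the solution operator \<open>G\<close> is visibly monotone; neither Boggio's Green function nor polar coordinates
  are needed. Integration by parts against radial functions shows
  \<open>\<integral> f \<phi> = \<integral> G f \<cdot> \<Delta>\<^sup>2\<phi>\<close> for every \<open>\<phi> \<in> C\<^sup>4\<close> with Dirichlet data, in the classical sense or in the
  sense of \<open>H\<^sub>0\<^sup>2\<close>, and that \<open>G\<close> is symmetric.

  The radial iterates \<open>v\<^sub>0 = 0\<close>, \<open>v\<^sub>k\<^sub>+\<^sub>1 = \<lambda> G(1 / (1 - v\<^sub>k))\<close> increase. If \<open>u\<close> is a classical solution,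
  then \<open>\<integral> v\<^sub>k \<xi> \<le> \<integral> u \<xi>\<close> for all radial \<open>\<xi> \<ge> 0\<close>, so the iterates stay below \<open>max u < 1\<close> and converge
  to a weak solution \<open>w\<close> with \<open>\<integral> w \<le> \<integral> u\<close>. Minimality of \<open>u\<close> gives \<open>u \<le> w\<close> almost everywhere, whence
  \<open>u = w\<close>. Now \<open>V\<^sub>\<lambda> = v\<^sub>1 < v\<^sub>2 \<le> u\<close>; and for \<open>\<lambda> \<le> 1\<close> all iterates are at most \<open>\<lambda> / 12\<close>, so that the limit
  exists (hence \<open>\<lambda>\<^sup>* \<ge> 1\<close>) and \<open>u \<le> V\<^sub>\<lambda> / (1 - \<lambda> / 12)\<close>.\<close>

section \<open>Integration by parts on the unit ball\<close>

text \<open>The bilaplacian is split into Delta eta = f and Delta z = eta. Each radial problem is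
  solved by integration, and the free additive constant in eta is spent on giving eta mean zero over
  the unit ball. By the divergence theorem this says that the normal derivative of z vanishes on the
  sphere, so z(1) = 0 and z'(1) = 0 hold together. When Delta^2 is moved from phi to z, the first of
  the two integrations by parts has no boundary term, because z and z' vanish. In the second one eta
  does not vanish on the sphere, so the boundary data of phi must enter. They come in two different
  forms: pointwise values for the classical solution, and approximation by test functions for the
  members of H_0^2 that define weak solutions. No trace theorem connects the two forms; the second
  integration is carried out twice, once with a cutoff and once through the approximating
  sequence.\<close>

lemma abs_diff_le_of_derivative_bound:
  fixes f f' :: "real \<Rightarrow> real"
  assumes "finite S" "a \<le> b" "continuous_on {a..b} f"
    and d: "\<And>x. a < x \<Longrightarrow> x < b \<Longrightarrow> x \<notin> S \<Longrightarrow> (f has_real_derivative f' x) (at x)"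
    and C: "\<And>x. a < x \<Longrightarrow> x < b \<Longrightarrow> x \<notin> S \<Longrightarrow> \<bar>f' x\<bar> \<le> C" and "0 \<le> C"
  shows "\<bar>f b - f a\<bar> \<le> C * (b - a)"
proof -
  define g where "g x = (if a < x \<and> x < b \<and> x \<notin> S then f' x else 0)" for x
  have "(g has_integral (f b - f a)) {a..b}"
    by (rule fundamental_theorem_of_calculus_interior_strong[OF \<open>finite S\<close> \<open>a \<le> b\<close> _ assms(3)])
       (use d in \<open>auto simp: g_def has_real_derivative_iff_has_vector_derivative\<close>)
  moreover have "\<bar>g x\<bar> \<le> C" for x using C \<open>0 \<le> C\<close> by (auto simp: g_def)
  ultimately show ?thesis
    using has_integral_bound[of C g "f b - f a" a b] assms(2,6) by auto
qed

text \<open>Along the line, |.|^2 is (t + x_i)^2 plus the squared distance of the line from the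
  origin, so the sphere is met at most twice. These points and the origin are where a radial
  function, extended by zero, may fail to be differentiable along an axis.\<close>

lemma finite_line_sphere:
  fixes x :: "real ^ 'n::finite"
  shows "finite {t. x + t *\<^sub>R axis i 1 \<in> sphere 0 1 \<union> {0}}"
proof -
  have n2: "(norm (x + t *\<^sub>R axis i 1))\<^sup>2 = (t + x $ i)\<^sup>2 + ((norm x)\<^sup>2 - (x $ i)\<^sup>2)" for t
    unfolding power2_norm_eq_inner
    by (simp add: inner_add_left inner_add_right inner_axis inner_axis' power2_eq_square algebra_simps)
  define A where "A = 1 - ((norm x)\<^sup>2 - (x $ i)\<^sup>2)"
  have "{t. x + t *\<^sub>R axis i 1 \<in> sphere 0 1 \<union> {0}} \<subseteq> {- (x $ i) + sqrt A, - (x $ i) - sqrt A, - (x $ i)}"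
  proof
    fix t assume "t \<in> {t. x + t *\<^sub>R axis i 1 \<in> sphere 0 1 \<union> {0}}"
    then consider "norm (x + t *\<^sub>R axis i 1) = 1" | "x + t *\<^sub>R axis i 1 = 0" by auto
    then show "t \<in> {- (x $ i) + sqrt A, - (x $ i) - sqrt A, - (x $ i)}"
    proof cases
      case 1
      then have "(t + x $ i)\<^sup>2 = A" using n2[of t] by (simp add: A_def)
      then have "\<bar>t + x $ i\<bar> = sqrt A" by (metis real_sqrt_abs)
      then show ?thesis by (auto simp: abs_if split: if_splits)
    next
      case 2
      then have "(x + t *\<^sub>R axis i 1) $ i = 0" by simp
      then show ?thesis by simp
    qed
  qed
  then show ?thesis by (rule finite_subset) simp
qed

lemma continuous_on_extend_zero:
  fixes h :: "real ^ 'n::finite \<Rightarrow> real"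
  assumes "continuous_on (cball 0 1) h" "\<And>x. norm x = 1 \<Longrightarrow> h x = 0"
  shows "continuous_on UNIV (\<lambda>x. if x \<in> cball 0 1 then h x else 0)"
proof -
  have "continuous_on (cball 0 1 \<union> - ball 0 1) (\<lambda>x. if x \<in> cball 0 1 then h x else 0)"
    by (rule continuous_on_cases[OF _ _ assms(1)]) (use assms(2) in \<open>auto simp: closed_Compl\<close>)
  moreover have "cball 0 1 \<union> - ball 0 1 = (UNIV :: (real^'n) set)" by auto
  ultimately show ?thesis by simp
qed

lemma derivative_along_cong:
  fixes f g :: "real ^ 'n::finite \<Rightarrow> real"
  assumes "open S" "x \<in> S" "\<And>y. y \<in> S \<Longrightarrow> f y = g y"
    and "((\<lambda>t. f (x + t *\<^sub>R v)) has_real_derivative d) (at 0)"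
  shows "((\<lambda>t. g (x + t *\<^sub>R v)) has_real_derivative d) (at 0)"
proof -
  have "((\<lambda>t. x + t *\<^sub>R v) \<longlongrightarrow> x + 0 *\<^sub>R v) (at 0)" by (intro tendsto_intros)
  then have "\<forall>\<^sub>F t in at 0. x + t *\<^sub>R v \<in> S" using assms(1,2) by (auto elim!: topological_tendstoD)
  then have "\<forall>\<^sub>F t in nhds 0. x + t *\<^sub>R v \<in> S"
    using assms(2) by (simp add: eventually_nhds_conv_at)
  then have "\<forall>\<^sub>F t in nhds 0. f (x + t *\<^sub>R v) = g (x + t *\<^sub>R v)"
    by eventually_elim (use assms(3) in auto)
  then show ?thesis using assms(4) DERIV_cong_ev[OF refl _ refl] by fast
qed

text \<open>The integral of the difference quotient of a compactly supported function vanishes by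
  translation invariance, which replaces Fubini's theorem here.\<close>

lemma integral_derivative_along_axis:
  fixes h D :: "real ^ 'n::finite \<Rightarrow> real"
  assumes h: "continuous_on (cball 0 1) h" and z: "\<And>x. norm x = 1 \<Longrightarrow> h x = 0"
    and d: "\<And>x. norm x < 1 \<Longrightarrow> x \<noteq> 0 \<Longrightarrow> ((\<lambda>t. h (x + t *\<^sub>R axis i 1)) has_real_derivative D x) (at 0)"
    and C: "\<And>x. norm x < 1 \<Longrightarrow> x \<noteq> 0 \<Longrightarrow> \<bar>D x\<bar> \<le> C"
  shows "integrable (lebesgue_on unit_ball) D" "(LINT x|lebesgue_on unit_ball. D x) = 0"
proof -
  let ?e = "axis i 1 :: real ^ 'n"
  \<comment> \<open>The zero extension lives on the whole space, where translation invariance is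
    available. It is continuous because \<open>h\<close> vanishes on the sphere, and its derivative
    along the axis is \<open>D'\<close> off the sphere and the origin.\<close>
  define H where "H x = (if x \<in> cball 0 1 then h x else 0)" for x
  define B where "B = max C 0"
  have B: "0 \<le> B" "\<And>x. norm x < 1 \<Longrightarrow> x \<noteq> 0 \<Longrightarrow> \<bar>D x\<bar> \<le> B"
    using C by (auto simp: B_def intro: order_trans[OF C])
  have Hc: "continuous_on UNIV H" unfolding H_def by (rule continuous_on_extend_zero[OF h z])
  define D' where "D' x = (if norm x < 1 then D x else 0)" for x
  let ?S = "sphere 0 1 \<union> {0} :: (real^'n) set"
  have dH: "((\<lambda>t. H (x + t *\<^sub>R ?e)) has_real_derivative D' x) (at 0)" if "x \<notin> ?S" for x
  proof (cases "norm x < 1")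
    case True
    show ?thesis
      by (rule derivative_along_cong[of "ball 0 1" x h]) (use d[of x] True that in \<open>auto simp: H_def D'_def\<close>)
  next
    case False
    show ?thesis
      by (rule derivative_along_cong[of "- cball 0 1" x "\<lambda>_. 0"])
        (use False that in \<open>auto simp: H_def D'_def closed_Compl\<close>)
  qed
  have D'B: "\<bar>D' x\<bar> \<le> B" if "x \<notin> ?S" for x using B that by (auto simp: D'_def)
  \<comment> \<open>The finitely many exceptional points on the line do not spoil the Lipschitz
    bound, so the difference quotients are bounded uniformly in the step size.\<close>
  have lip: "\<bar>H (x + t *\<^sub>R ?e) - H x\<bar> \<le> B * t" if "0 \<le> t" for x t
  proof -
    have "\<bar>(\<lambda>s. H (x + s *\<^sub>R ?e)) t - (\<lambda>s. H (x + s *\<^sub>R ?e)) 0\<bar> \<le> B * (t - 0)"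
    proof (rule abs_diff_le_of_derivative_bound[OF finite_line_sphere[of x i] that])
      show "continuous_on {0..t} (\<lambda>s. H (x + s *\<^sub>R ?e))"
        by (rule continuous_on_compose2[OF Hc]) (auto intro!: continuous_intros)
      fix s assume "s \<notin> {t. x + t *\<^sub>R ?e \<in> ?S}"
      then have *: "x + s *\<^sub>R ?e \<notin> ?S" by auto
      show "((\<lambda>s. H (x + s *\<^sub>R ?e)) has_real_derivative D' (x + s *\<^sub>R ?e)) (at s)"
        using dH[OF *] DERIV_shift[of "\<lambda>s. H (x + s *\<^sub>R ?e)" "D' (x + s *\<^sub>R ?e)" 0 s]
        by (simp add: algebra_simps)
      show "\<bar>D' (x + s *\<^sub>R ?e)\<bar> \<le> B" by (rule D'B[OF *])
    qed (use B in auto)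
    then show ?thesis by simp
  qed
  define e where "e j = 1 / real (Suc j)" for j :: nat
  have e: "0 < e j" "e j \<le> 1" for j by (auto simp: e_def)
  have e0: "e \<longlonglongrightarrow> 0" unfolding e_def by (rule LIMSEQ_Suc[OF lim_1_over_n])
  define s where "s j x = (H (x + e j *\<^sub>R ?e) - H x) / e j" for j x
  \<comment> \<open>On the null set \<open>?S\<close> the quotients are overwritten so that they
    converge to \<open>D'\<close> at every point. This makes \<open>D'\<close> Borel measurable as a
    pointwise limit, although nothing is assumed about the measurability of \<open>D\<close> or its
    value at the origin.\<close>
  define s' where "s' j x = s j x * indicator (- ?S) x + D' 0 * indicator {0} x" for j x
  have "sphere (0::real^'n) 1 \<in> null_sets lborel"
    using negligible_sphere[of "0::real^'n" 1]
    by (auto simp: null_sets_completion_iff negligible_iff_null_sets)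
  moreover have "{0::real^'n} \<in> null_sets lborel" by (simp add: null_sets_def)
  ultimately have nulS: "?S \<in> null_sets lborel" by (rule null_sets.Un)
  have Hm: "H \<in> borel_measurable borel" using Hc by (rule borel_measurable_continuous_onI)
  have sm: "s j \<in> borel_measurable borel" for j
    unfolding s_def
    by (intro borel_measurable_divide borel_measurable_diff Hm borel_measurable_const
       measurable_compose[OF _ Hm]) (auto intro!: borel_measurable_continuous_onI continuous_intros)
  have s'm: "s' j \<in> borel_measurable lborel" for j
    unfolding s'_def using sm[of j] by measurable
  have lim: "(\<lambda>j. s' j x) \<longlonglongrightarrow> (if x \<in> sphere 0 1 then 0 else D' x)" for x
  proof (cases "x \<in> ?S")
    case True
    then show ?thesis by (cases "x = 0") (auto simp: s'_def D'_def)
  next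
    case False
    have "(\<lambda>j. (H (x + e j *\<^sub>R ?e) - H (x + 0 *\<^sub>R ?e)) / e j) \<longlonglongrightarrow> D' x"
      using dH[OF False, unfolded DERIV_def] e e0
      by (auto simp: LIMSEQ_def LIM_def tendsto_at_iff_sequentially o_def less_imp_neq[symmetric])
    then show ?thesis using False by (auto simp: s'_def s_def)
  qed
  have D's: "(if x \<in> sphere 0 1 then 0 else D' x) = D' x" for x by (auto simp: D'_def)
  have D'm: "D' \<in> borel_measurable lborel"
    by (rule borel_measurable_LIMSEQ_real[OF _ s'm]) (use lim D's in auto)
  have Hint: "integrable lborel H"
  proof -
    have "integrable lborel (\<lambda>x. indicator (cball 0 1) x *\<^sub>R H x)"
      by (rule borel_integrable_compact[OF compact_cball]) (use Hc continuous_on_subset in blast)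
    moreover have "(\<lambda>x. indicator (cball 0 1) x *\<^sub>R H x) = H"
      by (auto simp: H_def indicator_def)
    ultimately show ?thesis by simp
  qed
  have trans: "integrable lborel (\<lambda>x. H (x + v))" "(LINT x|lborel. H (x + v)) = (LINT x|lborel. H x)" for v
  proof -
    have "integrable (distr lborel borel ((+) v)) H" using Hint by (simp add: lborel_distr_plus)
    then show "integrable lborel (\<lambda>x. H (x + v))"
      by (subst (asm) integrable_distr_eq) (use Hm in \<open>auto simp: add.commute\<close>)
    have "(LINT x|distr lborel borel ((+) v). H x) = (LINT x|lborel. H (v + x))"
      by (subst integral_distr) (use Hm in auto)
    then show "(LINT x|lborel. H (x + v)) = (LINT x|lborel. H x)"
      by (simp add: lborel_distr_plus add.commute)
  qed
  have int_s: "(LINT x|lborel. s j x) = 0" for j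
    unfolding s_def using trans Hint by (simp add: Bochner_Integration.integral_diff)
  have ae: "AE x in lborel. x \<notin> ?S" using nulS by (rule AE_not_in)
  have int_s': "(LINT x|lborel. s' j x) = 0" for j
  proof -
    have "(LINT x|lborel. s' j x) = (LINT x|lborel. s j x)"
    proof (rule integral_cong_AE)
      show "AE x in lborel. s' j x = s j x"
        using ae by eventually_elim (auto simp: s'_def indicator_def)
    qed (use s'm sm in auto)
    then show ?thesis using int_s by simp
  qed
  \<comment> \<open>Radius 2 suffices since the steps \<open>e j\<close> are at most 1 and
    \<open>H\<close> vanishes outside the unit ball; the summand with \<open>D' 0\<close> covers the
    overwritten value at the origin.\<close>
  have dom: "norm (s' j x) \<le> (B + \<bar>D' 0\<bar>) * indicator (cball 0 2) x" for j x
  proof (cases "norm x \<le> 2")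
    case True
    have "\<bar>s j x\<bar> \<le> B" using lip[of "e j" x] e[of j] by (auto simp: s_def field_simps)
    then show ?thesis using True B by (auto simp: s'_def indicator_def)
  next
    case False
    have "norm x \<le> norm (x + e j *\<^sub>R ?e) + e j"
      using norm_triangle_ineq4[of "x + e j *\<^sub>R ?e" "e j *\<^sub>R ?e"] e[of j] by simp
    then have "norm (x + e j *\<^sub>R ?e) > 1" using False e[of j] by linarith
    then show ?thesis using False by (auto simp: s'_def s_def H_def indicator_def)
  qed
  have domi: "integrable lborel (\<lambda>x::real^'n. (B + \<bar>D' 0\<bar>) * indicator (cball 0 2) x)"
    by (intro integrable_mult_right integrable_real_indicator) (use emeasure_lborel_cball_finite[of "0::real^'n" 2] in auto)
  have Lint: "integrable lborel D'"
    by (rule integrable_dominated_convergence[where s = s', OF D'm s'm domi]) (use lim D's dom in auto)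
  have "(\<lambda>j. LINT x|lborel. s' j x) \<longlonglongrightarrow> (LINT x|lborel. D' x)"
    by (rule integral_dominated_convergence[OF D'm s'm domi]) (use lim D's dom in auto)
  then have L0: "(LINT x|lborel. D' x) = 0" using int_s' by (simp add: LIMSEQ_const_iff)
  have eq: "(\<lambda>x. indicator (ball 0 1) x *\<^sub>R D x) = D'" by (auto simp: D'_def indicator_def)
  show "integrable (lebesgue_on unit_ball) D"
    using Lint by (subst integrable_restrict_space) (use D'm in \<open>auto simp: eq[simplified] integrable_completion\<close>)
  show "(LINT x|lebesgue_on unit_ball. D x) = 0"
    using L0 Lint by (subst integral_restrict_space) (use D'm in \<open>auto simp: eq[simplified] integral_completion\<close>)
qed

text \<open>Values of \<open>f\<close> on the sphere are ignored, because \<open>partials\<close> is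
  built from \<open>deriv\<close> and its values there depend on the arbitrary values of the
  function outside the ball. Boundedness, measurability and integrability on the ball are all drawn
  from this one property.\<close>

definition has_continuous_extension :: "(real ^ 'n::finite \<Rightarrow> real) \<Rightarrow> bool" where
  "has_continuous_extension f \<longleftrightarrow>
     (\<exists>g. continuous_on (cball 0 1) g \<and> (\<forall>x\<in>unit_ball. g x = f x))"

lemma has_continuous_extensionI:
  "continuous_on (cball 0 1) g \<Longrightarrow> (\<And>x. norm x < 1 \<Longrightarrow> g x = f x) \<Longrightarrow> has_continuous_extension f"
  unfolding has_continuous_extension_def by (intro exI[of _ g]) auto

lemma has_continuous_extensionE:
  assumes "has_continuous_extension f"
  obtains g where "continuous_on (cball 0 1) g" "\<And>x. norm x < 1 \<Longrightarrow> g x = f x"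
  using assms unfolding has_continuous_extension_def by auto

lemma has_continuous_extension_mult:
  assumes "has_continuous_extension f" "has_continuous_extension g"
  shows "has_continuous_extension (\<lambda>x. f x * g x)"
  using assms
  by (elim has_continuous_extensionE)
     (rule has_continuous_extensionI, erule (1) continuous_on_mult, auto)

lemma has_continuous_extension_add:
  assumes "has_continuous_extension f" "has_continuous_extension g"
  shows "has_continuous_extension (\<lambda>x. f x + g x)"
  using assms
  by (elim has_continuous_extensionE)
     (rule has_continuous_extensionI, erule (1) continuous_on_add, auto)

lemma has_continuous_extension_const: "has_continuous_extension (\<lambda>x. c)"
  by (rule has_continuous_extensionI[of "\<lambda>x. c"]) auto

lemma has_continuous_extension_sum:
  assumes "finite A" "\<And>i. i \<in> A \<Longrightarrow> has_continuous_extension (f i)"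
  shows "has_continuous_extension (\<lambda>x. \<Sum>i\<in>A. f i x)"
  using assms
  by (induction A) (auto intro: has_continuous_extension_const has_continuous_extension_add)

lemma has_continuous_extension_cong:
  assumes "has_continuous_extension f" "\<And>x. norm x < 1 \<Longrightarrow> f x = g x"
  shows "has_continuous_extension g"
  using assms by (metis has_continuous_extensionE has_continuous_extensionI)

lemma has_continuous_extension_bounded:
  assumes "has_continuous_extension f"
  obtains C where "0 \<le> C" "\<And>x. norm x < 1 \<Longrightarrow> \<bar>f x\<bar> \<le> C"
proof -
  obtain g where g: "continuous_on (cball 0 1) g" "\<And>x. norm x < 1 \<Longrightarrow> g x = f x"
    using assms by (rule has_continuous_extensionE) blast
  have "bounded (g ` cball 0 1)"
    by (rule compact_imp_bounded, rule compact_continuous_image) (use g in auto)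
  then obtain C where C: "\<And>x. x \<in> cball 0 1 \<Longrightarrow> \<bar>g x\<bar> \<le> C"
    unfolding bounded_iff real_norm_def by blast
  have "0 \<le> C" using order_trans[OF abs_ge_zero C[of 0]] by simp
  with that[of C] C g(2) show ?thesis by (metis less_imp_le mem_cball_0)
qed

lemma has_continuous_extension_measurable:
  assumes "has_continuous_extension f"
  shows "f \<in> borel_measurable (lebesgue_on unit_ball)"
proof -
  obtain g where g: "continuous_on (cball 0 1) g" "\<And>x. norm x < 1 \<Longrightarrow> g x = f x"
    using assms by (rule has_continuous_extensionE) blast
  have "continuous_on unit_ball f"
    using continuous_on_subset[OF g(1), of unit_ball] g(2)
    by (subst continuous_on_cong[of _ unit_ball _ g]) auto
  then show ?thesis by (rule continuous_imp_measurable_on_sets_lebesgue) auto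
qed

lemma finite_measure_ball: "finite_measure (lebesgue_on (unit_ball :: (real ^ 'n::finite) set))"
  by (rule finite_measure_lebesgue_on) auto

lemma integrable_ball_bounded:
  fixes f :: "real ^ 'n::finite \<Rightarrow> real"
  assumes "f \<in> borel_measurable (lebesgue_on unit_ball)" "\<And>x. norm x < 1 \<Longrightarrow> \<bar>f x\<bar> \<le> C"
  shows "integrable (lebesgue_on unit_ball) f"
  by (rule finite_measure.integrable_const_bound[OF finite_measure_ball, of _ C])
     (use assms in \<open>auto simp: space_restrict_space\<close>)

lemma has_continuous_extension_integrable:
  assumes "has_continuous_extension f"
  shows "integrable (lebesgue_on unit_ball) f"
  using has_continuous_extension_bounded[OF assms] has_continuous_extension_measurable[OF assms]
  by (metis integrable_ball_bounded)

section \<open>Green's identities with a radial factor\<close>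

lemma continuous_on_radial:
  fixes z :: "real \<Rightarrow> real"
  assumes "continuous_on {0..1} z"
  shows "continuous_on (cball 0 1) (\<lambda>x::real ^ 'n::finite. z (norm x))"
  by (rule continuous_on_compose2[OF assms]) (auto intro!: continuous_intros)

lemma has_continuous_extension_radial:
  assumes "continuous_on {0..1} z"
  shows "has_continuous_extension (\<lambda>x. z (norm x))"
  by (rule has_continuous_extensionI[OF continuous_on_radial[OF assms]]) auto

lemma DERIV_norm_along_axis:
  fixes x :: "real ^ 'n::finite"
  assumes "x \<noteq> 0"
  shows "((\<lambda>t. norm (x + t *\<^sub>R axis i 1)) has_real_derivative x $ i / norm x) (at 0)"
proof -
  have "((\<lambda>t. x + t *\<^sub>R axis i 1) has_derivative (\<lambda>t. t *\<^sub>R axis i 1)) (at 0)"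
    by (auto intro!: derivative_eq_intros)
  moreover have "(norm has_derivative (\<lambda>y. y \<bullet> sgn x)) (at (x + 0 *\<^sub>R axis i 1))"
    using has_derivative_norm[OF assms] by (simp add: inner_commute)
  ultimately have "((\<lambda>t. norm (x + t *\<^sub>R axis i 1)) has_derivative (\<lambda>t. (t *\<^sub>R axis i 1) \<bullet> sgn x)) (at 0)"
    by (rule has_derivative_compose)
  moreover have "(\<lambda>t. (t *\<^sub>R axis i 1) \<bullet> sgn x) = (*) (x $ i / norm x)"
    by (simp add: fun_eq_iff sgn_div_norm inner_axis' divide_inverse mult_ac)
  ultimately show ?thesis by (simp add: has_field_derivative_def)
qed

lemma has_continuous_extension_coord: "has_continuous_extension (\<lambda>x::real ^ 'n::finite. x $ i)"
  by (rule has_continuous_extensionI[of "\<lambda>x. x $ i"]) (auto intro!: continuous_intros)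

lemma DERIV_radial_along_axis:
  fixes x :: "real ^ 'n::finite"
  assumes "x \<noteq> 0" "(z has_real_derivative d) (at (norm x))"
  shows "((\<lambda>t. z (norm (x + t *\<^sub>R axis i 1))) has_real_derivative d * (x $ i / norm x)) (at 0)"
  using DERIV_chain[of z d "\<lambda>t. norm (x + t *\<^sub>R axis i 1)" 0, OF _ DERIV_norm_along_axis[OF assms(1)]] assms(2)
  by (simp add: o_def)

text \<open>Since the gradient of z(|x|) is x l(|x|), the i-th summand is the i-th partial
  derivative of z(|x|) times \<open>G1 i\<close>. The condition \<open>bd\<close> kills the boundary
  term through either factor, which serves both radial functions vanishing on the sphere and test
  functions.\<close>

lemma integral_radial_gradient:
  fixes G1 G2 :: "'n::finite \<Rightarrow> real ^ 'n \<Rightarrow> real"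
  assumes z: "continuous_on {0..1} z" and l: "continuous_on {0..1} l"
    and dz: "\<And>r. 0 < r \<Longrightarrow> r < 1 \<Longrightarrow> (z has_real_derivative r * l r) (at r)"
    and G1: "\<And>i. continuous_on (cball 0 1) (G1 i)"
    and G2: "\<And>i. has_continuous_extension (G2 i)"
    and dG: "\<And>i x. norm x < 1 \<Longrightarrow> ((\<lambda>t. G1 i (x + t *\<^sub>R axis i 1)) has_real_derivative G2 i x) (at 0)"
    and bd: "\<And>i x. norm x = 1 \<Longrightarrow> z 1 * G1 i x = 0"
  shows "(LINT x|lebesgue_on unit_ball. (\<Sum>i\<in>UNIV. l (norm x) * (x $ i * G1 i x) + z (norm x) * G2 i x)) = 0"
proof -
  let ?D = "\<lambda>i x. l (norm x) * (x $ i * G1 i x) + z (norm x) * G2 i x"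
  have G1': "has_continuous_extension (G1 i)" for i by (rule has_continuous_extensionI[OF G1]) auto
  have "integrable (lebesgue_on unit_ball) (?D i) \<and> (LINT x|lebesgue_on unit_ball. ?D i x) = 0" for i
  proof -
    have "has_continuous_extension (?D i)"
      by (intro has_continuous_extension_add has_continuous_extension_mult
          has_continuous_extension_radial z l G2 G1' has_continuous_extension_coord)
    then obtain C where C: "\<And>x. norm x < 1 \<Longrightarrow> \<bar>?D i x\<bar> \<le> C"
      by (rule has_continuous_extension_bounded) blast
    have d: "((\<lambda>t. z (norm (x + t *\<^sub>R axis i 1)) * G1 i (x + t *\<^sub>R axis i 1)) has_real_derivative ?D i x) (at 0)"
      if "norm x < 1" "x \<noteq> 0" for x
      using DERIV_mult[OF DERIV_radial_along_axis[OF that(2) dz[of "norm x"]] dG[OF that(1), of i]] that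
      by (simp add: field_simps)
    have c: "continuous_on (cball 0 1) (\<lambda>x. z (norm x) * G1 i x)"
      by (intro continuous_on_mult continuous_on_radial z G1)
    show ?thesis
      by (rule conjI; rule integral_derivative_along_axis[OF c _ d C]; use bd in auto)
  qed
  then show ?thesis by (simp add: Bochner_Integration.integral_sum)
qed

lemma sum_coord_squares: "(\<Sum>i\<in>UNIV. (x $ i)\<^sup>2) = (norm (x :: real ^ 'n::finite))\<^sup>2"
  by (simp add: norm_vec_def L2_set_def sum_nonneg)

text \<open>The integrand is the divergence of the field x l(|x|) G(x): the radial part contributes
  n l + r l', which is m by \<open>dl\<close>, and the other part is l x . grad G.\<close>

lemma integral_radial_divergence:
  fixes G :: "real ^ 'n::finite \<Rightarrow> real" and G1 :: "'n \<Rightarrow> real ^ 'n \<Rightarrow> real"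
  assumes l: "continuous_on {0..1} l" and m: "continuous_on {0..1} m"
    and dl: "\<And>r. 0 < r \<Longrightarrow> r < 1 \<Longrightarrow> (l has_real_derivative (m r - real CARD('n) * l r) / r) (at r)"
    and G: "continuous_on (cball 0 1) G"
    and G1: "\<And>i. has_continuous_extension (G1 i)"
    and dG: "\<And>i x. norm x < 1 \<Longrightarrow> ((\<lambda>t. G (x + t *\<^sub>R axis i 1)) has_real_derivative G1 i x) (at 0)"
    and bd: "\<And>x. norm x = 1 \<Longrightarrow> l 1 * G x = 0"
  shows "(LINT x|lebesgue_on unit_ball. (\<Sum>i\<in>UNIV. l (norm x) * (x $ i * G1 i x)) + m (norm x) * G x) = 0"
proof -
  define n where "n = real CARD('n)"
  have n: "n \<ge> 1" by (simp add: n_def Suc_leI)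
  \<comment> \<open>For nonzero x this is the i-th partial derivative of
    \<open>x $ i * l (norm x)\<close>. The value at the origin is chosen so that the sum over i
    equals m there as well.\<close>
  define q where "q i x = (if x = 0 then m 0 / n else
      l (norm x) + (x $ i)\<^sup>2 / (norm x)\<^sup>2 * (m (norm x) - n * l (norm x)))" for i and x :: "real ^ 'n"
  have q: "(\<Sum>i\<in>UNIV. q i x) = m (norm x)" for x
  proof (cases "x = 0")
    case True
    then show ?thesis using n by (simp add: q_def n_def)
  next
    case False
    then have "(\<Sum>i\<in>UNIV. q i x) = n * l (norm x) + (\<Sum>i\<in>UNIV. (x $ i)\<^sup>2) / (norm x)\<^sup>2 * (m (norm x) - n * l (norm x))"
      by (simp add: q_def n_def sum.distrib sum_distrib_right sum_divide_distrib)
    then show ?thesis using False by (simp add: sum_coord_squares)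
  qed
  let ?D = "\<lambda>i x. l (norm x) * (x $ i * G1 i x) + q i x * G x"
  note xi = has_continuous_extension_coord
  have "integrable (lebesgue_on unit_ball) (?D i) \<and> (LINT x|lebesgue_on unit_ball. ?D i x) = 0" for i
  proof -
    have "has_continuous_extension (\<lambda>x. l (norm x) * (x $ i * G1 i x))"
      by (intro has_continuous_extension_mult has_continuous_extension_radial l G1 xi)
    then obtain C where C: "0 \<le> C" "\<And>x. norm x < 1 \<Longrightarrow> \<bar>l (norm x) * (x $ i * G1 i x)\<bar> \<le> C"
      by (rule has_continuous_extension_bounded) blast
    obtain L where L: "0 \<le> L" "\<And>x::real^'n. norm x < 1 \<Longrightarrow> \<bar>l (norm x)\<bar> \<le> L"
      by (rule has_continuous_extension_bounded[OF has_continuous_extension_radial[OF l]]) blast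
    obtain M where M: "0 \<le> M" "\<And>x::real^'n. norm x < 1 \<Longrightarrow> \<bar>m (norm x)\<bar> \<le> M"
      by (rule has_continuous_extension_bounded[OF has_continuous_extension_radial[OF m]]) blast
    obtain K where K: "0 \<le> K" "\<And>x. norm x < 1 \<Longrightarrow> \<bar>G x\<bar> \<le> K"
      by (rule has_continuous_extension_bounded[OF has_continuous_extensionI[OF G]]) auto
    \<comment> \<open>A direct bound is needed, as (x_i / |x|)^2 has no limit at the origin and
      \<open>q i\<close> need not extend continuously.\<close>
    have qb: "\<bar>q i x\<bar> \<le> L + (M + n * L)" if "norm x < 1" "x \<noteq> 0" for x
    proof -
      have "\<bar>(x $ i)\<^sup>2 / (norm x)\<^sup>2\<bar> \<le> 1"
        using component_le_norm_cart[of x i] that(2) by (auto simp: abs_le_square_iff[symmetric])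
      moreover have "\<bar>m (norm x) - n * l (norm x)\<bar> \<le> M + n * L"
        using M(2)[OF that(1)] mult_left_mono[OF L(2)[OF that(1)], of n] n
        by (intro order_trans[OF abs_triangle_ineq4] add_mono) (auto simp: abs_mult)
      ultimately have "\<bar>(x $ i)\<^sup>2 / (norm x)\<^sup>2 * (m (norm x) - n * l (norm x))\<bar> \<le> 1 * (M + n * L)"
        unfolding abs_mult[of "_ / _"] by (rule mult_mono) auto
      then have "\<bar>l (norm x) + (x $ i)\<^sup>2 / (norm x)\<^sup>2 * (m (norm x) - n * l (norm x))\<bar> \<le> L + 1 * (M + n * L)"
        using L(2)[OF that(1)] by linarith
      then show ?thesis using that(2) by (simp add: q_def)
    qed
    have Db: "\<bar>?D i x\<bar> \<le> C + (L + (M + n * L)) * K" if "norm x < 1" "x \<noteq> 0" for x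
    proof (rule order_trans[OF abs_triangle_ineq], rule add_mono[OF C(2)[OF that(1)]])
      show "\<bar>q i x * G x\<bar> \<le> (L + (M + n * L)) * K"
        unfolding abs_mult by (rule mult_mono[OF qb[OF that] K(2)[OF that(1)]]) (use L M n in auto)
    qed
    have d: "((\<lambda>t. (x + t *\<^sub>R axis i 1) $ i * l (norm (x + t *\<^sub>R axis i 1)) * G (x + t *\<^sub>R axis i 1))
        has_real_derivative ?D i x) (at 0)"
      if "norm x < 1" "x \<noteq> 0" for x
    proof -
      have "((\<lambda>t. (x + t *\<^sub>R axis i 1) $ i) has_real_derivative 1) (at 0)"
        by (auto intro!: derivative_eq_intros)
      from DERIV_mult[OF DERIV_mult[OF this DERIV_radial_along_axis[OF that(2) dl[of "norm x"]]]
          dG[OF that(1), of i]] that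
      show ?thesis by (simp add: q_def field_simps power2_eq_square n_def)
    qed
    have c: "continuous_on (cball 0 1) (\<lambda>x. x $ i * l (norm x) * G x)"
      by (intro continuous_on_mult continuous_on_radial l G continuous_intros)
    show ?thesis
      by (rule conjI; rule integral_derivative_along_axis[OF c _ d Db]; use bd in auto)
  qed
  then have "(LINT x|lebesgue_on unit_ball. (\<Sum>i\<in>UNIV. ?D i x)) = 0"
    by (simp add: Bochner_Integration.integral_sum)
  moreover have "(\<Sum>i\<in>UNIV. ?D i x) = (\<Sum>i\<in>UNIV. l (norm x) * (x $ i * G1 i x)) + m (norm x) * G x" for x
    by (simp add: sum.distrib sum_distrib_right[symmetric] q)
  ultimately show ?thesis by simp
qed

text \<open>For radial functions on the unit ball of \<open>\<real>\<^sup>n\<close>: the gradient of \<open>z(|x|)\<close> is \<open>x l(|x|)\<close>, whose divergence is \<open>m(|x|)\<close>.\<close>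

definition radial_laplace :: "nat \<Rightarrow> (real \<Rightarrow> real) \<Rightarrow> (real \<Rightarrow> real) \<Rightarrow> (real \<Rightarrow> real) \<Rightarrow> bool" where
  "radial_laplace n z l m \<longleftrightarrow> continuous_on {0..1} z \<and> continuous_on {0..1} l \<and> continuous_on {0..1} m \<and>
     (\<forall>r. 0 < r \<and> r < 1 \<longrightarrow> (z has_real_derivative r * l r) (at r) \<and>
        (l has_real_derivative (m r - real n * l r) / r) (at r))"

text \<open>Green's second identity: both preceding identities contain the integral of l x . grad G,
  which cancels.\<close>

lemma integral_radial_laplace:
  fixes G :: "real ^ 'n::finite \<Rightarrow> real" and G1 G2 :: "'n \<Rightarrow> real ^ 'n \<Rightarrow> real"
  assumes rl: "radial_laplace CARD('n) z l m"
    and G: "continuous_on (cball 0 1) G" and G1: "\<And>i. continuous_on (cball 0 1) (G1 i)"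
    and G2: "\<And>i. has_continuous_extension (G2 i)"
    and dG: "\<And>i x. norm x < 1 \<Longrightarrow> ((\<lambda>t. G (x + t *\<^sub>R axis i 1)) has_real_derivative G1 i x) (at 0)"
    and dG1: "\<And>i x. norm x < 1 \<Longrightarrow> ((\<lambda>t. G1 i (x + t *\<^sub>R axis i 1)) has_real_derivative G2 i x) (at 0)"
    and bd1: "\<And>i x. norm x = 1 \<Longrightarrow> z 1 * G1 i x = 0" and bd: "\<And>x. norm x = 1 \<Longrightarrow> l 1 * G x = 0"
  shows "(LINT x|lebesgue_on unit_ball. z (norm x) * (\<Sum>i\<in>UNIV. G2 i x))
       = (LINT x|lebesgue_on unit_ball. m (norm x) * G x)"
proof -
  note rl' = rl[unfolded radial_laplace_def]
  note xi = has_continuous_extension_coord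
  have G1': "has_continuous_extension (G1 i)" for i by (rule has_continuous_extensionI[OF G1]) auto
  have G': "has_continuous_extension G" by (rule has_continuous_extensionI[OF G]) auto
  have 1: "(LINT x|lebesgue_on unit_ball. (\<Sum>i\<in>UNIV. l (norm x) * (x $ i * G1 i x) + z (norm x) * G2 i x)) = 0"
    by (rule integral_radial_gradient[where z=z and l=l, OF _ _ _ G1 G2 dG1 bd1]) (use rl' in auto)
  have 2: "(LINT x|lebesgue_on unit_ball. (\<Sum>i\<in>UNIV. l (norm x) * (x $ i * G1 i x)) + m (norm x) * G x) = 0"
    by (rule integral_radial_divergence[where l=l and m=m, OF _ _ _ G G1' dG bd]) (use rl' in auto)
  have i1: "integrable (lebesgue_on unit_ball) (\<lambda>x. \<Sum>i\<in>UNIV. l (norm x) * (x $ i * G1 i x))"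
    using rl' by (intro has_continuous_extension_integrable has_continuous_extension_sum
        has_continuous_extension_mult has_continuous_extension_radial xi G1') auto
  have i2: "integrable (lebesgue_on unit_ball) (\<lambda>x. z (norm x) * (\<Sum>i\<in>UNIV. G2 i x))"
    using rl' by (intro has_continuous_extension_integrable has_continuous_extension_sum
        has_continuous_extension_mult has_continuous_extension_radial G2) auto
  have i3: "integrable (lebesgue_on unit_ball) (\<lambda>x. m (norm x) * G x)"
    using rl' by (intro has_continuous_extension_integrable
        has_continuous_extension_mult has_continuous_extension_radial G') auto
  show ?thesis
    using 1 2 i1 i2 i3 by (simp add: sum.distrib sum_distrib_left[symmetric])
qed

section \<open>The radial solution operator\<close>

text \<open>This is 1/n times the mean of f(|.|) over the ball of radius r, written after the
  substitution t = r s so that it makes sense and is continuous at r = 0. As a function l of r it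
  solves r l' + n l = f, so the field x l(|x|) has divergence f.\<close>

definition ball_mean :: "nat \<Rightarrow> (real \<Rightarrow> real) \<Rightarrow> real \<Rightarrow> real" where
  "ball_mean n f r = integral {0..1} (\<lambda>s. s ^ (n - 1) * f (r * s))"

text \<open>A radial solution of Delta eta = f. The subtracted constant is the mean over the unit
  ball of the first term, so that eta has mean zero.\<close>

definition radial_neumann :: "nat \<Rightarrow> (real \<Rightarrow> real) \<Rightarrow> real \<Rightarrow> real" where
  "radial_neumann n f r = integral {0..r} (\<lambda>s. s * ball_mean n f s)
     - real n * integral {0..1} (\<lambda>t. t ^ (n - 1) * integral {0..t} (\<lambda>s. s * ball_mean n f s))"

text \<open>The solution of Delta z = eta with z(1) = 0, where z' = r times the
  \<open>ball_mean\<close> of eta. Integrating from r to 1 with the minus sign makes the integrand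
  nonnegative when f is.\<close>

definition radial_green :: "nat \<Rightarrow> (real \<Rightarrow> real) \<Rightarrow> real \<Rightarrow> real" where
  "radial_green n f r = integral {r..1} (\<lambda>s. s * - ball_mean n (radial_neumann n f) s)"

lemma mult_in_unit: "0 \<le> r \<Longrightarrow> r \<le> 1 \<Longrightarrow> 0 \<le> s \<Longrightarrow> s \<le> 1 \<Longrightarrow> r * s \<in> {0..1::real}"
  by (auto intro: mult_le_one)

lemma continuous_on_scaled:
  fixes f :: "real \<Rightarrow> real"
  assumes "continuous_on {0..1} f" "r \<in> {0..1}"
  shows "continuous_on {0..1} (\<lambda>s. s ^ k * f (r * s))"
  by (intro continuous_intros continuous_on_compose2[OF assms(1)]) (use assms(2) in \<open>auto intro: mult_le_one\<close>)

lemma ball_mean_cong: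
  assumes "\<And>s. s \<in> {0..1} \<Longrightarrow> f s = g s" "r \<in> {0..1}"
  shows "ball_mean n f r = ball_mean n g r"
  unfolding ball_mean_def by (rule integral_cong) (use assms mult_in_unit[of r] in auto)

lemma continuous_on_ball_mean:
  assumes "continuous_on {0..1} f"
  shows "continuous_on {0..1} (ball_mean n f)"
proof -
  have "continuous_on ({0..1} \<times> cbox 0 1) (\<lambda>(r, s). s ^ (n - 1) * f (r * s))"
    unfolding case_prod_beta
    by (intro continuous_intros continuous_on_compose2[OF assms]) (auto intro: mult_le_one)
  from integral_continuous_on_param[OF this] show ?thesis by (simp add: ball_mean_def[abs_def])
qed

lemma ball_mean_eq:
  assumes f: "continuous_on {0..1} f" and r: "0 < r" "r \<le> 1" and n: "0 < n"
  shows "ball_mean n f r = integral {0..r} (\<lambda>t. t ^ (n - 1) * f t) / r ^ n"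
proof -
  have "continuous_on {0..r} (\<lambda>t. t ^ (n - 1) * f t)"
    using r by (intro continuous_intros continuous_on_subset[OF f]) auto
  then have "((\<lambda>t. t ^ (n - 1) * f t) has_integral integral {0..r} (\<lambda>t. t ^ (n - 1) * f t)) {0..r}"
    by (intro integrable_integral integrable_continuous_real)
  from has_integral_stretch_real[OF this, of r] r
  have "((\<lambda>s. (r * s) ^ (n - 1) * f (r * s)) has_integral
     integral {0..r} (\<lambda>t. t ^ (n - 1) * f t) / r) ((\<lambda>x. x / r) ` {0..r})" by simp
  moreover have "(\<lambda>x. x / r) ` {0..r} = {0..1}"
    using r image_divide_atLeastAtMost[of r 0 r] by simp
  ultimately have "((\<lambda>s. (1 / r ^ (n - 1)) * ((r * s) ^ (n - 1) * f (r * s))) has_integral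
     (1 / r ^ (n - 1)) * (integral {0..r} (\<lambda>t. t ^ (n - 1) * f t) / r)) {0..1}"
    by (intro has_integral_mult_right) simp
  moreover have "(1 / r ^ (n - 1)) * ((r * s) ^ (n - 1) * f (r * s)) = s ^ (n - 1) * f (r * s)" for s
    using r by (simp add: power_mult_distrib)
  moreover have "r ^ n = r ^ (n - 1) * r" using n by (cases n) auto
  ultimately show ?thesis by (simp add: ball_mean_def integral_unique)
qed

lemma DERIV_ball_mean:
  assumes f: "continuous_on {0..1} f" and r: "0 < r" "r < 1" and n: "0 < n"
  shows "(ball_mean n f has_real_derivative (f r - real n * ball_mean n f r) / r) (at r)"
proof -
  let ?I = "\<lambda>r. integral {0..r} (\<lambda>t. t ^ (n - 1) * f t)"
  have "continuous_on {0..1} (\<lambda>t. t ^ (n - 1) * f t)" by (intro continuous_intros f)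
  then have "(?I has_real_derivative r ^ (n - 1) * f r) (at r within {0..1})"
    by (rule integral_has_real_derivative) (use r in auto)
  then have "(?I has_real_derivative r ^ (n - 1) * f r) (at r)"
    unfolding at_within_Icc_at[OF r] .
  moreover have "((\<lambda>r. r ^ n) has_real_derivative real n * r ^ (n - 1)) (at r)"
    using DERIV_pow[of n r] by simp
  ultimately have "((\<lambda>r. ?I r / r ^ n) has_real_derivative
      (r ^ (n - 1) * f r * r ^ n - ?I r * (real n * r ^ (n - 1))) / (r ^ n * r ^ n)) (at r)"
    by (rule DERIV_divide) (use r in auto)
  moreover have "(r ^ (n - 1) * f r * r ^ n - ?I r * (real n * r ^ (n - 1))) / (r ^ n * r ^ n)
      = (f r - real n * ball_mean n f r) / r"
  proof -
    have "r ^ n = r ^ (n - 1) * r" using n by (cases n) auto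
    then show ?thesis using r n by (simp add: ball_mean_eq[OF f] field_simps)
  qed
  ultimately have "((\<lambda>r. ?I r / r ^ n) has_real_derivative (f r - real n * ball_mean n f r) / r) (at r)" by simp
  then show ?thesis
  proof (rule has_field_derivative_transform_within_open[where S = "{0<..<1}"])
    show "?I s / s ^ n = ball_mean n f s" if "s \<in> {0<..<1}" for s
      using that by (subst ball_mean_eq[OF f _ _ n]) auto
  qed (use r in auto)
qed

lemma continuous_on_times_ball_mean:
  assumes "continuous_on {0..1} f"
  shows "continuous_on {0..1} (\<lambda>s. s * ball_mean n f s)"
  by (intro continuous_intros continuous_on_ball_mean assms)

lemma continuous_on_integral_times_ball_mean:
  assumes "continuous_on {0..1} f"
  shows "continuous_on {0..1} (\<lambda>r. integral {0..r} (\<lambda>s. s * ball_mean n f s))"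
  by (rule indefinite_integral_continuous_1, rule integrable_continuous_real,
      rule continuous_on_times_ball_mean, rule assms)

lemma continuous_on_radial_neumann:
  assumes "continuous_on {0..1} f"
  shows "continuous_on {0..1} (radial_neumann n f)"
  unfolding radial_neumann_def
  by (intro continuous_intros continuous_on_integral_times_ball_mean assms)

lemma DERIV_radial_neumann:
  assumes f: "continuous_on {0..1} f" and r: "0 < r" "r < 1"
  shows "(radial_neumann n f has_real_derivative r * ball_mean n f r) (at r)"
proof -
  have "((\<lambda>r. integral {0..r} (\<lambda>s. s * ball_mean n f s)) has_real_derivative r * ball_mean n f r) (at r within {0..1})"
    by (rule integral_has_real_derivative[OF continuous_on_times_ball_mean[OF f]]) (use r in auto)
  then have "((\<lambda>r. integral {0..r} (\<lambda>s. s * ball_mean n f s)) has_real_derivative r * ball_mean n f r) (at r)"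
    unfolding at_within_Icc_at[OF r] .
  from DERIV_diff[OF this DERIV_const] show ?thesis
    by (simp add: radial_neumann_def[abs_def])
qed

lemma radial_laplace_neumann:
  assumes "continuous_on {0..1} f" "0 < n"
  shows "radial_laplace n (radial_neumann n f) (ball_mean n f) f"
  unfolding radial_laplace_def
  using assms by (auto intro: continuous_on_radial_neumann continuous_on_ball_mean
      DERIV_radial_neumann DERIV_ball_mean)

lemma integral_power_unit: "0 < n \<Longrightarrow> integral {0..1} (\<lambda>t::real. t ^ (n - 1)) = 1 / real n"
proof -
  assume n: "0 < n"
  have "((\<lambda>t::real. t ^ (n - 1)) has_integral (1 ^ n / real n - 0 ^ n / real n)) {0..1}"
    by (rule fundamental_theorem_of_calculus)
       (use n in \<open>auto intro!: derivative_eq_intros simp: has_real_derivative_iff_has_vector_derivative[symmetric]\<close>)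
  then show ?thesis using n by (simp add: integral_unique)
qed

text \<open>The purpose of the constant in \<open>radial_neumann\<close>: up to the factor r, the
  left-hand side is the radial derivative of \<open>radial_green\<close> at r = 1, so this is the
  second Dirichlet condition.\<close>

lemma ball_mean_neumann_1:
  assumes f: "continuous_on {0..1} f" and n: "0 < n"
  shows "ball_mean n (radial_neumann n f) 1 = 0"
proof -
  let ?P = "\<lambda>t. integral {0..t} (\<lambda>s. s * ball_mean n f s)"
  let ?c = "integral {0..1} (\<lambda>t. t ^ (n - 1) * ?P t)"
  have c: "continuous_on {0..1} (\<lambda>t. t ^ (n - 1) * ?P t)"
    by (rule continuous_on_mult[OF _ continuous_on_integral_times_ball_mean[OF f]]) (intro continuous_intros)
  have "ball_mean n (radial_neumann n f) 1
      = integral {0..1} (\<lambda>t. t ^ (n - 1) * ?P t - (real n * ?c) * t ^ (n - 1))"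
    by (simp add: ball_mean_def radial_neumann_def algebra_simps)
  also have "\<dots> = ?c - integral {0..1} (\<lambda>t. (real n * ?c) * t ^ (n - 1))"
    by (rule integral_diff) (rule integrable_continuous_real, rule c,
        intro integrable_continuous_real continuous_intros)
  also have "\<dots> = ?c - (real n * ?c) * (1 / real n)"
    by (simp only: integral_mult_right integral_power_unit[OF n])
  finally show ?thesis using n by simp
qed

lemma radial_green_1: "radial_green n f 1 = 0"
  by (simp add: radial_green_def)

lemma radial_green_eq:
  assumes f: "continuous_on {0..1} f" and r: "r \<in> {0..1}"
  shows "radial_green n f r = radial_green n f 0 + integral {0..r} (\<lambda>s. s * ball_mean n (radial_neumann n f) s)"
proof -
  let ?h = "\<lambda>s. s * ball_mean n (radial_neumann n f) s"
  have i: "?h integrable_on {0..1}"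
    by (intro integrable_continuous_real continuous_on_times_ball_mean continuous_on_radial_neumann f)
  have "integral {0..r} ?h + integral {r..1} ?h = integral {0..1} ?h"
    by (rule Henstock_Kurzweil_Integration.integral_combine) (use r i in auto)
  then show ?thesis by (simp add: radial_green_def)
qed

lemma radial_laplace_green:
  assumes f: "continuous_on {0..1} f" and n: "0 < n"
  shows "radial_laplace n (radial_green n f) (ball_mean n (radial_neumann n f)) (radial_neumann n f)"
proof -
  let ?h = "\<lambda>s. s * ball_mean n (radial_neumann n f) s"
  let ?R = "\<lambda>r. radial_green n f 0 + integral {0..r} ?h"
  have c: "continuous_on {0..1} ?h"
    by (intro continuous_on_times_ball_mean continuous_on_radial_neumann f)
  have "continuous_on {0..1} ?R"
    by (intro continuous_on_add continuous_on_const indefinite_integral_continuous_1 integrable_continuous_real c)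
  then have 1: "continuous_on {0..1} (radial_green n f)"
    by (rule continuous_on_eq) (rule radial_green_eq[OF f, symmetric])
  have 2: "(radial_green n f has_real_derivative r * ball_mean n (radial_neumann n f) r) (at r)"
    if r: "0 < r" "r < 1" for r
  proof -
    have "((\<lambda>r. integral {0..r} ?h) has_real_derivative ?h r) (at r within {0..1})"
      by (rule integral_has_real_derivative[OF c]) (use r in auto)
    then have "((\<lambda>r. integral {0..r} ?h) has_real_derivative ?h r) (at r)"
      unfolding at_within_Icc_at[OF r] .
    from DERIV_add[OF DERIV_const this] have "(?R has_real_derivative ?h r) (at r)" by simp
    then show ?thesis
      by (rule has_field_derivative_transform_within_open[where S = "{0<..<1}"])
         (use r in \<open>auto intro!: radial_green_eq[OF f, symmetric]\<close>)
  qed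
  show ?thesis
    unfolding radial_laplace_def
    using 1 2 assms by (auto intro: continuous_on_radial_neumann continuous_on_ball_mean DERIV_ball_mean)
qed

lemma continuous_on_radial_green:
  "continuous_on {0..1} f \<Longrightarrow> 0 < n \<Longrightarrow> continuous_on {0..1} (radial_green n f)"
  using radial_laplace_green unfolding radial_laplace_def by blast

section \<open>Linearity, positivity and monotonicity of the solution operator\<close>

lemma ball_mean_diff:
  assumes f: "continuous_on {0..1} f" and g: "continuous_on {0..1} g" and r: "r \<in> {0..1}"
  shows "ball_mean n (\<lambda>x. f x - g x) r = ball_mean n f r - ball_mean n g r"
  unfolding ball_mean_def right_diff_distrib
  by (intro integral_diff integrable_continuous_real continuous_on_scaled assms)

lemma radial_neumann_diff:
  assumes f: "continuous_on {0..1} f" and g: "continuous_on {0..1} g" and r: "r \<in> {0..1}"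
  shows "radial_neumann n (\<lambda>x. f x - g x) r = radial_neumann n f r - radial_neumann n g r"
proof -
  let ?P = "\<lambda>f t. integral {0..t} (\<lambda>s. s * ball_mean n f s)"
  have P: "?P (\<lambda>x. f x - g x) t = ?P f t - ?P g t" if t: "t \<in> {0..1}" for t
  proof -
    have "?P (\<lambda>x. f x - g x) t = integral {0..t} (\<lambda>s. s * ball_mean n f s - s * ball_mean n g s)"
      by (rule integral_cong) (use t in \<open>simp add: ball_mean_diff[OF f g] algebra_simps\<close>)
    also have "\<dots> = ?P f t - ?P g t"
      by (intro integral_diff integrable_continuous_real continuous_on_subset[OF continuous_on_times_ball_mean] f g)
         (use t in auto)
    finally show ?thesis .
  qed
  have c: "continuous_on {0..1} (\<lambda>t. t ^ (n - 1) * ?P f t)" if "continuous_on {0..1} f" for f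
    by (intro continuous_intros continuous_on_integral_times_ball_mean that)
  have "integral {0..1} (\<lambda>t. t ^ (n - 1) * ?P (\<lambda>x. f x - g x) t)
      = integral {0..1} (\<lambda>t. t ^ (n - 1) * ?P f t - t ^ (n - 1) * ?P g t)"
    by (rule integral_cong) (simp add: P algebra_simps)
  also have "\<dots> = integral {0..1} (\<lambda>t. t ^ (n - 1) * ?P f t) - integral {0..1} (\<lambda>t. t ^ (n - 1) * ?P g t)"
    by (intro integral_diff integrable_continuous_real c f g)
  finally have eq: "integral {0..1} (\<lambda>t. t ^ (n - 1) * ?P (\<lambda>x. f x - g x) t)
      = integral {0..1} (\<lambda>t. t ^ (n - 1) * ?P f t) - integral {0..1} (\<lambda>t. t ^ (n - 1) * ?P g t)" .
  show ?thesis unfolding radial_neumann_def P[OF r] eq by (simp add: algebra_simps)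
qed

lemma radial_green_diff:
  assumes f: "continuous_on {0..1} f" and g: "continuous_on {0..1} g" and r: "r \<in> {0..1}"
  shows "radial_green n (\<lambda>x. f x - g x) r = radial_green n f r - radial_green n g r"
proof -
  let ?h = "\<lambda>f s. s * - ball_mean n (radial_neumann n f) s"
  have c: "?h f integrable_on {r..1}" if "continuous_on {0..1} f" for f
    by (intro integrable_continuous_real continuous_intros continuous_on_subset[OF continuous_on_ball_mean]
        continuous_on_radial_neumann that) (use r in auto)
  have eq: "ball_mean n (radial_neumann n (\<lambda>x. f x - g x)) s
      = ball_mean n (radial_neumann n f) s - ball_mean n (radial_neumann n g) s" if "s \<in> {0..1}" for s
    by (subst ball_mean_diff[symmetric], (intro continuous_on_radial_neumann f g)+, rule that)
       (rule ball_mean_cong, rule radial_neumann_diff[OF f g], use that in auto)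
  have "radial_green n (\<lambda>x. f x - g x) r = integral {r..1} (\<lambda>s. ?h f s - ?h g s)"
    unfolding radial_green_def
  proof (rule integral_cong)
    fix s assume "s \<in> {r..1}"
    then have "s \<in> {0..1}" using r by auto
    then show "s * - ball_mean n (radial_neumann n (\<lambda>x. f x - g x)) s = ?h f s - ?h g s"
      by (simp only: eq) (simp add: algebra_simps)
  qed
  also have "\<dots> = radial_green n f r - radial_green n g r"
    unfolding radial_green_def by (intro integral_diff c f g)
  finally show ?thesis .
qed

lemma radial_green_scale: "radial_green n (\<lambda>x. c * f x) r = c * radial_green n f r"
proof -
  have 1: "ball_mean n (\<lambda>x. c * f x) r = c * ball_mean n f r" for f r
    unfolding ball_mean_def integral_mult_right[symmetric] by (simp only: mult.left_commute)
  have 2: "integral {0..t} (\<lambda>s. s * (c * ball_mean n f s)) = c * integral {0..t} (\<lambda>s. s * ball_mean n f s)" for t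
    unfolding integral_mult_right[symmetric] by (simp only: mult.left_commute)
  have 3: "integral {0..1} (\<lambda>t. t ^ (n - 1) * (c * h t)) = c * integral {0..1} (\<lambda>t. t ^ (n - 1) * h t)" for h
    unfolding integral_mult_right[symmetric] by (simp only: mult.left_commute)
  have "radial_neumann n (\<lambda>x. c * f x) = (\<lambda>r. c * radial_neumann n f r)"
    by (rule ext) (simp only: radial_neumann_def 1 2 3, simp add: algebra_simps)
  then show ?thesis
    unfolding radial_green_def integral_mult_right[symmetric] by (simp add: 1 mult.left_commute)
qed

lemma ball_mean_nonneg:
  assumes f: "continuous_on {0..1} f" "\<And>s. s \<in> {0..1} \<Longrightarrow> 0 \<le> f s" and r: "r \<in> {0..1}"
  shows "0 \<le> ball_mean n f r"
  unfolding ball_mean_def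
proof (rule integral_nonneg)
  fix s :: real assume s: "s \<in> {0..1}"
  then have "0 \<le> f (r * s)" using r by (intro f(2) mult_in_unit) auto
  then show "0 \<le> s ^ (n - 1) * f (r * s)" using s by simp
qed (intro integrable_continuous_real continuous_on_scaled f r)

lemma ball_mean_pos:
  assumes f: "continuous_on {0..1} f" "\<And>s. 0 \<le> s \<Longrightarrow> s < 1 \<Longrightarrow> 0 < f s" and r: "r \<in> {0..1}"
  shows "0 < ball_mean n f r"
proof -
  have "integral {0..1} (\<lambda>s::real. 0::real) < ball_mean n f r"
    unfolding ball_mean_def
  proof (rule integral_less_real)
    fix s :: real assume s: "s \<in> {0<..<1}"
    then have "r * s \<le> 1 * s" "0 \<le> r * s" using r by (auto intro!: mult_right_mono simp del: mult_1)
    moreover have "s < 1" using s by simp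
    ultimately have "0 < f (r * s)" by (intro f(2)) linarith+
    then show "0 < s ^ (n - 1) * f (r * s)" using s by simp
  qed (auto intro!: continuous_on_scaled f r)
  then show ?thesis by simp
qed

lemma radial_neumann_diff_points:
  assumes f: "continuous_on {0..1} f" and ab: "0 \<le> a" "a \<le> b" "b \<le> 1"
  shows "radial_neumann n f b - radial_neumann n f a = integral {a..b} (\<lambda>s. s * ball_mean n f s)"
proof -
  have "integral {0..a} (\<lambda>s. s * ball_mean n f s) + integral {a..b} (\<lambda>s. s * ball_mean n f s)
      = integral {0..b} (\<lambda>s. s * ball_mean n f s)"
    by (rule Henstock_Kurzweil_Integration.integral_combine)
       (use ab in \<open>auto intro!: integrable_continuous_real continuous_on_subset[OF continuous_on_times_ball_mean[OF f]]\<close>)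
  then show ?thesis by (simp add: radial_neumann_def)
qed

text \<open>The mean value over the unit ball of the increasing function \<^const>\<open>radial_neumann\<close> is zero,
  so that its mean values over smaller balls are nonpositive.\<close>

lemma radial_green_nonneg:
  assumes f: "continuous_on {0..1} f" "\<And>s. s \<in> {0..1} \<Longrightarrow> 0 \<le> f s" and r: "r \<in> {0..1}" and n: "0 < n"
  shows "0 \<le> radial_green n f r"
proof -
  let ?N = "radial_neumann n f"
  have N: "continuous_on {0..1} ?N" by (rule continuous_on_radial_neumann[OF f(1)])
  have mono: "?N a \<le> ?N b" if "0 \<le> a" "a \<le> b" "b \<le> 1" for a b
  proof -
    have "0 \<le> integral {a..b} (\<lambda>s. s * ball_mean n f s)"
      by (rule integral_nonneg) (use that in \<open>auto intro!: integrable_continuous_real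
          continuous_on_subset[OF continuous_on_times_ball_mean[OF f(1)]] mult_nonneg_nonneg ball_mean_nonneg f\<close>)
    then show ?thesis using radial_neumann_diff_points[OF f(1) that, of n] by simp
  qed
  have le: "ball_mean n ?N s \<le> 0" if s: "s \<in> {0..1}" for s
  proof -
    have "ball_mean n ?N s \<le> ball_mean n ?N 1"
      unfolding ball_mean_def
    proof (rule integral_le)
      fix t :: real assume t: "t \<in> {0..1}"
      have "s * t \<le> 1 * t" using s t by (intro mult_right_mono) auto
      then show "t ^ (n - 1) * ?N (s * t) \<le> t ^ (n - 1) * ?N (1 * t)"
        using s t by (intro mult_left_mono mono) auto
    qed (use s continuous_on_scaled[OF N, of 1 "n - 1"] in
        \<open>auto intro!: integrable_continuous_real continuous_on_scaled N\<close>)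
    then show ?thesis using ball_mean_neumann_1[OF f(1) n] by simp
  qed
  show ?thesis
    unfolding radial_green_def
    by (rule integral_nonneg)
       (use r le in \<open>auto intro!: integrable_continuous_real continuous_intros
          continuous_on_subset[OF continuous_on_ball_mean[OF N]] mult_nonneg_nonpos\<close>)
qed

text \<open>The argument for \<open>radial_green_nonneg\<close> with strict inequalities throughout.
  Positivity is asked only for s < 1 because the difference of right-hand sides to which this gets
  applied vanishes on the sphere.\<close>

lemma radial_green_pos:
  assumes f: "continuous_on {0..1} f" "\<And>s. 0 \<le> s \<Longrightarrow> s < 1 \<Longrightarrow> 0 < f s"
    and r: "0 \<le> r" "r < 1" and n: "0 < n"
  shows "0 < radial_green n f r"
proof -
  let ?N = "radial_neumann n f"
  have N: "continuous_on {0..1} ?N" by (rule continuous_on_radial_neumann[OF f(1)])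
  have mono: "?N a < ?N b" if "0 \<le> a" "a < b" "b \<le> 1" for a b
  proof -
    have "integral {a..b} (\<lambda>s. 0) < integral {a..b} (\<lambda>s. s * ball_mean n f s)"
      by (rule integral_less_real) (use that in \<open>auto intro!: integrable_continuous_real
          continuous_on_subset[OF continuous_on_times_ball_mean[OF f(1)]] mult_pos_pos ball_mean_pos f\<close>)
    then show ?thesis using radial_neumann_diff_points[OF f(1), of a b n] that by simp
  qed
  have less: "ball_mean n ?N s < 0" if s: "0 \<le> s" "s < 1" for s
  proof -
    have "ball_mean n ?N s < ball_mean n ?N 1"
      unfolding ball_mean_def
    proof (rule integral_less_real)
      fix t :: real assume t: "t \<in> {0<..<1}"
      have "s * t < 1 * t" using s t by (intro mult_strict_right_mono) auto
      then show "t ^ (n - 1) * ?N (s * t) < t ^ (n - 1) * ?N (1 * t)"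
        using s t by (intro mult_strict_left_mono mono) auto
    qed (use s continuous_on_scaled[OF N, of 1 "n - 1"] in \<open>auto intro!: continuous_on_scaled N\<close>)
    then show ?thesis using ball_mean_neumann_1[OF f(1) n] by simp
  qed
  have "integral {r..1} (\<lambda>s. 0) < radial_green n f r"
    unfolding radial_green_def
  proof (rule integral_less_real)
    show "continuous_on {r..1} (\<lambda>s. s * - ball_mean n ?N s)"
      using r by (intro continuous_intros continuous_on_subset[OF continuous_on_ball_mean[OF N]]) auto
    show "0 < s * - ball_mean n ?N s" if "s \<in> {r<..<1}" for s
      using that r less[of s] by (intro mult_pos_pos) auto
  qed (use r in auto)
  then show ?thesis by simp
qed

lemma radial_green_mono:
  assumes f: "continuous_on {0..1} f" and g: "continuous_on {0..1} g"
    and le: "\<And>s. s \<in> {0..1} \<Longrightarrow> f s \<le> g s" and r: "r \<in> {0..1}" and n: "0 < n"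
  shows "radial_green n f r \<le> radial_green n g r"
proof -
  have "0 \<le> radial_green n (\<lambda>x. g x - f x) r"
    by (rule radial_green_nonneg) (use assms in \<open>auto intro!: continuous_intros\<close>)
  then show ?thesis by (simp add: radial_green_diff[OF g f r])
qed

lemma radial_green_strict_mono:
  assumes f: "continuous_on {0..1} f" and g: "continuous_on {0..1} g"
    and less: "\<And>s. 0 \<le> s \<Longrightarrow> s < 1 \<Longrightarrow> f s < g s" and r: "0 \<le> r" "r < 1" and n: "0 < n"
  shows "radial_green n f r < radial_green n g r"
proof -
  have "0 < radial_green n (\<lambda>x. g x - f x) r"
    by (rule radial_green_pos) (use assms in \<open>auto intro!: continuous_intros\<close>)
  then show ?thesis using r by (simp add: radial_green_diff[OF g f])
qed

text \<open>The origin of \<open>V\<close>, which is lam times this function. For f = 1 one finds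
  eta = s^2 / (2 n) - 1 / (2 (n + 2)), whose \<open>ball_mean\<close> is -(1 - s^2) / d with d = 2 n
  (n + 2); the last integration gives (1 - r^2)^2 / (4 d).\<close>

lemma radial_green_const_1:
  assumes r: "r \<in> {0..1}" and n: "0 < n"
  shows "radial_green n (\<lambda>_. 1) r = (1 - r\<^sup>2)\<^sup>2 / (8 * real n * (real n + 2))"
proof -
  define d where "d = 2 * real n * (real n + 2)"
  have d: "d \<noteq> 0" using n by (simp add: d_def)
  have m1: "ball_mean n (\<lambda>_. 1) r = 1 / real n" for r
    using integral_power_unit[OF n] by (simp add: ball_mean_def)
  have P: "integral {0..t} (\<lambda>s. s * (1 / real n)) = t\<^sup>2 / (2 * real n)" if "0 \<le> t" for t
  proof -
    have "((\<lambda>s. s * (1 / real n)) has_integral (t\<^sup>2 / (2 * real n) - 0\<^sup>2 / (2 * real n))) {0..t}"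
      by (rule fundamental_theorem_of_calculus)
         (use that n in \<open>auto intro!: derivative_eq_intros simp: has_real_derivative_iff_has_vector_derivative[symmetric] field_simps\<close>)
    from integral_unique[OF this] show ?thesis by simp
  qed
  have sq: "t ^ (n - 1) * t\<^sup>2 = t ^ (n + 1)" for t :: real
    using n by (cases n) (auto simp: power2_eq_square)
  have p2: "integral {0..1} (\<lambda>t::real. t ^ (n + 1)) = 1 / (real n + 2)"
    using integral_power_unit[of "n + 2"] by (simp add: add.commute)
  have "integral {0..1} (\<lambda>t. t ^ (n - 1) * integral {0..t} (\<lambda>s. s * ball_mean n (\<lambda>_. 1) s))
      = integral {0..1} (\<lambda>t::real. (1 / (2 * real n)) * t ^ (n + 1))"
    unfolding m1
  proof (rule integral_cong)
    fix t :: real assume "t \<in> {0..1}"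
    then show "t ^ (n - 1) * integral {0..t} (\<lambda>s. s * (1 / real n)) = (1 / (2 * real n)) * t ^ (n + 1)"
      unfolding sq[symmetric] by (subst P) auto
  qed
  also have "\<dots> = (1 / (2 * real n)) * (1 / (real n + 2))"
    by (simp only: integral_mult_right p2)
  finally have c: "integral {0..1} (\<lambda>t. t ^ (n - 1) * integral {0..t} (\<lambda>s. s * ball_mean n (\<lambda>_. 1) s))
      = (1 / (2 * real n)) * (1 / (real n + 2))" .
  have N: "radial_neumann n (\<lambda>_. 1) t = (1 / (2 * real n)) * t\<^sup>2 - 1 / (2 * (real n + 2))" if "0 \<le> t" for t
    unfolding radial_neumann_def c unfolding m1 P[OF that] using n by simp
  have L: "ball_mean n (radial_neumann n (\<lambda>_. 1)) s = - ((1 - s\<^sup>2) / d)" if "0 \<le> s" for s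
  proof -
    have "ball_mean n (radial_neumann n (\<lambda>_. 1)) s
      = integral {0..1} (\<lambda>t. (s\<^sup>2 / (2 * real n)) * t ^ (n + 1) - (1 / (2 * (real n + 2))) * t ^ (n - 1))"
      unfolding ball_mean_def
    proof (rule integral_cong)
      fix t :: real assume "t \<in> {0..1}"
      then have "0 \<le> s * t" using that by simp
      show "t ^ (n - 1) * radial_neumann n (\<lambda>_. 1) (s * t)
          = (s\<^sup>2 / (2 * real n)) * t ^ (n + 1) - (1 / (2 * (real n + 2))) * t ^ (n - 1)"
        unfolding N[OF \<open>0 \<le> s * t\<close>] sq[symmetric] by (simp add: power_mult_distrib right_diff_distrib mult_ac)
    qed
    also have "\<dots> = integral {0..1} (\<lambda>t. (s\<^sup>2 / (2 * real n)) * t ^ (n + 1)) - integral {0..1} (\<lambda>t. (1 / (2 * (real n + 2))) * t ^ (n - 1))"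
      by (rule integral_diff; intro integrable_continuous_real continuous_on_mult continuous_on_const continuous_on_power continuous_on_id)
    also have "\<dots> = (s\<^sup>2 / (2 * real n)) * (1 / (real n + 2)) - (1 / (2 * (real n + 2))) * (1 / real n)"
      by (simp only: integral_mult_right p2 integral_power_unit[OF n])
    also have "\<dots> = - ((1 - s\<^sup>2) / d)"
      by (simp add: d_def diff_divide_distrib mult_ac)
    finally show ?thesis .
  qed
  have "radial_green n (\<lambda>_. 1) r = integral {r..1} (\<lambda>s. s * ((1 - s\<^sup>2) / d))"
    unfolding radial_green_def
  proof (rule integral_cong)
    fix s assume "s \<in> {r..1}"
    then have "0 \<le> s" using r by simp
    then show "s * - ball_mean n (radial_neumann n (\<lambda>_. 1)) s = s * ((1 - s\<^sup>2) / d)"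
      by (simp only: L minus_minus)
  qed
  also have "\<dots> = - ((1 - 1\<^sup>2)\<^sup>2 / (4 * d)) - - ((1 - r\<^sup>2)\<^sup>2 / (4 * d))"
  proof (rule integral_unique, rule fundamental_theorem_of_calculus)
    fix s :: real
    have "((\<lambda>s. - ((1 - s\<^sup>2)\<^sup>2 / (4 * d))) has_real_derivative s * ((1 - s\<^sup>2) / d)) (at s)"
      using d by (auto intro!: derivative_eq_intros simp: field_simps)
    then show "((\<lambda>s. - ((1 - s\<^sup>2)\<^sup>2 / (4 * d))) has_vector_derivative s * ((1 - s\<^sup>2) / d)) (at s within {r..1})"
      by (simp add: has_real_derivative_iff_has_vector_derivative has_vector_derivative_at_within)
  qed (use r in auto)
  finally show ?thesis by (simp add: d_def)
qed

section \<open>Classical Dirichlet data\<close>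

lemma partials_Nil [simp]: "partials [] f = f"
  and partials_Cons: "partials (i # is) f = partial i (partials is f)"
  by (simp_all add: partials_def)

lemma partial_eqI:
  "((\<lambda>t. f (x + t *\<^sub>R axis i 1)) has_real_derivative d) (at 0) \<Longrightarrow> partial i f x = d"
  unfolding partial_def by (rule DERIV_imp_deriv)

lemma DERIV_along_derivative:
  fixes f :: "real ^ 'n::finite \<Rightarrow> real"
  assumes "(f has_derivative f') (at x)"
  shows "((\<lambda>t. f (x + t *\<^sub>R v)) has_real_derivative f' v) (at 0)"
proof -
  have "((\<lambda>t. x + t *\<^sub>R v) has_derivative (\<lambda>t. t *\<^sub>R v)) (at 0)"
    by (auto intro!: derivative_eq_intros)
  moreover have "(f has_derivative f') (at (x + 0 *\<^sub>R v))" using assms by simp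
  ultimately have "((\<lambda>t. f (x + t *\<^sub>R v)) has_derivative (\<lambda>t. f' (t *\<^sub>R v))) (at 0)"
    by (rule has_derivative_compose)
  moreover have "(\<lambda>t. f' (t *\<^sub>R v)) = (*) (f' v)"
    using has_derivative_linear[OF assms] by (simp add: fun_eq_iff linear_scale)
  ultimately show ?thesis by (simp add: has_field_derivative_def)
qed

lemma DERIV_along_axis:
  fixes f :: "real ^ 'n::finite \<Rightarrow> real"
  assumes "f differentiable (at x)"
  shows "((\<lambda>t. f (x + t *\<^sub>R axis i 1)) has_real_derivative partial i f x) (at 0)"
  using assms DERIV_along_derivative partial_eqI unfolding differentiable_def by metis

lemma DERIV_along_vector:
  fixes f :: "real ^ 'n::finite \<Rightarrow> real"
  assumes "f differentiable (at x)"
  shows "((\<lambda>t. f (x + t *\<^sub>R v)) has_real_derivative (\<Sum>i\<in>UNIV. v $ i * partial i f x)) (at 0)"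
proof -
  from assms obtain f' where f': "(f has_derivative f') (at x)" by (auto simp: differentiable_def)
  note lin = has_derivative_linear[OF f']
  have "f' v = f' (\<Sum>i\<in>UNIV. (v $ i) *\<^sub>R axis i 1)"
    using basis_expansion[of v] by (simp add: scalar_mult_eq_scaleR)
  also have "\<dots> = (\<Sum>i\<in>UNIV. v $ i * f' (axis i 1))"
    by (simp add: linear_sum[OF lin] linear_scale[OF lin])
  also have "\<dots> = (\<Sum>i\<in>UNIV. v $ i * partial i f x)"
    by (simp add: partial_eqI[OF DERIV_along_derivative[OF f']])
  finally show ?thesis using DERIV_along_derivative[OF f', of v] by simp
qed

lemma C_closure_differentiable:
  assumes "f \<in> C_closure k unit_ball" "length is < k" "norm x < 1"
  shows "partials is f differentiable (at x)"
  using assms by (auto simp: C_closure_def differentiable_on_eq_differentiable_at)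

lemma C_closure_DERIV:
  assumes "f \<in> C_closure k unit_ball" "length is < k" "norm x < 1"
  shows "((\<lambda>t. partials is f (x + t *\<^sub>R axis i 1)) has_real_derivative partials (i # is) f x) (at 0)"
  unfolding partials_Cons by (rule DERIV_along_axis, rule C_closure_differentiable[OF assms])

lemma C_closure_extension:
  fixes f :: "real ^ 'n::finite \<Rightarrow> real"
  assumes "f \<in> C_closure k unit_ball" "length is \<le> k"
  shows "has_continuous_extension (partials is f)"
  using assms by (auto simp: C_closure_def has_continuous_extension_def)

lemma C_closure_continuous:
  fixes f :: "real ^ 'n::finite \<Rightarrow> real"
  shows "f \<in> C_closure k unit_ball \<Longrightarrow> continuous_on (cball 0 1) f"
  by (auto simp: C_closure_def)

lemma laplacian_eq: "laplacian f x = (\<Sum>i\<in>UNIV. partials [i, i] f x)"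
  by (simp add: laplacian_def partials_Cons)

text \<open>As \<open>deriv\<close> is not additive in general, each of the two outer derivatives is
  carried through the sum by differentiability of the partial derivatives of orders 2 and 3. The
  first exchange must hold on a neighbourhood before the second can be made.\<close>

lemma bilaplacian_eq:
  fixes f :: "real ^ 'n::finite \<Rightarrow> real"
  assumes f: "f \<in> C_closure 4 unit_ball" and x: "norm x < 1"
  shows "bilaplacian f x = (\<Sum>i\<in>UNIV. \<Sum>j\<in>UNIV. partials [j, j, i, i] f x)"
proof -
  have p1: "partial j (laplacian f) y = (\<Sum>i\<in>UNIV. partials [j, i, i] f y)" if "norm y < 1" for j y
    unfolding laplacian_eq
    by (rule partial_eqI, rule DERIV_sum, rule C_closure_DERIV[OF f]) (use that in auto)
  have "partial j (partial j (laplacian f)) x = (\<Sum>i\<in>UNIV. partials [j, j, i, i] f x)" for j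
  proof (rule partial_eqI, rule derivative_along_cong[of unit_ball x])
    show "((\<lambda>t. \<Sum>i\<in>UNIV. partials [j, i, i] f (x + t *\<^sub>R axis j 1)) has_real_derivative
        (\<Sum>i\<in>UNIV. partials [j, j, i, i] f x)) (at 0)"
      by (rule DERIV_sum, rule C_closure_DERIV[OF f]) (use x in auto)
  qed (use x p1 in auto)
  then have "bilaplacian f x = (\<Sum>j\<in>UNIV. \<Sum>i\<in>UNIV. partials [j, j, i, i] f x)"
    by (simp add: bilaplacian_def laplacian_def[of "laplacian f"])
  then show ?thesis by (subst sum.swap)
qed

text \<open>Here z and its gradient both vanish on the sphere, so \<open>F\<close> may have
  arbitrary boundary values. Replacing \<open>F\<close> and its first derivatives by their
  continuous extensions reduces this to \<open>integral_radial_laplace\<close>.\<close>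

lemma integral_radial_laplace_ball:
  fixes F :: "real ^ 'n::finite \<Rightarrow> real" and Fa Fb :: "'n \<Rightarrow> real ^ 'n \<Rightarrow> real"
  assumes rl: "radial_laplace CARD('n) z l m" and z1: "z 1 = 0" and l1: "l 1 = 0"
    and F: "has_continuous_extension F" and Fa: "\<And>i. has_continuous_extension (Fa i)"
    and Fb: "\<And>i. has_continuous_extension (Fb i)"
    and dF: "\<And>i x. norm x < 1 \<Longrightarrow> ((\<lambda>t. F (x + t *\<^sub>R axis i 1)) has_real_derivative Fa i x) (at 0)"
    and dFa: "\<And>i x. norm x < 1 \<Longrightarrow> ((\<lambda>t. Fa i (x + t *\<^sub>R axis i 1)) has_real_derivative Fb i x) (at 0)"
  shows "(LINT x|lebesgue_on unit_ball. z (norm x) * (\<Sum>i\<in>UNIV. Fb i x))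
       = (LINT x|lebesgue_on unit_ball. m (norm x) * F x)"
proof -
  obtain G where G: "continuous_on (cball 0 1) G" "\<And>x. norm x < 1 \<Longrightarrow> G x = F x"
    using F by (rule has_continuous_extensionE) blast
  have "\<forall>i. \<exists>g. continuous_on (cball 0 1) g \<and> (\<forall>x. norm x < 1 \<longrightarrow> g x = Fa i x)"
    using Fa by (meson has_continuous_extensionE)
  then obtain G1 where G1: "\<And>i. continuous_on (cball 0 1) (G1 i)" "\<And>i x. norm x < 1 \<Longrightarrow> G1 i x = Fa i x"
    by metis
  have "(LINT x|lebesgue_on unit_ball. z (norm x) * (\<Sum>i\<in>UNIV. Fb i x))
       = (LINT x|lebesgue_on unit_ball. m (norm x) * G x)"
  proof (rule integral_radial_laplace[OF rl G(1) G1(1) Fb])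
    show "((\<lambda>t. G (x + t *\<^sub>R axis i 1)) has_real_derivative G1 i x) (at 0)" if "norm x < 1" for i x
      by (rule derivative_along_cong[of unit_ball x F]) (use that G(2) G1(2) dF in auto)
    show "((\<lambda>t. G1 i (x + t *\<^sub>R axis i 1)) has_real_derivative Fb i x) (at 0)" if "norm x < 1" for i x
      by (rule derivative_along_cong[of unit_ball x "Fa i"]) (use that G1(2) dFa in auto)
  qed (use z1 l1 in auto)
  also have "\<dots> = (LINT x|lebesgue_on unit_ball. m (norm x) * F x)"
    by (rule Bochner_Integration.integral_cong) (use G(2) in \<open>auto simp: space_restrict_space\<close>)
  finally show ?thesis .
qed

lemma integral_radial_laplacian:
  fixes f :: "real ^ 'n::finite \<Rightarrow> real"
  assumes f: "f \<in> C_closure k unit_ball" "2 \<le> k"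
    and rl: "radial_laplace CARD('n) z l m" "z 1 = 0" "l 1 = 0"
  shows "(LINT x|lebesgue_on unit_ball. z (norm x) * laplacian f x)
       = (LINT x|lebesgue_on unit_ball. m (norm x) * f x)"
proof -
  have e: "has_continuous_extension (partials is f)" if "length is \<le> 2" for "is"
    using f that by (auto intro: C_closure_extension)
  have d: "((\<lambda>t. partials is f (x + t *\<^sub>R axis i 1)) has_real_derivative partials (i # is) f x) (at 0)"
    if "length is < 2" "norm x < 1" for "is" i x
    using f that by (intro C_closure_DERIV[of f k]) auto
  show ?thesis
    unfolding laplacian_eq
    by (rule integral_radial_laplace_ball[OF rl, where Fa = "\<lambda>i. partials [i] f"])
       (use e[of "[]"] e d[of "[]"] d in auto)
qed

text \<open>The bilaplacian is the sum over i of the Laplacians of the pure second derivatives, and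
  Green's identity applies to each of these separately.\<close>

lemma integral_radial_bilaplacian:
  fixes f :: "real ^ 'n::finite \<Rightarrow> real"
  assumes f: "f \<in> C_closure 4 unit_ball"
    and rl: "radial_laplace CARD('n) z l m" "z 1 = 0" "l 1 = 0"
  shows "(LINT x|lebesgue_on unit_ball. z (norm x) * bilaplacian f x)
       = (LINT x|lebesgue_on unit_ball. m (norm x) * laplacian f x)"
proof -
  note ext = C_closure_extension[OF f]
  have zc: "continuous_on {0..1} z" and mc: "continuous_on {0..1} m"
    using rl(1) by (auto simp: radial_laplace_def)
  have 1: "(LINT x|lebesgue_on unit_ball. z (norm x) * (\<Sum>j\<in>UNIV. partials [j, j, i, i] f x))
       = (LINT x|lebesgue_on unit_ball. m (norm x) * partials [i, i] f x)" for i
    by (rule integral_radial_laplace_ball[OF rl, where Fa = "\<lambda>j. partials [j, i, i] f"])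
       (auto intro!: ext C_closure_DERIV[OF f])
  have i1: "integrable (lebesgue_on unit_ball) (\<lambda>x. z (norm x) * (\<Sum>j\<in>UNIV. partials [j, j, i, i] f x))" for i
    by (intro has_continuous_extension_integrable has_continuous_extension_mult
        has_continuous_extension_sum has_continuous_extension_radial zc ext) auto
  have i2: "integrable (lebesgue_on unit_ball) (\<lambda>x. m (norm x) * partials [i, i] f x)" for i
    by (intro has_continuous_extension_integrable has_continuous_extension_mult
        has_continuous_extension_radial mc ext) auto
  have "(LINT x|lebesgue_on unit_ball. z (norm x) * bilaplacian f x)
      = (LINT x|lebesgue_on unit_ball. (\<Sum>i\<in>UNIV. z (norm x) * (\<Sum>j\<in>UNIV. partials [j, j, i, i] f x)))"
    by (rule Bochner_Integration.integral_cong)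
       (auto simp: space_restrict_space bilaplacian_eq[OF f] sum_distrib_left)
  also have "\<dots> = (LINT x|lebesgue_on unit_ball. (\<Sum>i\<in>UNIV. m (norm x) * partials [i, i] f x))"
    using i1 i2 1 by (simp add: Bochner_Integration.integral_sum)
  also have "\<dots> = (LINT x|lebesgue_on unit_ball. m (norm x) * laplacian f x)"
    by (simp add: laplacian_eq sum_distrib_left)
  finally show ?thesis .
qed

text \<open>Taylor's formula at the boundary point along each ray: second derivatives are bounded,
  and the first-order coefficient is the normal derivative, which is zero. The decay later absorbs
  two derivatives falling on a cutoff.\<close>

lemma dirichlet_quadratic_decay:
  fixes u :: "real ^ 'n::finite \<Rightarrow> real"
  assumes u: "u \<in> C_closure k unit_ball" "2 \<le> k"
    and bd: "\<And>x. norm x = 1 \<Longrightarrow> u x = 0" "\<And>x. norm x = 1 \<Longrightarrow> has_normal_derivative u 0 x"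
  obtains C where "0 \<le> C" "\<And>x. norm x \<le> 1 \<Longrightarrow> \<bar>u x\<bar> \<le> C * (1 - norm x)\<^sup>2"
proof -
  have "\<forall>i j. \<exists>C\<ge>0. \<forall>x. norm x < 1 \<longrightarrow> \<bar>partials [j, i] u x\<bar> \<le> C"
  proof (intro allI)
    fix i j
    have "has_continuous_extension (partials [j, i] u)"
      using u by (intro C_closure_extension[of u k]) auto
    then show "\<exists>C\<ge>0. \<forall>x. norm x < 1 \<longrightarrow> \<bar>partials [j, i] u x\<bar> \<le> C"
      by (metis has_continuous_extension_bounded)
  qed
  then obtain B where B: "\<And>i j. 0 \<le> B i j" "\<And>i j x. norm x < 1 \<Longrightarrow> \<bar>partials [j, i] u x\<bar> \<le> B i j"
    by metis
  \<comment> \<open>Bounds the second derivative along every ray, since the coordinates of a unit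
    vector are at most 1 in absolute value.\<close>
  define C where "C = (\<Sum>i\<in>UNIV. \<Sum>j\<in>UNIV. B i j)"
  have C0: "0 \<le> C" unfolding C_def by (intro sum_nonneg B)
  have "\<forall>i. \<exists>g. continuous_on (cball 0 1) g \<and> (\<forall>x. norm x < 1 \<longrightarrow> g x = partials [i] u x)"
  proof
    fix i
    have "has_continuous_extension (partials [i] u)"
      using u by (intro C_closure_extension[of u k]) auto
    then show "\<exists>g. continuous_on (cball 0 1) g \<and> (\<forall>x. norm x < 1 \<longrightarrow> g x = partials [i] u x)"
      by (meson has_continuous_extensionE)
  qed
  then obtain g where g: "\<And>i. continuous_on (cball 0 1) (g i)" "\<And>i x. norm x < 1 \<Longrightarrow> g i x = partials [i] u x"
    by metis
  have ray: "\<bar>u (s *\<^sub>R \<theta>)\<bar> \<le> C * (1 - s)\<^sup>2" if \<theta>: "norm \<theta> = 1" and s: "0 \<le> s" "s \<le> 1" for \<theta> :: "real ^ 'n" and s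
  proof -
    define U where "U s = u (s *\<^sub>R \<theta>)" for s
    \<comment> \<open>The derivative of \<open>U\<close>, expressed through the extensions
      \<open>g i\<close> so that it has a continuous value at the endpoint s = 1.\<close>
    define W where "W s = (\<Sum>i\<in>UNIV. \<theta> $ i * g i (s *\<^sub>R \<theta>))" for s
    define W' where "W' s = (\<Sum>i\<in>UNIV. \<theta> $ i * (\<Sum>j\<in>UNIV. \<theta> $ j * partials [j, i] u (s *\<^sub>R \<theta>)))" for s
    have inb: "norm (s *\<^sub>R \<theta>) < 1" if "0 < s" "s < 1" for s using that \<theta> by simp
    have th: "\<bar>\<theta> $ i\<bar> \<le> 1" for i using component_le_norm_cart[of \<theta> i] \<theta> by simp
    have shift: "(h has_real_derivative d) (at s)" if "((\<lambda>t. h (s + t)) has_real_derivative d) (at 0)" for h d and s :: real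
      using DERIV_shift[of h d 0 s] that by (simp add: add.commute)
    have cU: "continuous_on {0..1} U"
      unfolding U_def using \<theta>
      by (intro continuous_on_compose2[OF C_closure_continuous[OF u(1)]] continuous_intros) auto
    have cW: "continuous_on {0..1} W"
      unfolding W_def using \<theta>
      by (intro continuous_intros continuous_on_compose2[OF g(1)]) auto
    have dU: "(U has_real_derivative W s) (at s)" if "0 < s" "s < 1" for s
    proof (rule shift)
      have "u differentiable (at (s *\<^sub>R \<theta>))"
        using C_closure_differentiable[OF u(1), of "[]"] u(2) inb[OF that] by auto
      from DERIV_along_vector[OF this, of \<theta>] show "((\<lambda>t. U (s + t)) has_real_derivative W s) (at 0)"
        using g(2)[OF inb[OF that]] by (simp add: U_def W_def scaleR_add_left partials_Cons)
    qed
    have dW: "(W has_real_derivative W' s) (at s)" if "0 < s" "s < 1" for s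
    proof (rule has_field_derivative_transform_within_open[where S = "{0<..<1}"])
      have "((\<lambda>s. partials [i] u (s *\<^sub>R \<theta>)) has_real_derivative (\<Sum>j\<in>UNIV. \<theta> $ j * partials [j, i] u (s *\<^sub>R \<theta>))) (at s)" for i
      proof (rule shift)
        have "partials [i] u differentiable (at (s *\<^sub>R \<theta>))"
          using C_closure_differentiable[OF u(1), of "[i]"] u(2) inb[OF that] by auto
        from DERIV_along_vector[OF this, of \<theta>]
        show "((\<lambda>t. partials [i] u ((s + t) *\<^sub>R \<theta>)) has_real_derivative
            (\<Sum>j\<in>UNIV. \<theta> $ j * partials [j, i] u (s *\<^sub>R \<theta>))) (at 0)"
          by (simp add: scaleR_add_left partials_Cons)
      qed
      then show "((\<lambda>s. \<Sum>i\<in>UNIV. \<theta> $ i * partials [i] u (s *\<^sub>R \<theta>)) has_real_derivative W' s) (at s)"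
        unfolding W'_def by (intro DERIV_sum DERIV_cmult)
      show "(\<Sum>i\<in>UNIV. \<theta> $ i * partials [i] u (t *\<^sub>R \<theta>)) = W t" if "t \<in> {0<..<1}" for t
        using g(2)[OF inb, of t] that by (simp add: W_def)
    qed (use that in auto)
    have W'C: "\<bar>W' s\<bar> \<le> C" if "0 < s" "s < 1" for s
      unfolding W'_def C_def
    proof (rule order_trans[OF sum_abs], rule sum_mono)
      fix i
      have "\<bar>\<Sum>j\<in>UNIV. \<theta> $ j * partials [j, i] u (s *\<^sub>R \<theta>)\<bar> \<le> (\<Sum>j\<in>UNIV. B i j)"
      proof (rule order_trans[OF sum_abs], rule sum_mono)
        fix j
        have "\<bar>\<theta> $ j * partials [j, i] u (s *\<^sub>R \<theta>)\<bar> \<le> 1 * B i j"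
          unfolding abs_mult by (rule mult_mono) (use th B(2)[OF inb[OF that]] in auto)
        then show "\<bar>\<theta> $ j * partials [j, i] u (s *\<^sub>R \<theta>)\<bar> \<le> B i j" by simp
      qed
      then have "\<bar>\<theta> $ i * (\<Sum>j\<in>UNIV. \<theta> $ j * partials [j, i] u (s *\<^sub>R \<theta>))\<bar> \<le> 1 * (\<Sum>j\<in>UNIV. B i j)"
        unfolding abs_mult by (rule mult_mono[OF th]) auto
      then show "\<bar>\<theta> $ i * (\<Sum>j\<in>UNIV. \<theta> $ j * partials [j, i] u (s *\<^sub>R \<theta>))\<bar> \<le> (\<Sum>j\<in>UNIV. B i j)" by simp
    qed
    define L where "L = W 1"
    have WL: "\<bar>W t - L\<bar> \<le> C * (1 - t)" if "0 \<le> t" "t \<le> 1" for t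
    proof -
      have "\<bar>W 1 - W t\<bar> \<le> C * (1 - t)"
        by (rule abs_diff_le_of_derivative_bound[where S = "{}" and f' = W'])
           (use that dW W'C C0 in \<open>auto intro: continuous_on_subset[OF cW]\<close>)
      then show ?thesis by (simp add: L_def abs_minus_commute)
    qed
    have UL: "\<bar>U t + L * (1 - t)\<bar> \<le> C * (1 - t)\<^sup>2" if t: "0 \<le> t" "t \<le> 1" for t
    proof -
      have "\<bar>(U 1 - L * 1) - (U t - L * t)\<bar> \<le> (C * (1 - t)) * (1 - t)"
      proof (rule abs_diff_le_of_derivative_bound[where S = "{}" and f' = "\<lambda>s. W s - L"])
        show "continuous_on {t..1} (\<lambda>s. U s - L * s)"
          using t by (intro continuous_intros continuous_on_subset[OF cU]) auto
        fix s assume s: "t < s" "s < 1"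
        show "((\<lambda>s. U s - L * s) has_real_derivative W s - L) (at s)"
          using dU[of s] s t by (auto intro!: derivative_eq_intros)
        have "C * (1 - s) \<le> C * (1 - t)" using s C0 by (intro mult_left_mono) auto
        then show "\<bar>W s - L\<bar> \<le> C * (1 - t)" using WL[of s] s t by linarith
      qed (use t C0 in auto)
      moreover have "U 1 = 0" using bd(1)[OF \<theta>] by (simp add: U_def)
      moreover have "(U 1 - L * 1) - (U t - L * t) = - (U t + L * (1 - t)) + U 1" by (simp add: algebra_simps)
      ultimately show ?thesis by (simp only: abs_minus_cancel add_0_right power2_eq_square mult.assoc)
    qed
    \<comment> \<open>The one-sided quotient u(theta + t theta) / t tends to 0 by the boundary
      condition and to \<open>L\<close> by the expansion \<open>UL\<close>.\<close>
    have "L = 0"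
    proof -
      have U1: "U (1 + t) = u (\<theta> + t *\<^sub>R \<theta>)" for t by (simp add: U_def scaleR_add_left)
      have "((\<lambda>t. u (\<theta> + t *\<^sub>R \<theta>)) has_real_derivative 0) (at_left 0)"
        using bd(2)[OF \<theta>] by (simp add: has_normal_derivative_def)
      then have q0: "((\<lambda>t. u (\<theta> + t *\<^sub>R \<theta>) / t) \<longlongrightarrow> 0) (at_left 0)"
        using bd(1)[OF \<theta>] by (simp add: has_field_derivative_iff)
      have ev: "\<forall>\<^sub>F t in at_left (0::real). t \<in> {-1<..<0}" 
        by (rule eventually_at_leftI[of "-1"]) auto
      have "((\<lambda>t. u (\<theta> + t *\<^sub>R \<theta>) / t - L) \<longlongrightarrow> 0) (at_left 0)"
      proof (rule Lim_null_comparison)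
        show "\<forall>\<^sub>F t in at_left 0. norm (u (\<theta> + t *\<^sub>R \<theta>) / t - L) \<le> C * \<bar>t\<bar>"
          using ev
        proof eventually_elim
          case (elim t)
          have "\<bar>u (\<theta> + t *\<^sub>R \<theta>) - L * t\<bar> \<le> C * t\<^sup>2"
            using UL[of "1 + t"] elim by (simp add: U1)
          then have "\<bar>u (\<theta> + t *\<^sub>R \<theta>) - L * t\<bar> / \<bar>t\<bar> \<le> C * t\<^sup>2 / \<bar>t\<bar>"
            by (rule divide_right_mono) simp
          moreover have "u (\<theta> + t *\<^sub>R \<theta>) / t - L = (u (\<theta> + t *\<^sub>R \<theta>) - L * t) / t"
            using elim by (simp add: field_simps)
          moreover have "C * t\<^sup>2 / \<bar>t\<bar> = C * \<bar>t\<bar>"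
            using elim by (simp add: power2_eq_square field_simps)
          ultimately show ?case by (simp add: abs_divide)
        qed
        show "((\<lambda>t. C * \<bar>t\<bar>) \<longlongrightarrow> 0) (at_left 0)"
          by (rule tendsto_eq_intros refl | simp)+
      qed
      then have "((\<lambda>t. u (\<theta> + t *\<^sub>R \<theta>) / t) \<longlongrightarrow> L) (at_left 0)" by (simp add: LIM_zero_iff)
      from tendsto_unique[OF _ this q0] show "L = 0" by simp
    qed
    then show ?thesis using UL[OF s] by (simp add: U_def)
  qed
  show ?thesis
  proof (rule that[OF C0])
    fix x :: "real ^ 'n" assume x: "norm x \<le> 1"
    obtain \<theta> where "norm \<theta> = 1" "x = norm x *\<^sub>R \<theta>"
    proof (cases "x = 0")
      case True
      then show ?thesis using that[of "axis undefined 1"] by (simp add: norm_axis_1)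
    next
      case False
      then show ?thesis using that[of "sgn x"] by (simp add: norm_sgn sgn_div_norm)
    qed
    then show "\<bar>u x\<bar> \<le> C * (1 - norm x)\<^sup>2" using ray[of \<theta> "norm x"] x by simp
  qed
qed

text \<open>The product rule Delta(c z) = c Delta z + 2 grad c . grad z + z Delta c. With grad c = x
  d the mixed term is 2 r^2 d l, and Delta c = r d' + n d = e + n d.\<close>

lemma radial_laplace_mult:
  assumes rl: "radial_laplace n z l m"
    and c: "continuous_on {0..1} c" and d: "continuous_on {0..1} d" and e: "continuous_on {0..1} e"
    and dc: "\<And>r. 0 < r \<Longrightarrow> r < 1 \<Longrightarrow> (c has_real_derivative r * d r) (at r)"
    and dd: "\<And>r. 0 < r \<Longrightarrow> r < 1 \<Longrightarrow> (d has_real_derivative e r / r) (at r)"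
  shows "radial_laplace n (\<lambda>r. c r * z r) (\<lambda>r. c r * l r + d r * z r)
    (\<lambda>r. c r * m r + 2 * r\<^sup>2 * d r * l r + (e r + real n * d r) * z r)"
proof -
  note rl' = rl[unfolded radial_laplace_def]
  have 1: "((\<lambda>r. c r * z r) has_real_derivative r * (c r * l r + d r * z r)) (at r)" if "0 < r" "r < 1" for r
    using DERIV_mult[OF dc[OF that], of z "r * l r"] rl' that by (simp add: algebra_simps)
  have 2: "((\<lambda>r. c r * l r + d r * z r) has_real_derivative
     (c r * m r + 2 * r\<^sup>2 * d r * l r + (e r + real n * d r) * z r - real n * (c r * l r + d r * z r)) / r) (at r)"
    if "0 < r" "r < 1" for r
  proof -
    have "((\<lambda>r. c r * l r + d r * z r) has_real_derivative
      (r * d r * l r + (m r - real n * l r) / r * c r) + (e r / r * z r + r * l r * d r)) (at r)"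
      by (intro DERIV_add DERIV_mult dc dd) (use rl' that in auto)
    moreover have "(r * d r * l r + (m r - real n * l r) / r * c r) + (e r / r * z r + r * l r * d r)
      = (c r * m r + 2 * r\<^sup>2 * d r * l r + (e r + real n * d r) * z r - real n * (c r * l r + d r * z r)) / r"
      using that by (simp add: field_simps power2_eq_square)
    ultimately show ?thesis by simp
  qed
  show ?thesis
    unfolding radial_laplace_def
    using 1 2 rl' by (auto intro!: continuous_intros c d e)
qed

text \<open>Each power r^t with t at most p is at least r^p, and their sum times 1 - r telescopes.
  The bound is uniform in p, which is what dominated convergence requires.\<close>

lemma cutoff_bound:
  fixes r :: real
  assumes "0 \<le> r" "r \<le> 1"
  shows "real (p + 1) * r ^ p * (1 - r) \<le> 1"
proof -
  have "(\<Sum>t\<le>p. r ^ p) \<le> (\<Sum>t\<le>p. r ^ t)"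
    by (intro sum_mono power_decreasing) (use assms in auto)
  then have "real (p + 1) * r ^ p * (1 - r) \<le> (\<Sum>t\<le>p. r ^ t) * (1 - r)"
    using assms by (intro mult_right_mono) auto
  also have "\<dots> = 1 - r ^ (Suc p)" using sum_gp_basic[of r p] by (simp add: mult.commute)
  also have "\<dots> \<le> 1" using assms by simp
  finally show ?thesis .
qed

lemma cutoff_limit:
  fixes r :: real
  assumes "0 \<le> r" "r < 1"
  shows "(\<lambda>p. real (p + 1) * r ^ p) \<longlonglongrightarrow> 0"
proof -
  have "(\<lambda>p. real p * r ^ p + r ^ p) \<longlonglongrightarrow> 0 + 0"
    by (intro tendsto_add powser_times_n_limit_0 LIMSEQ_power_zero) (use assms in auto)
  then show ?thesis by (simp add: algebra_simps)
qed

text \<open>The radial function \<open>z\<close> need not vanish on the sphere. It is multiplied by the cutoff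
  \<open>(1 - r\<^bsup>2p+2\<^esup>)\<^sup>2\<close>; the terms in which the cutoff is differentiated are dominated since \<open>f\<close> is
  of order \<open>(1 - r)\<^sup>2\<close>.\<close>

lemma integral_radial_laplacian_dirichlet:
  fixes f :: "real ^ 'n::finite \<Rightarrow> real"
  assumes f: "f \<in> C_closure k unit_ball" "2 \<le> k"
    and bd: "\<And>x. norm x = 1 \<Longrightarrow> f x = 0" "\<And>x. norm x = 1 \<Longrightarrow> has_normal_derivative f 0 x"
    and rl: "radial_laplace CARD('n) z l m"
  shows "(LINT x|lebesgue_on unit_ball. z (norm x) * laplacian f x)
       = (LINT x|lebesgue_on unit_ball. m (norm x) * f x)"
proof -
  let ?n = "real CARD('n)"
  note rl' = rl[unfolded radial_laplace_def]
  obtain C where C: "0 \<le> C" "\<And>x. norm x \<le> 1 \<Longrightarrow> \<bar>f x\<bar> \<le> C * (1 - norm x)\<^sup>2"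
    using dirichlet_quadratic_decay[OF f bd] by blast
  have bnd: "\<exists>B\<ge>0. \<forall>r. 0 \<le> r \<and> r \<le> 1 \<longrightarrow> \<bar>h r\<bar> \<le> B" if "continuous_on {0..1} h" for h :: "real \<Rightarrow> real"
  proof -
    have "bounded (h ` {0..1})"
      by (rule compact_imp_bounded, rule compact_continuous_image) (use that in auto)
    then obtain B where B: "\<And>r. r \<in> {0..1} \<Longrightarrow> \<bar>h r\<bar> \<le> B"
      unfolding bounded_iff real_norm_def by blast
    have "0 \<le> B" using order_trans[OF abs_ge_zero B[of 0]] by simp
    then show ?thesis using B by auto
  qed
  obtain Z where Z: "0 \<le> Z" "\<And>r. 0 \<le> r \<Longrightarrow> r \<le> 1 \<Longrightarrow> \<bar>z r\<bar> \<le> Z" using bnd[of z] rl' by blast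
  obtain L where L: "0 \<le> L" "\<And>r. 0 \<le> r \<Longrightarrow> r \<le> 1 \<Longrightarrow> \<bar>l r\<bar> \<le> L" using bnd[of l] rl' by blast
  obtain M where M: "0 \<le> M" "\<And>r. 0 \<le> r \<Longrightarrow> r \<le> 1 \<Longrightarrow> \<bar>m r\<bar> \<le> M" using bnd[of m] rl' by blast
  define a where "a p = real (2 * p + 2)" for p :: nat
  \<comment> \<open>The square makes both the cutoff and its derivative vanish at r = 1, as the
    identity for functions vanishing to first order demands. The summand 2 in the exponent keeps
    \<open>d p\<close>, the derivative divided by r, a polynomial; the even exponent turns r^(2p)
    into a square.\<close>
  define c where "c p r = (1 - r ^ (2 * p + 2))\<^sup>2" for p and r :: real
  define d where "d p r = - 2 * a p * r ^ (2 * p) * (1 - r ^ (2 * p + 2))" for p and r :: real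
  define e where "e p r = - 2 * a p * (real (2 * p) * r ^ (2 * p) * (1 - r ^ (2 * p + 2))
    - a p * r ^ (2 * p) * r ^ (2 * p + 2))" for p and r :: real
  define zp where "zp p r = c p r * z r" for p r
  define mp where "mp p r = c p r * m r + 2 * r\<^sup>2 * d p r * l r + (e p r + ?n * d p r) * z r" for p r
  have dq: "((\<lambda>r. 1 - r ^ (2 * p + 2)) has_real_derivative 0 - a p * (r * r ^ (2 * p))) (at r)" for p and r :: real
    by (intro DERIV_diff DERIV_const) (use DERIV_pow[of "2 * p + 2" r] in \<open>simp add: a_def\<close>)
  have dc: "(c p has_real_derivative r * d p r) (at r)" for p r
  proof -
    have "of_nat 2 * ((0 - a p * (r * r ^ (2 * p))) * (1 - r ^ (2 * p + 2)) ^ (2 - Suc 0)) = r * d p r"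
      by (simp add: d_def algebra_simps)
    with DERIV_power[OF dq[of p r], of 2] show ?thesis unfolding c_def[abs_def] by simp
  qed
  have dd: "(d p has_real_derivative e p r / r) (at r)" if "0 < r" "r < 1" for p r
  proof -
    have "((\<lambda>r::real. r ^ (2 * p)) has_real_derivative real (2 * p) * r ^ (2 * p) / r) (at r)"
      using DERIV_pow[of "2 * p" r] that by (cases p) auto
    moreover have "((\<lambda>r::real. 1 - r ^ (2 * p + 2)) has_real_derivative - a p * r ^ (2 * p + 2) / r) (at r)"
      using dq[of p r] that by simp
    ultimately have "((\<lambda>r. - 2 * a p * (r ^ (2 * p) * (1 - r ^ (2 * p + 2)))) has_real_derivative
       - 2 * a p * (real (2 * p) * r ^ (2 * p) / r * (1 - r ^ (2 * p + 2)) + - a p * r ^ (2 * p + 2) / r * r ^ (2 * p))) (at r)"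
      by (intro DERIV_cmult DERIV_mult)
    moreover have "- 2 * A * (P * X / r * (1 - Y) + - A * Y / r * X) = - 2 * A * (P * X * (1 - Y) - A * X * Y) / r"
      for A P X Y using that by (simp add: field_simps)
    ultimately show ?thesis unfolding d_def[abs_def] e_def by (simp only: mult.assoc)
  qed
  have cc: "continuous_on {0..1} (c p)" "continuous_on {0..1} (d p)" "continuous_on {0..1} (e p)" for p
    unfolding c_def d_def e_def by (intro continuous_intros)+
  have rlp: "radial_laplace CARD('n) (zp p) (\<lambda>r. c p r * l r + d p r * z r) (mp p)" for p
    unfolding zp_def[abs_def] mp_def[abs_def] by (rule radial_laplace_mult[OF rl cc dc dd])
  have eqp: "(LINT x|lebesgue_on unit_ball. zp p (norm x) * laplacian f x)
       = (LINT x|lebesgue_on unit_ball. mp p (norm x) * f x)" for p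
    by (rule integral_radial_laplacian[OF f rlp]) (auto simp: zp_def c_def d_def)
  have pw: "0 \<le> r ^ j" "r ^ j \<le> 1" if "0 \<le> r" "r \<le> 1" for r :: real and j
    using that by (auto intro: power_le_one)
  have absq: "\<bar>1 - r ^ (2 * p + 2)\<bar> \<le> 1" "\<bar>r ^ (2 * p + 2)\<bar> \<le> 1" if "0 \<le> r" "r \<le> 1" for p and r :: real
    using pw[OF that, of "2 * p + 2"] by linarith+
  have c01: "\<bar>c p r\<bar> \<le> 1" if "0 \<le> r" "r \<le> 1" for p r
  proof -
    show ?thesis unfolding c_def using absq(1)[OF that, of p] by (simp add: abs_square_le_1)
  qed
  have a2: "2 \<le> a p" "a p \<le> (a p)\<^sup>2" for p by (auto simp: a_def power2_eq_square)
  have db: "\<bar>d p r\<bar> \<le> 2 * (a p)\<^sup>2 * r ^ (2 * p)" if r: "0 \<le> r" "r \<le> 1" for p r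
  proof -
    have "\<bar>d p r\<bar> = 2 * a p * r ^ (2 * p) * \<bar>1 - r ^ (2 * p + 2)\<bar>"
      unfolding d_def abs_mult using pw(1)[OF r, of "2 * p"] a2[of p] by simp
    also have "\<dots> \<le> 2 * (a p)\<^sup>2 * r ^ (2 * p) * 1"
      using pw[OF r] a2[of p] absq[OF r, of p] by (intro mult_mono) auto
    finally show ?thesis by simp
  qed
  have eb: "\<bar>e p r\<bar> \<le> 4 * (a p)\<^sup>2 * r ^ (2 * p)" if r: "0 \<le> r" "r \<le> 1" for p r
  proof -
    have "\<bar>real (2 * p) * r ^ (2 * p) * (1 - r ^ (2 * p + 2))\<bar> \<le> a p * r ^ (2 * p) * 1"
      unfolding abs_mult using pw[OF r] absq[OF r, of p] by (intro mult_mono) (auto simp: a_def)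
    moreover have "\<bar>a p * r ^ (2 * p) * r ^ (2 * p + 2)\<bar> \<le> a p * r ^ (2 * p) * 1"
      unfolding abs_mult using pw[OF r] a2[of p] absq[OF r, of p] by (intro mult_mono) auto
    ultimately have "\<bar>real (2 * p) * r ^ (2 * p) * (1 - r ^ (2 * p + 2)) - a p * r ^ (2 * p) * r ^ (2 * p + 2)\<bar>
       \<le> 2 * a p * r ^ (2 * p)" by linarith
    then have "\<bar>- 2 * a p\<bar> * \<bar>real (2 * p) * r ^ (2 * p) * (1 - r ^ (2 * p + 2)) - a p * r ^ (2 * p) * r ^ (2 * p + 2)\<bar>
       \<le> \<bar>- 2 * a p\<bar> * (2 * a p * r ^ (2 * p))"
      by (rule mult_left_mono) simp
    then show ?thesis unfolding e_def abs_mult using a2[of p] by (simp add: power2_eq_square mult_ac)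
  qed
  define K where "K = 4 * L + 4 * Z + 2 * ?n * Z"
  have K0: "0 \<le> K" using L(1) Z(1) by (simp add: K_def)
  \<comment> \<open>Everything in \<open>mp p\<close> except the undifferentiated term is an error,
    of size p^2 r^(2p).\<close>
  have mpb: "\<bar>mp p r - c p r * m r\<bar> \<le> K * ((a p)\<^sup>2 * r ^ (2 * p))" if r: "0 \<le> r" "r \<le> 1" for p r
  proof -
    let ?y = "(a p)\<^sup>2 * r ^ (2 * p)"
    have y: "0 \<le> ?y" using pw[OF r] by simp
    have "\<bar>2 * r\<^sup>2 * d p r * l r\<bar> \<le> 2 * 1 * (2 * ?y) * L"
      unfolding abs_mult using pw[OF r, of 2] db[OF r, of p] L(2)[OF r] y by (intro mult_mono) auto
    moreover have "\<bar>e p r * z r\<bar> \<le> (4 * ?y) * Z"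
      unfolding abs_mult using eb[OF r, of p] Z(2)[OF r] y by (intro mult_mono) auto
    moreover have "\<bar>?n * d p r * z r\<bar> \<le> ?n * (2 * ?y) * Z"
      unfolding abs_mult using db[OF r, of p] Z(2)[OF r] y by (intro mult_mono) auto
    moreover have "mp p r - c p r * m r = 2 * r\<^sup>2 * d p r * l r + e p r * z r + ?n * d p r * z r"
      by (simp add: mp_def algebra_simps)
    ultimately have "\<bar>mp p r - c p r * m r\<bar> \<le> 2 * 1 * (2 * ?y) * L + (4 * ?y) * Z + ?n * (2 * ?y) * Z" by linarith
    also have "\<dots> = K * ?y" by (simp add: K_def algebra_simps)
    finally show ?thesis .
  qed
  \<comment> \<open>In this form pointwise convergence to 0 inside the ball and the uniform bound
    near the sphere follow from \<open>cutoff_limit\<close> and \<open>cutoff_bound\<close> for the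
    square root.\<close>
  have asq: "(a p)\<^sup>2 * r ^ (2 * p) = 4 * (real (p + 1) * r ^ p)\<^sup>2" for p r
  proof -
    have "a p = 2 * real (p + 1)" "r ^ (2 * p) = (r ^ p)\<^sup>2"
      by (simp add: a_def) (metis mult.commute power_mult)
    then show ?thesis by (simp only: power_mult_distrib) simp
  qed
  have lim0: "(\<lambda>p. (a p)\<^sup>2 * r ^ (2 * p)) \<longlonglongrightarrow> 0" if "0 \<le> r" "r < 1" for r
    unfolding asq by (rule tendsto_eq_intros cutoff_limit[OF that] refl | simp)+
  have climit: "(\<lambda>p. c p r) \<longlonglongrightarrow> 1" if "0 \<le> r" "r < 1" for r
  proof -
    have "strict_mono (\<lambda>p::nat. 2 * p + 2)" by (auto simp: strict_mono_def)
    from LIMSEQ_subseq_LIMSEQ[OF LIMSEQ_power_zero[of r] this] that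
    have "(\<lambda>p. r ^ (2 * p + 2)) \<longlonglongrightarrow> 0" by (simp add: o_def)
    then have "(\<lambda>p. (1 - r ^ (2 * p + 2))\<^sup>2) \<longlonglongrightarrow> (1 - 0)\<^sup>2" by (intro tendsto_intros)
    then show ?thesis by (simp add: c_def)
  qed
  have mlimit: "(\<lambda>p. mp p r) \<longlonglongrightarrow> m r" if "0 \<le> r" "r < 1" for r
  proof -
    have "(\<lambda>p. mp p r - c p r * m r) \<longlonglongrightarrow> 0"
    proof (rule Lim_null_comparison)
      show "(\<lambda>p. K * ((a p)\<^sup>2 * r ^ (2 * p))) \<longlonglongrightarrow> 0"
        using tendsto_mult_left[OF lim0[OF that], of K] by simp
      show "\<forall>\<^sub>F p in sequentially. norm (mp p r - c p r * m r) \<le> K * ((a p)\<^sup>2 * r ^ (2 * p))"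
        using mpb[of r] that by simp
    qed
    moreover have "(\<lambda>p. c p r * m r) \<longlonglongrightarrow> 1 * m r" by (intro tendsto_intros climit that)
    ultimately have "(\<lambda>p. (mp p r - c p r * m r) + c p r * m r) \<longlonglongrightarrow> 0 + 1 * m r" by (rule tendsto_add)
    then show ?thesis by simp
  qed
  have fext: "has_continuous_extension f"
    using C_closure_extension[OF f(1), of "[]"] by simp
  have lext: "has_continuous_extension (laplacian f)"
    unfolding laplacian_eq[abs_def]
    by (intro has_continuous_extension_sum C_closure_extension[OF f(1)]) (use f(2) in auto)
  obtain F where F: "\<And>x. norm x < 1 \<Longrightarrow> \<bar>f x\<bar> \<le> F"
    by (rule has_continuous_extension_bounded[OF fext]) blast
  obtain D where D: "0 \<le> D" "\<And>x. norm x < 1 \<Longrightarrow> \<bar>laplacian f x\<bar> \<le> D"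
    by (rule has_continuous_extension_bounded[OF lext]) blast
  have meas: "(\<lambda>x. h (norm x) * g x) \<in> borel_measurable (lebesgue_on unit_ball)"
    if "continuous_on {0..1} h" "has_continuous_extension g" for h :: "real \<Rightarrow> real" and g :: "real ^ 'n \<Rightarrow> real"
    by (intro has_continuous_extension_measurable has_continuous_extension_mult has_continuous_extension_radial that)
  have zc: "continuous_on {0..1} (zp p)" "continuous_on {0..1} (mp p)" for p
    using rlp[of p] by (auto simp: radial_laplace_def)
  have ci: "integrable (lebesgue_on unit_ball) (\<lambda>x::real^'n. c :: real)" for c
    by (rule has_continuous_extension_integrable[OF has_continuous_extension_const])
  have l1: "(\<lambda>p. LINT x|lebesgue_on unit_ball. zp p (norm x) * laplacian f x)
      \<longlonglongrightarrow> (LINT x|lebesgue_on unit_ball. z (norm x) * laplacian f x)"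
  proof (rule integral_dominated_convergence[where w = "\<lambda>_. Z * D"])
    show "AE x in lebesgue_on unit_ball. (\<lambda>p. zp p (norm x) * laplacian f x) \<longlonglongrightarrow> z (norm x) * laplacian f x"
    proof (rule AE_I2)
      fix x :: "real ^ 'n" assume "x \<in> space (lebesgue_on unit_ball)"
      then have "norm x < 1" by (simp add: space_restrict_space)
      then have "(\<lambda>p. zp p (norm x) * laplacian f x) \<longlonglongrightarrow> 1 * z (norm x) * laplacian f x"
        unfolding zp_def by (intro tendsto_intros climit) auto
      then show "(\<lambda>p. zp p (norm x) * laplacian f x) \<longlonglongrightarrow> z (norm x) * laplacian f x" by simp
    qed
    show "AE x in lebesgue_on unit_ball. norm (zp p (norm x) * laplacian f x) \<le> Z * D" for p
    proof (rule AE_I2)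
      fix x :: "real ^ 'n" assume "x \<in> space (lebesgue_on unit_ball)"
      then have x: "norm x < 1" by (simp add: space_restrict_space)
      have "\<bar>zp p (norm x)\<bar> \<le> 1 * Z"
        unfolding zp_def abs_mult by (rule mult_mono) (use x c01 Z in auto)
      then have "\<bar>zp p (norm x)\<bar> * \<bar>laplacian f x\<bar> \<le> Z * D"
        using D(2)[OF x] Z by (intro mult_mono) auto
      then show "norm (zp p (norm x) * laplacian f x) \<le> Z * D" by (simp add: abs_mult)
    qed
  qed (use rl' zc in \<open>auto intro!: meas lext ci\<close>)
  have l2: "(\<lambda>p. LINT x|lebesgue_on unit_ball. mp p (norm x) * f x)
      \<longlonglongrightarrow> (LINT x|lebesgue_on unit_ball. m (norm x) * f x)"
  proof (rule integral_dominated_convergence[where w = "\<lambda>_. M * F + K * 4 * C"])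
    show "AE x in lebesgue_on unit_ball. (\<lambda>p. mp p (norm x) * f x) \<longlonglongrightarrow> m (norm x) * f x"
    proof (rule AE_I2)
      fix x :: "real ^ 'n" assume "x \<in> space (lebesgue_on unit_ball)"
      then have "norm x < 1" by (simp add: space_restrict_space)
      then show "(\<lambda>p. mp p (norm x) * f x) \<longlonglongrightarrow> m (norm x) * f x"
        by (intro tendsto_intros mlimit) auto
    qed
    show "AE x in lebesgue_on unit_ball. norm (mp p (norm x) * f x) \<le> M * F + K * 4 * C" for p
    proof (rule AE_I2)
      fix x :: "real ^ 'n" assume "x \<in> space (lebesgue_on unit_ball)"
      then have x: "norm x < 1" by (simp add: space_restrict_space)
      let ?r = "norm x"
      have "\<bar>c p ?r * m ?r\<bar> \<le> 1 * M"
        unfolding abs_mult by (rule mult_mono) (use x c01 M in auto)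
      then have 1: "\<bar>c p ?r * m ?r\<bar> * \<bar>f x\<bar> \<le> M * F"
        using F[OF x] M by (intro mult_mono) auto
      have "0 \<le> real (p + 1) * ?r ^ p * (1 - ?r)" using x by simp
      then have "(real (p + 1) * ?r ^ p * (1 - ?r))\<^sup>2 \<le> 1\<^sup>2"
        by (intro power_mono cutoff_bound) (use x in auto)
      \<comment> \<open>The factor (1 - r)^2 is supplied by the decay of \<open>f\<close> and
        exactly offsets the growth of the differentiated cutoff; this is the 4 in the dominating
        constant.\<close>
      then have b: "(a p)\<^sup>2 * ?r ^ (2 * p) * (1 - ?r)\<^sup>2 \<le> 4"
        unfolding asq by (simp add: power_mult_distrib)
      have "\<bar>mp p ?r - c p ?r * m ?r\<bar> * \<bar>f x\<bar> \<le> K * ((a p)\<^sup>2 * ?r ^ (2 * p)) * (C * (1 - ?r)\<^sup>2)"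
        using mpb[of ?r p] C(2)[of x] x K0 by (intro mult_mono) auto
      also have "\<dots> = (K * C) * ((a p)\<^sup>2 * ?r ^ (2 * p) * (1 - ?r)\<^sup>2)" by (simp add: mult_ac)
      also have "\<dots> \<le> (K * C) * 4" using b K0 C(1) by (intro mult_left_mono) auto
      finally have 2: "\<bar>mp p ?r - c p ?r * m ?r\<bar> * \<bar>f x\<bar> \<le> K * 4 * C" by simp
      have "\<bar>mp p ?r * f x\<bar> = \<bar>c p ?r * m ?r * f x + (mp p ?r - c p ?r * m ?r) * f x\<bar>"
        by (simp add: algebra_simps)
      also have "\<dots> \<le> \<bar>c p ?r * m ?r\<bar> * \<bar>f x\<bar> + \<bar>mp p ?r - c p ?r * m ?r\<bar> * \<bar>f x\<bar>"
        unfolding abs_mult[symmetric] by (rule abs_triangle_ineq)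
      finally show "norm (mp p ?r * f x) \<le> M * F + K * 4 * C" using 1 2 by simp
    qed
  qed (use rl' zc in \<open>auto intro!: meas fext ci\<close>)
  show ?thesis using LIMSEQ_unique[OF l1] l2 by (simp add: eqp)
qed

text \<open>In the first integration by parts the boundary terms vanish because of
  \<open>radial_green\<close>. In the second the factor \<open>radial_neumann\<close> need not
  vanish on the sphere, and the Dirichlet data of \<open>u\<close> take over.\<close>

lemma integral_radial_green_classical:
  fixes u :: "real ^ 'n::finite \<Rightarrow> real"
  assumes u: "u \<in> C_closure 4 unit_ball"
    and bd: "\<And>x. norm x = 1 \<Longrightarrow> u x = 0" "\<And>x. norm x = 1 \<Longrightarrow> has_normal_derivative u 0 x"
    and f: "continuous_on {0..1} f"
  shows "(LINT x|lebesgue_on unit_ball. radial_green CARD('n) f (norm x) * bilaplacian u x)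
       = (LINT x|lebesgue_on unit_ball. f (norm x) * u x)"
proof -
  have n: "0 < CARD('n)" by simp
  show ?thesis
    unfolding integral_radial_bilaplacian[OF u radial_laplace_green[OF f n] radial_green_1 ball_mean_neumann_1[OF f n]]
    by (rule integral_radial_laplacian_dirichlet[OF u _ bd radial_laplace_neumann[OF f n]]) auto
qed

section \<open>Test functions and the Sobolev space\<close>

text \<open>The powers of t in the denominator are included so that derivatives are combinations of
  the same functions. The parameter c is kept because for k = 0 the function tends to 1 on t > 0 as
  c tends to 0, which yields cutoffs.\<close>

definition flat_exp :: "real \<Rightarrow> nat \<Rightarrow> real \<Rightarrow> real" where
  "flat_exp c k t = (if 0 < t then exp (- c / t) / t ^ k else 0)"

lemma flat_exp_tendsto_0:
  assumes c: "0 < c"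
  shows "(flat_exp c k \<longlongrightarrow> 0) (at 0)"
proof -
  have "filterlim (\<lambda>t. c / t) at_top (at_right 0)"
    by (rule LIM_at_top_divide[OF tendsto_const c]) (auto simp: eventually_at_right_less)
  from filterlim_compose[OF tendsto_power_div_exp_0 this]
  have "((\<lambda>t. (1 / c ^ k) * ((c / t) ^ k / exp (c / t))) \<longlongrightarrow> (1 / c ^ k) * 0) (at_right 0)"
    by (intro tendsto_mult tendsto_const)
  moreover have "\<forall>\<^sub>F t in at_right 0. (1 / c ^ k) * ((c / t) ^ k / exp (c / t)) = flat_exp c k t"
    using eventually_at_right_less
    by eventually_elim (use c in \<open>simp add: flat_exp_def exp_minus power_divide divide_simps\<close>)
  ultimately have r: "(flat_exp c k \<longlongrightarrow> 0) (at_right 0)"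
    by (simp add: tendsto_cong)
  have "\<forall>\<^sub>F t in at_left (0::real). t < 0" by (auto simp: eventually_at_filter)
  then have "\<forall>\<^sub>F t in at_left 0. flat_exp c k t = 0"
    by eventually_elim (simp add: flat_exp_def)
  then have "(flat_exp c k \<longlongrightarrow> 0) (at_left 0)" by (rule tendsto_eventually)
  with r show ?thesis by (simp add: filterlim_split_at)
qed

lemma DERIV_flat_exp:
  assumes c: "0 < c"
  shows "(flat_exp c k has_real_derivative c * flat_exp c (k + 2) t - real k * flat_exp c (k + 1) t) (at t)"
proof -
  consider "0 < t" | "t < 0" | "t = 0" by linarith
  then show ?thesis
  proof cases
    case 1
    have "((\<lambda>t. exp (- c / t) / t ^ k) has_real_derivative
        (exp (- c / t) * (c / t\<^sup>2) * t ^ k - exp (- c / t) * (real k * t ^ (k - 1))) / (t ^ k * t ^ k)) (at t)"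
      using 1 by (auto intro!: derivative_eq_intros simp: power2_eq_square field_simps)
    moreover have "real k * t ^ (k - 1) = real k * t ^ k / t" using 1 by (cases k) auto
    moreover have "(exp (- c / t) * (c / t\<^sup>2) * t ^ k - exp (- c / t) * (real k * t ^ k / t)) / (t ^ k * t ^ k)
        = c * flat_exp c (k + 2) t - real k * flat_exp c (k + 1) t"
      using 1 by (simp add: flat_exp_def field_simps power2_eq_square)
    ultimately have "((\<lambda>t. exp (- c / t) / t ^ k) has_real_derivative
        c * flat_exp c (k + 2) t - real k * flat_exp c (k + 1) t) (at t)" by simp
    then show ?thesis
      by (rule has_field_derivative_transform_within_open[where S = "{0<..}"]) (use 1 in \<open>auto simp: flat_exp_def\<close>)
  next
    case 2
    have "((\<lambda>t. 0) has_real_derivative 0) (at t)" by simp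
    then have "(flat_exp c k has_real_derivative 0) (at t)"
      by (rule has_field_derivative_transform_within_open[where S = "{..<0}"]) (use 2 in \<open>auto simp: flat_exp_def\<close>)
    then show ?thesis using 2 by (simp add: flat_exp_def)
  next
    case 3
    \<comment> \<open>At 0 the difference quotient is again in the family, with k raised by one, so
      its limit is already known.\<close>
    have "(flat_exp c k h - flat_exp c k 0) / (h - 0) = flat_exp c (k + 1) h" for h
      by (simp add: flat_exp_def)
    then have "(flat_exp c k has_real_derivative 0) (at 0)"
      unfolding has_field_derivative_iff using flat_exp_tendsto_0[OF c, of "k + 1"] by simp
    then show ?thesis using 3 by (simp add: flat_exp_def)
  qed
qed

text \<open>A class containing the bump functions of |x|^2 and closed under everything that a
  partial derivative produces. Smoothness of all orders then takes only one induction for the first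
  derivative and one over the list of directions.\<close>

inductive_set bumps :: "real \<Rightarrow> real \<Rightarrow> (real ^ 'n::finite \<Rightarrow> real) set" for c \<rho> where
  base: "(\<lambda>x. flat_exp c k (\<rho> - x \<bullet> x)) \<in> bumps c \<rho>"
| add: "f \<in> bumps c \<rho> \<Longrightarrow> g \<in> bumps c \<rho> \<Longrightarrow> (\<lambda>x. f x + g x) \<in> bumps c \<rho>"
| scale: "f \<in> bumps c \<rho> \<Longrightarrow> (\<lambda>x. a * f x) \<in> bumps c \<rho>"
| coord: "f \<in> bumps c \<rho> \<Longrightarrow> (\<lambda>x. x $ i * f x) \<in> bumps c \<rho>"

lemma bumps_partial:
  fixes f :: "real ^ 'n::finite \<Rightarrow> real"
  assumes "f \<in> bumps c \<rho>" "0 < c"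
  shows "(\<forall>x. f differentiable (at x)) \<and> (\<forall>i. partial i f \<in> bumps c \<rho>)"
  using assms(1)
proof induction
  case (base k)
  let ?f = "\<lambda>x::real^'n. flat_exp c k (\<rho> - x \<bullet> x)"
  have d: "?f differentiable (at x)" for x
  proof -
    have "((\<lambda>x. \<rho> - x \<bullet> x) has_derivative (\<lambda>h. - (x \<bullet> h + h \<bullet> x))) (at x)"
      by (auto intro!: derivative_eq_intros)
    from has_derivative_compose[OF this DERIV_flat_exp[OF assms(2), unfolded has_field_derivative_def]]
    show ?thesis by (rule differentiableI)
  qed
  have "partial i ?f = (\<lambda>x. x $ i * ((- 2 * c) * flat_exp c (k + 2) (\<rho> - x \<bullet> x)
      + (2 * real k) * flat_exp c (k + 1) (\<rho> - x \<bullet> x)))" for i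
  proof (rule ext, rule partial_eqI)
    fix x :: "real ^ 'n"
    have "((\<lambda>t. \<rho> - (x + t *\<^sub>R axis i 1) \<bullet> (x + t *\<^sub>R axis i 1)) has_real_derivative - (x $ i + x $ i)) (at 0)"
      by (auto intro!: derivative_eq_intros simp: inner_add_left inner_add_right inner_axis inner_axis')
    from DERIV_chain2[OF DERIV_flat_exp[OF assms(2), of k] this]
    show "((\<lambda>t. ?f (x + t *\<^sub>R axis i 1)) has_real_derivative x $ i * ((- 2 * c) * flat_exp c (k + 2) (\<rho> - x \<bullet> x)
      + (2 * real k) * flat_exp c (k + 1) (\<rho> - x \<bullet> x))) (at 0)"
      by (simp add: algebra_simps)
  qed
  then have "partial i ?f \<in> bumps c \<rho>" for i
    by (simp only:) (intro bumps.coord bumps.add bumps.scale bumps.base)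
  then show ?case using d by blast
next
  case (add f g)
  have "partial i (\<lambda>x. f x + g x) = (\<lambda>x. partial i f x + partial i g x)" for i
    by (rule ext, rule partial_eqI, rule DERIV_add; rule DERIV_along_axis; use add in blast)
  then show ?case using add by (auto intro!: bumps.intros)
next
  case (scale f a)
  have "partial i (\<lambda>x. a * f x) = (\<lambda>x. a * partial i f x)" for i
    by (rule ext, rule partial_eqI, rule DERIV_cmult, rule DERIV_along_axis) (use scale in blast)
  then show ?case using scale by (auto intro!: bumps.intros)
next
  case (coord f j)
  have "partial i (\<lambda>x. x $ j * f x) = (\<lambda>x. (if i = j then 1 else 0) * f x + x $ j * partial i f x)" for i
  proof (rule ext, rule partial_eqI)
    fix x :: "real ^ 'n"
    have 1: "((\<lambda>t. (x + t *\<^sub>R axis i 1) $ j) has_real_derivative (if i = j then 1 else 0)) (at 0)"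
      by (auto intro!: derivative_eq_intros simp: axis_def)
    have "f differentiable (at x)" using coord by blast
    from DERIV_mult[OF 1 DERIV_along_axis[OF this, of i]]
    show "((\<lambda>t. (x + t *\<^sub>R axis i 1) $ j * f (x + t *\<^sub>R axis i 1)) has_real_derivative
        (if i = j then 1 else 0) * f x + x $ j * partial i f x) (at 0)"
      by (simp add: algebra_simps)
  qed
  moreover have "(\<lambda>x. x $ j * f x) differentiable (at x)" for x
  proof (intro differentiable_mult)
    show "(\<lambda>x. x $ j) differentiable (at x)"
      by (rule bounded_linear_imp_differentiable) (rule bounded_linear_vec_nth)
  qed (use coord in blast)
  ultimately show ?case using coord by (auto intro!: bumps.intros)
qed

lemma bumps_vanish:
  "f \<in> bumps c \<rho> \<Longrightarrow> \<rho> \<le> x \<bullet> x \<Longrightarrow> f x = 0"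
  by (induction rule: bumps.induct) (auto simp: flat_exp_def)

lemma bumps_test_functions:
  fixes f :: "real ^ 'n::finite \<Rightarrow> real"
  assumes f: "f \<in> bumps c (R\<^sup>2)" and c: "0 < c" and R: "0 \<le> R" "R < 1"
  shows "f \<in> test_functions unit_ball"
proof -
  have p: "partials is f \<in> bumps c (R\<^sup>2)" for "is"
    by (induction "is") (use f bumps_partial[OF _ c] in \<open>auto simp: partials_Cons\<close>)
  have "partials is f differentiable_on UNIV" for "is"
    using bumps_partial[OF p c] by (auto simp: differentiable_on_def)
  moreover have "f x = 0" if "x \<notin> cball 0 R" for x
  proof (rule bumps_vanish[OF f])
    have "R\<^sup>2 \<le> (norm x)\<^sup>2" using that R by (intro power_mono) auto
    then show "R\<^sup>2 \<le> x \<bullet> x" by (simp add: power2_norm_eq_inner)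
  qed
  moreover have "cball 0 R \<subseteq> (unit_ball :: (real^'n) set)" using R by auto
  ultimately show ?thesis
    unfolding test_functions_def by (auto intro!: exI[of _ "cball 0 R"])
qed

lemma bumps_sum:
  assumes "finite A" "A \<noteq> {}" "\<And>i. i \<in> A \<Longrightarrow> f i \<in> bumps c \<rho>"
  shows "(\<lambda>x. \<Sum>i\<in>A. f i x) \<in> bumps c \<rho>"
  using assms by (induction A rule: finite_ne_induct) (auto intro: bumps.add)

text \<open>The factor x . x is the sum of the squares of the coordinates, so multiplication by it
  stays in the class. For products of polynomials \<open>f\<close> must be arbitrary in the
  induction, as the second factor is absorbed into it.\<close>

lemma bumps_polynomial:
  assumes "real_polynomial_function p" "f \<in> bumps c \<rho>"
  shows "(\<lambda>x. p (x \<bullet> x) * f x) \<in> bumps c \<rho>"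
  using assms
proof (induction arbitrary: f)
  case (linear p)
  note f = linear.prems
  interpret bounded_linear p by fact
  have p: "p s = p 1 * s" for s using scaleR[of s 1] by (simp add: mult.commute)
  have "(\<lambda>x. p 1 * (\<Sum>i\<in>UNIV. x $ i * (x $ i * f x))) \<in> bumps c \<rho>"
    by (intro bumps.scale bumps_sum bumps.coord f) auto
  moreover have "p 1 * (\<Sum>i\<in>UNIV. x $ i * (x $ i * f x)) = p (x \<bullet> x) * f x" for x
    by (subst p) (simp add: inner_vec_def sum_distrib_right mult.assoc)
  ultimately show ?case by simp
next
  case (const a)
  from bumps.scale[OF const.prems] show ?case .
next
  case (add p q)
  then show ?case by (simp add: distrib_right bumps.add)
next
  case (mult p q)
  then show ?case using mult.IH(1)[OF mult.IH(2)[OF mult.prems]] by (simp add: mult.assoc)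
qed

text \<open>The polynomial is multiplied by bumps \<open>b j\<close> with values in [0, 1],
  supported in the ball of radius \<open>R j\<close> < 1. As \<open>R j\<close> tends to 1 and the
  parameter of \<open>flat_exp\<close> to 0, they tend to 1 at every point of the ball, and
  dominated convergence removes them.\<close>

lemma integral_mult_polynomial_zero:
  fixes F :: "real ^ 'n::finite \<Rightarrow> real"
  assumes F: "integrable (lebesgue_on unit_ball) F"
    and 0: "\<And>\<tau>. \<tau> \<in> test_functions unit_ball \<Longrightarrow> (LINT x|lebesgue_on unit_ball. F x * \<tau> x) = 0"
    and p: "real_polynomial_function p"
  shows "(LINT x|lebesgue_on unit_ball. F x * p (x \<bullet> x)) = 0"
proof -
  define R where "R j = 1 - 1 / real (Suc j)" for j
  define b where "b j x = flat_exp (1 / real (Suc j)) 0 ((R j)\<^sup>2 - x \<bullet> x)" for j and x :: "real ^ 'n"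
  have R: "0 \<le> R j" "R j < 1" for j by (auto simp: R_def field_simps)
  have c0: "(\<lambda>j. 1 / real (Suc j)) \<longlonglongrightarrow> 0" by (rule LIMSEQ_Suc[OF lim_1_over_n])
  have R1: "R \<longlonglongrightarrow> 1" unfolding R_def using tendsto_diff[OF tendsto_const c0, of 1] by simp
  have bt: "(\<lambda>x. p (x \<bullet> x) * b j x) \<in> test_functions unit_ball" for j
    unfolding b_def
    by (rule bumps_test_functions[OF bumps_polynomial[OF p bumps.base] _ R]) simp
  have b01: "0 \<le> b j x" "b j x \<le> 1" for j x
    by (auto simp: b_def flat_exp_def)
  have bl: "(\<lambda>j. b j x) \<longlonglongrightarrow> 1" if x: "norm x < 1" for x
  proof -
    have pos: "0 < 1 - x \<bullet> x" using x by (simp add: dot_square_norm power_less_one_iff)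
    have l: "(\<lambda>j. (R j)\<^sup>2 - x \<bullet> x) \<longlonglongrightarrow> 1\<^sup>2 - x \<bullet> x" by (intro tendsto_intros R1)
    then have ev: "\<forall>\<^sub>F j in sequentially. 0 < (R j)\<^sup>2 - x \<bullet> x"
      by (rule order_tendstoD) (use pos in simp)
    have "(\<lambda>j. exp (- (1 / real (Suc j)) / ((R j)\<^sup>2 - x \<bullet> x))) \<longlonglongrightarrow> exp (- 0 / (1\<^sup>2 - x \<bullet> x))"
      by (intro tendsto_exp tendsto_divide tendsto_minus c0 l) (use pos in auto)
    moreover have "\<forall>\<^sub>F j in sequentially. exp (- (1 / real (Suc j)) / ((R j)\<^sup>2 - x \<bullet> x)) = b j x"
      using ev by eventually_elim (simp add: b_def flat_exp_def)
    ultimately show ?thesis by (simp add: tendsto_cong)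
  qed
  have cp: "continuous_on UNIV p" by (rule continuous_on_polymonial_function) (use p in \<open>simp add: real_polynomial_function_eq\<close>)
  have pe: "has_continuous_extension (\<lambda>x::real^'n. p (x \<bullet> x))"
    by (rule has_continuous_extensionI[where g = "\<lambda>x. p (x \<bullet> x)"])
       (auto intro!: continuous_on_compose2[OF cp] continuous_intros)
  obtain P where P: "0 \<le> P" "\<And>x::real^'n. norm x < 1 \<Longrightarrow> \<bar>p (x \<bullet> x)\<bar> \<le> P"
    by (rule has_continuous_extension_bounded[OF pe]) blast
  have bext: "has_continuous_extension (b j)" for j
  proof (rule has_continuous_extensionI)
    have "continuous_on UNIV (flat_exp (1 / real (Suc j)) 0)"
      by (intro continuous_at_imp_continuous_on ballI DERIV_isCont[OF DERIV_flat_exp]) simp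
    then show "continuous_on (cball 0 1) (b j)"
      unfolding b_def by (rule continuous_on_compose2) (auto intro!: continuous_intros)
  qed simp
  note Fm = borel_measurable_integrable[OF F]
  have "(\<lambda>j. LINT x|lebesgue_on unit_ball. F x * (p (x \<bullet> x) * b j x))
     \<longlonglongrightarrow> (LINT x|lebesgue_on unit_ball. F x * p (x \<bullet> x))"
  proof (rule integral_dominated_convergence[where w = "\<lambda>x. \<bar>F x\<bar> * P"])
    show "AE x in lebesgue_on unit_ball. (\<lambda>j. F x * (p (x \<bullet> x) * b j x)) \<longlonglongrightarrow> F x * p (x \<bullet> x)"
    proof (rule AE_I2)
      fix x :: "real ^ 'n" assume "x \<in> space (lebesgue_on unit_ball)"
      then have "norm x < 1" by (simp add: space_restrict_space)
      then have "(\<lambda>j. F x * (p (x \<bullet> x) * b j x)) \<longlonglongrightarrow> F x * (p (x \<bullet> x) * 1)" by (intro tendsto_intros bl)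
      then show "(\<lambda>j. F x * (p (x \<bullet> x) * b j x)) \<longlonglongrightarrow> F x * p (x \<bullet> x)" by simp
    qed
    show "AE x in lebesgue_on unit_ball. norm (F x * (p (x \<bullet> x) * b j x)) \<le> \<bar>F x\<bar> * P" for j
    proof (rule AE_I2)
      fix x :: "real ^ 'n" assume "x \<in> space (lebesgue_on unit_ball)"
      then have x: "norm x < 1" by (simp add: space_restrict_space)
      have "\<bar>p (x \<bullet> x)\<bar> * \<bar>b j x\<bar> \<le> P * 1"
        using P(2)[OF x] b01[of j x] P(1) by (intro mult_mono) auto
      then show "norm (F x * (p (x \<bullet> x) * b j x)) \<le> \<bar>F x\<bar> * P"
        by (auto simp: abs_mult intro!: mult_left_mono)
    qed
    show "(\<lambda>x. F x * p (x \<bullet> x)) \<in> borel_measurable (lebesgue_on unit_ball)"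
      by (intro borel_measurable_times Fm has_continuous_extension_measurable pe)
    show "(\<lambda>x. F x * (p (x \<bullet> x) * b j x)) \<in> borel_measurable (lebesgue_on unit_ball)" for j
      by (intro borel_measurable_times Fm has_continuous_extension_measurable pe bext)
    show "integrable (lebesgue_on unit_ball) (\<lambda>x. \<bar>F x\<bar> * P)" using F by simp
  qed
  moreover have "(LINT x|lebesgue_on unit_ball. F x * (p (x \<bullet> x) * b j x)) = 0" for j
    by (rule 0[OF bt])
  ultimately show ?thesis by (simp add: LIMSEQ_const_iff)
qed

lemma integrable_mult_extension:
  fixes F :: "real ^ 'n::finite \<Rightarrow> real"
  assumes F: "integrable (lebesgue_on unit_ball) F" and h: "has_continuous_extension h"
  shows "integrable (lebesgue_on unit_ball) (\<lambda>x. F x * h x)"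
proof -
  obtain B where B: "0 \<le> B" "\<And>x. norm x < 1 \<Longrightarrow> \<bar>h x\<bar> \<le> B"
    by (rule has_continuous_extension_bounded[OF h]) blast
  show ?thesis
  proof (rule Bochner_Integration.integrable_bound)
    show "integrable (lebesgue_on unit_ball) (\<lambda>x. B * \<bar>F x\<bar>)" using F by simp
    show "(\<lambda>x. F x * h x) \<in> borel_measurable (lebesgue_on unit_ball)"
      by (intro borel_measurable_times borel_measurable_integrable[OF F] has_continuous_extension_measurable h)
    show "AE x in lebesgue_on unit_ball. norm (F x * h x) \<le> norm (B * \<bar>F x\<bar>)"
    proof (rule AE_I2)
      fix x :: "real ^ 'n" assume "x \<in> space (lebesgue_on unit_ball)"
      then have "\<bar>h x\<bar> \<le> B" using B by (simp add: space_restrict_space)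
      then have "\<bar>F x\<bar> * \<bar>h x\<bar> \<le> \<bar>F x\<bar> * B" by (intro mult_left_mono) auto
      then show "norm (F x * h x) \<le> norm (B * \<bar>F x\<bar>)" using B(1) by (simp add: abs_mult mult.commute)
    qed
  qed
qed

text \<open>A radial substitute for the fundamental lemma of the calculus of variations. Weierstrass
  approximation is applied to a(sqrt s), so that the approximants are polynomials in |x|^2 and hence
  smooth at the origin.\<close>

lemma integral_mult_radial_zero:
  fixes F :: "real ^ 'n::finite \<Rightarrow> real"
  assumes F: "integrable (lebesgue_on unit_ball) F"
    and 0: "\<And>\<tau>. \<tau> \<in> test_functions unit_ball \<Longrightarrow> (LINT x|lebesgue_on unit_ball. F x * \<tau> x) = 0"
    and a: "continuous_on {0..1} a"
  shows "(LINT x|lebesgue_on unit_ball. F x * a (norm x)) = 0"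
proof -
  note Fa = integrable_mult_extension[OF F]
  let ?I = "LINT x|lebesgue_on unit_ball. F x * a (norm x)"
  let ?N = "LINT x|lebesgue_on unit_ball. \<bar>F x\<bar>"
  have bound: "\<bar>?I\<bar> \<le> \<epsilon> * ?N" if \<epsilon>: "0 < \<epsilon>" for \<epsilon>
  proof -
    have "continuous_on {0..1} (\<lambda>s. a (sqrt s))"
      by (rule continuous_on_compose2[OF a]) (auto intro!: continuous_intros)
    then obtain p where p: "real_polynomial_function p" "\<And>s. s \<in> {0..1} \<Longrightarrow> \<bar>a (sqrt s) - p s\<bar> < \<epsilon>"
      using Stone_Weierstrass_real_polynomial_function[of "{0..1::real}" "\<lambda>s. a (sqrt s)" \<epsilon>] \<epsilon> by auto
    have ap: "\<bar>a (norm x) - p (x \<bullet> x)\<bar> \<le> \<epsilon>" if "norm x < 1" for x :: "real ^ 'n"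
    proof -
      have "x \<bullet> x \<in> {0..1}" using that by (auto simp: dot_square_norm power_le_one)
      from p(2)[OF this] show ?thesis by (simp add: norm_eq_sqrt_inner)
    qed
    have cp: "continuous_on UNIV p" by (rule continuous_on_polymonial_function) (use p(1) in \<open>simp add: real_polynomial_function_eq\<close>)
    have pe: "has_continuous_extension (\<lambda>x::real^'n. p (x \<bullet> x))"
      by (rule has_continuous_extensionI[where g = "\<lambda>x. p (x \<bullet> x)"])
         (auto intro!: continuous_on_compose2[OF cp] continuous_intros)
    have i: "integrable (lebesgue_on unit_ball) (\<lambda>x. F x * a (norm x))"
      "integrable (lebesgue_on unit_ball) (\<lambda>x. F x * p (x \<bullet> x))"
      by (rule Fa[OF has_continuous_extension_radial[OF a]], rule Fa[OF pe])
    have "?I = (LINT x|lebesgue_on unit_ball. F x * a (norm x) - F x * p (x \<bullet> x))"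
      using i integral_mult_polynomial_zero[OF F 0 p(1)] by simp
    also have "\<bar>\<dots>\<bar> \<le> (LINT x|lebesgue_on unit_ball. \<epsilon> * \<bar>F x\<bar>)"
    proof (rule order_trans[OF integral_abs_bound integral_mono])
      fix x :: "real ^ 'n" assume "x \<in> space (lebesgue_on unit_ball)"
      then have "\<bar>a (norm x) - p (x \<bullet> x)\<bar> \<le> \<epsilon>" using ap by (simp add: space_restrict_space)
      then have "\<bar>F x\<bar> * \<bar>a (norm x) - p (x \<bullet> x)\<bar> \<le> \<bar>F x\<bar> * \<epsilon>" by (intro mult_left_mono) auto
      then show "\<bar>F x * a (norm x) - F x * p (x \<bullet> x)\<bar> \<le> \<epsilon> * \<bar>F x\<bar>"
        by (simp add: abs_mult[symmetric] right_diff_distrib mult.commute)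
    qed (use F i in auto)
    finally show ?thesis by simp
  qed
  have "\<bar>?I\<bar> \<le> 0"
  proof (rule field_le_epsilon)
    fix e :: real assume e: "0 < e"
    have N: "0 \<le> ?N" by (rule integral_nonneg_AE) simp
    then have N1: "0 < ?N + 1" by linarith
    have "\<bar>?I\<bar> \<le> e / (?N + 1) * ?N" by (intro bound divide_pos_pos e N1)
    also have "\<dots> \<le> e / (?N + 1) * (?N + 1)"
      using divide_pos_pos[OF e N1] by (intro mult_left_mono) linarith+
    also have "\<dots> = e" by (rule nonzero_eq_divide_eq[THEN iffD1]) (use N1 in linarith, rule refl)
    finally show "\<bar>?I\<bar> \<le> 0 + e" by simp
  qed
  then show ?thesis by simp
qed

section \<open>Test functions, weak derivatives and passage to the limit in H_0^2\<close>

lemma test_functions_differentiable: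
  "\<tau> \<in> test_functions \<Omega> \<Longrightarrow> partials is \<tau> differentiable (at x)"
  by (auto simp: test_functions_def differentiable_on_def)

lemma test_functions_DERIV:
  "\<tau> \<in> test_functions \<Omega> \<Longrightarrow>
    ((\<lambda>t. partials is \<tau> (x + t *\<^sub>R axis i 1)) has_real_derivative partials (i # is) \<tau> x) (at 0)"
  unfolding partials_Cons by (rule DERIV_along_axis, rule test_functions_differentiable)

lemma test_functions_continuous:
  fixes \<tau> :: "real ^ 'n::finite \<Rightarrow> real"
  shows "\<tau> \<in> test_functions \<Omega> \<Longrightarrow> continuous_on S (partials is \<tau>)"
  by (intro continuous_at_imp_continuous_on ballI differentiable_imp_continuous_within
      test_functions_differentiable)

lemma test_functions_extension:
  fixes \<tau> :: "real ^ 'n::finite \<Rightarrow> real"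
  shows "\<tau> \<in> test_functions \<Omega> \<Longrightarrow> has_continuous_extension (partials is \<tau>)"
  by (rule has_continuous_extensionI[OF test_functions_continuous]) auto

lemma test_functions_vanish:
  fixes \<tau> :: "real ^ 'n::finite \<Rightarrow> real"
  assumes "\<tau> \<in> test_functions unit_ball" "norm x = 1"
  shows "partials is \<tau> x = 0"
proof -
  obtain K where K: "compact K" "K \<subseteq> unit_ball" "\<And>x. x \<notin> K \<Longrightarrow> \<tau> x = 0"
    using assms(1) by (auto simp: test_functions_def)
  have "partials is \<tau> y = 0" if "y \<notin> K" for y
    using that
  proof (induction "is" arbitrary: y)
    case (Cons i "is")
    show ?case
      unfolding partials_Cons
      by (rule partial_eqI, rule derivative_along_cong[of "- K" y "\<lambda>_. 0"])
         (use Cons K(1) in \<open>auto simp: compact_imp_closed open_Compl\<close>)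
  qed (use K in auto)
  moreover have "x \<notin> K" using K(2) assms(2) by auto
  ultimately show ?thesis by simp
qed

lemma integral_radial_laplacian_test:
  fixes \<tau> :: "real ^ 'n::finite \<Rightarrow> real"
  assumes \<tau>: "\<tau> \<in> test_functions unit_ball" and rl: "radial_laplace CARD('n) z l m"
  shows "(LINT x|lebesgue_on unit_ball. z (norm x) * (\<Sum>i\<in>UNIV. partials [i, i] \<tau> x))
       = (LINT x|lebesgue_on unit_ball. m (norm x) * \<tau> x)"
  by (rule integral_radial_laplace[OF rl, where ?G1.0 = "\<lambda>i. partials [i] \<tau>"])
     (use test_functions_continuous[OF \<tau>, of _ "[]"] test_functions_continuous[OF \<tau>]
        test_functions_extension[OF \<tau>] test_functions_DERIV[OF \<tau>, of "[]"] test_functions_DERIV[OF \<tau>]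
        test_functions_vanish[OF \<tau>, of _ "[]"] test_functions_vanish[OF \<tau>] in auto)

lemma integral_by_parts_test:
  fixes f :: "real ^ 'n::finite \<Rightarrow> real"
  assumes \<tau>: "\<tau> \<in> test_functions unit_ball" and f: "has_continuous_extension f" and f': "has_continuous_extension f'"
    and d: "\<And>x. norm x < 1 \<Longrightarrow> ((\<lambda>t. f (x + t *\<^sub>R axis i 1)) has_real_derivative f' x) (at 0)"
  shows "(LINT x|lebesgue_on unit_ball. f x * partials (i # is) \<tau> x)
       = - (LINT x|lebesgue_on unit_ball. f' x * partials is \<tau> x)"
proof -
  obtain F where F: "continuous_on (cball 0 1) F" "\<And>x. norm x < 1 \<Longrightarrow> F x = f x"
    using f by (rule has_continuous_extensionE) blast
  let ?D = "\<lambda>x. f' x * partials is \<tau> x + partials (i # is) \<tau> x * F x"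
  have Fe: "has_continuous_extension F" by (rule has_continuous_extension_cong[OF f]) (use F in auto)
  note te = test_functions_extension[OF \<tau>]
  have "has_continuous_extension ?D"
    by (intro has_continuous_extension_add has_continuous_extension_mult te f' Fe)
  then obtain C where C: "\<And>x. norm x < 1 \<Longrightarrow> \<bar>?D x\<bar> \<le> C" by (rule has_continuous_extension_bounded) blast
  have "(LINT x|lebesgue_on unit_ball. ?D x) = 0"
  proof (rule integral_derivative_along_axis(2)[where h = "\<lambda>x. F x * partials is \<tau> x"])
    show "continuous_on (cball 0 1) (\<lambda>x. F x * partials is \<tau> x)"
      by (intro continuous_on_mult F test_functions_continuous[OF \<tau>])
    show "((\<lambda>t. F (x + t *\<^sub>R axis i 1) * partials is \<tau> (x + t *\<^sub>R axis i 1)) has_real_derivative ?D x) (at 0)"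
      if x: "norm x < 1" for x
    proof -
      have "((\<lambda>t. F (x + t *\<^sub>R axis i 1)) has_real_derivative f' x) (at 0)"
        by (rule derivative_along_cong[of unit_ball x f]) (use x F(2) d in auto)
      from DERIV_mult[OF this test_functions_DERIV[OF \<tau>]] show ?thesis by simp
    qed
  qed (use C test_functions_vanish[OF \<tau>] in auto)
  moreover have "integrable (lebesgue_on unit_ball) (\<lambda>x. f' x * partials is \<tau> x)"
    "integrable (lebesgue_on unit_ball) (\<lambda>x. partials (i # is) \<tau> x * F x)"
    by (intro has_continuous_extension_integrable has_continuous_extension_mult te f' Fe)+
  ultimately have "(LINT x|lebesgue_on unit_ball. partials (i # is) \<tau> x * F x)
       = - (LINT x|lebesgue_on unit_ball. f' x * partials is \<tau> x)" by simp
  moreover have "(LINT x|lebesgue_on unit_ball. partials (i # is) \<tau> x * F x)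
     = (LINT x|lebesgue_on unit_ball. f x * partials (i # is) \<tau> x)"
    by (rule Bochner_Integration.integral_cong) (auto simp: space_restrict_space F(2))
  ultimately show ?thesis by simp
qed

lemma L2_integrable:
  fixes g :: "real ^ 'n::finite \<Rightarrow> real"
  assumes "g \<in> L2 unit_ball"
  shows "integrable (lebesgue_on unit_ball) g"
proof (rule Bochner_Integration.integrable_bound)
  show "integrable (lebesgue_on unit_ball) (\<lambda>x. 1 + (g x)\<^sup>2)"
    using assms has_continuous_extension_integrable[OF has_continuous_extension_const[of 1]]
    by (intro Bochner_Integration.integrable_add) (auto simp: L2_def)
  show "AE x in lebesgue_on unit_ball. norm (g x) \<le> norm (1 + (g x)\<^sup>2)"
  proof (rule AE_I2)
    fix x
    have "0 \<le> (\<bar>g x\<bar> - 1)\<^sup>2" by simp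
    then have "2 * \<bar>g x\<bar> \<le> 1 + (g x)\<^sup>2" by (simp add: power2_diff)
    then show "norm (g x) \<le> norm (1 + (g x)\<^sup>2)" by simp
  qed
qed (use assms in \<open>simp add: L2_def\<close>)

text \<open>Lets a weak derivative be replaced by the classical one under an integral against a
  radial function, without first showing that the two agree almost everywhere.\<close>

lemma integral_radial_weak_eq:
  fixes g h :: "real ^ 'n::finite \<Rightarrow> real"
  assumes g: "g \<in> L2 unit_ball" and h: "has_continuous_extension h" and a: "continuous_on {0..1} a"
    and eq: "\<And>\<tau>. \<tau> \<in> test_functions unit_ball \<Longrightarrow>
      (LINT x|lebesgue_on unit_ball. g x * \<tau> x) = (LINT x|lebesgue_on unit_ball. h x * \<tau> x)"
  shows "(LINT x|lebesgue_on unit_ball. g x * a (norm x)) = (LINT x|lebesgue_on unit_ball. h x * a (norm x))"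
proof -
  note ig = L2_integrable[OF g] and ih = has_continuous_extension_integrable[OF h]
  have "(LINT x|lebesgue_on unit_ball. (g x - h x) * a (norm x)) = 0"
  proof (rule integral_mult_radial_zero[OF _ _ a])
    fix \<tau> :: "real ^ 'n \<Rightarrow> real" assume \<tau>: "\<tau> \<in> test_functions unit_ball"
    note te = test_functions_extension[OF \<tau>, of "[]", simplified]
    show "(LINT x|lebesgue_on unit_ball. (g x - h x) * \<tau> x) = 0"
      using eq[OF \<tau>] integrable_mult_extension[OF ig te] integrable_mult_extension[OF ih te]
      by (simp add: left_diff_distrib)
  qed (use ig ih in auto)
  then show ?thesis
    using integrable_mult_extension[OF ig has_continuous_extension_radial[OF a]]
      integrable_mult_extension[OF ih has_continuous_extension_radial[OF a]]
    by (simp add: left_diff_distrib)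
qed

text \<open>Mean-square convergence on a set of finite measure implies convergence of the integrals.
  In place of the Cauchy-Schwarz inequality the elementary estimate w <= e + w^2 / e is integrated,
  with \<open>e\<close> depending on m.\<close>

lemma integral_square_limit:
  fixes g :: "real ^ 'n::finite \<Rightarrow> real"
  assumes g: "g \<in> L2 unit_ball" and p: "\<And>m. has_continuous_extension (p m)"
    and lim: "(\<lambda>m. LINT x|lebesgue_on unit_ball. (p m x - g x)\<^sup>2) \<longlonglongrightarrow> 0"
    and a: "has_continuous_extension a"
  shows "(\<lambda>m. LINT x|lebesgue_on unit_ball. p m x * a x) \<longlonglongrightarrow> (LINT x|lebesgue_on unit_ball. g x * a x)"
proof -
  let ?M = "lebesgue_on (unit_ball :: (real ^ 'n) set)"
  obtain A where A: "0 \<le> A" "\<And>x. norm x < 1 \<Longrightarrow> \<bar>a x\<bar> \<le> A"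
    by (rule has_continuous_extension_bounded[OF a]) blast
  note ig = L2_integrable[OF g] and ip = has_continuous_extension_integrable[OF p]
  have isq: "integrable ?M (\<lambda>x. (p m x - g x)\<^sup>2)" for m
  proof -
    have "integrable ?M (\<lambda>x. p m x * p m x)"
      by (intro has_continuous_extension_integrable has_continuous_extension_mult p)
    moreover have "integrable ?M (\<lambda>x. g x * p m x)" by (rule integrable_mult_extension[OF ig p])
    moreover have "integrable ?M (\<lambda>x. (g x)\<^sup>2)" using g by (simp add: L2_def)
    ultimately have "integrable ?M (\<lambda>x. p m x * p m x - 2 * (g x * p m x) + (g x)\<^sup>2)" by simp
    then show ?thesis by (simp add: power2_eq_square algebra_simps)
  qed
  define I where "I m = (LINT x|?M. (p m x - g x)\<^sup>2)" for m
  \<comment> \<open>The choice e = sqrt I would balance the two terms; the added 1 / (m + 1) keeps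
    the divisor positive when I = 0 and still tends to 0.\<close>
  define e where "e m = sqrt (I m) + 1 / real (Suc m)" for m
  have I0: "0 \<le> I m" for m unfolding I_def by (rule integral_nonneg_AE) simp
  have e: "0 < e m" "sqrt (I m) \<le> e m" for m using I0[of m] by (auto simp: e_def intro: add_nonneg_pos)
  have Il: "I \<longlonglongrightarrow> 0" using lim by (simp add: I_def[abs_def])
  then have sl: "(\<lambda>m. sqrt (I m)) \<longlonglongrightarrow> 0" using tendsto_real_sqrt[OF Il] by simp
  have el: "e \<longlonglongrightarrow> 0" unfolding e_def using tendsto_add[OF sl LIMSEQ_Suc[OF lim_1_over_n]] by simp
  let ?v = "LINT x|?M. (1::real)"
  have ci: "integrable ?M (\<lambda>x. c :: real)" for c
    by (rule has_continuous_extension_integrable[OF has_continuous_extension_const])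
  have bound: "\<bar>(LINT x|?M. p m x * a x) - (LINT x|?M. g x * a x)\<bar> \<le> A * (e m * ?v + sqrt (I m))" for m
  proof -
    have "(LINT x|?M. p m x * a x) - (LINT x|?M. g x * a x) = (LINT x|?M. p m x * a x - g x * a x)"
      by (rule Bochner_Integration.integral_diff[symmetric]) (intro integrable_mult_extension ip ig a)+
    also have "\<bar>\<dots>\<bar> \<le> (LINT x|?M. A * (e m * 1 + (p m x - g x)\<^sup>2 / e m))"
    proof (rule order_trans[OF integral_abs_bound integral_mono])
      fix x :: "real ^ 'n" assume "x \<in> space ?M"
      then have ax: "\<bar>a x\<bar> \<le> A" using A by (simp add: space_restrict_space)
      define w where "w = \<bar>p m x - g x\<bar>"
      have "0 \<le> (w - e m)\<^sup>2" by simp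
      then have "2 * w * e m \<le> w\<^sup>2 + (e m)\<^sup>2" by (simp add: power2_diff)
      moreover have "0 \<le> w * e m" using e[of m] by (simp add: w_def)
      ultimately have "w * e m \<le> w\<^sup>2 + (e m)\<^sup>2" by linarith
      then have "w \<le> e m * 1 + w\<^sup>2 / e m" using e[of m] by (simp add: field_simps power2_eq_square)
      then have w: "w \<le> e m * 1 + (p m x - g x)\<^sup>2 / e m" by (simp add: w_def)
      have "\<bar>p m x * a x - g x * a x\<bar> = \<bar>a x\<bar> * w" by (simp add: w_def abs_mult[symmetric] algebra_simps)
      also have "\<dots> \<le> A * (e m * 1 + (p m x - g x)\<^sup>2 / e m)"
        by (rule mult_mono[OF ax w]) (auto simp: w_def A)
      finally show "\<bar>p m x * a x - g x * a x\<bar> \<le> A * (e m * 1 + (p m x - g x)\<^sup>2 / e m)" .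
    next
      show "integrable ?M (\<lambda>x. \<bar>p m x * a x - g x * a x\<bar>)"
        by (intro integrable_abs Bochner_Integration.integrable_diff integrable_mult_extension ip ig a)
      show "integrable ?M (\<lambda>x. A * (e m * 1 + (p m x - g x)\<^sup>2 / e m))"
        using ci isq by simp
    qed
    also have "\<dots> = A * (e m * ?v + I m / e m)"
      using ci isq by (simp add: I_def)
    also have "\<dots> \<le> A * (e m * ?v + sqrt (I m))"
    proof -
      have "I m = sqrt (I m) * sqrt (I m)" using I0 by simp
      also have "\<dots> \<le> sqrt (I m) * e m" using e[of m] I0[of m] by (intro mult_left_mono) auto
      finally have "I m / e m \<le> sqrt (I m)" using e[of m] by (simp add: divide_le_eq)
      then show ?thesis using A by (intro mult_left_mono add_left_mono) auto
    qed
    finally show ?thesis .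
  qed
  have "(\<lambda>m. A * (e m * ?v + sqrt (I m))) \<longlonglongrightarrow> A * (0 * ?v + 0)" by (intro tendsto_intros el sl)
  then have "(\<lambda>m. A * (e m * ?v + sqrt (I m))) \<longlonglongrightarrow> 0" by simp
  then have "(\<lambda>m. (LINT x|?M. p m x * a x) - (LINT x|?M. g x * a x)) \<longlonglongrightarrow> 0"
    by (rule Lim_null_comparison[rotated]) (use bound in auto)
  then show ?thesis by (simp add: LIM_zero_iff)
qed

text \<open>The second integration by parts is done for the approximating test functions, which have
  no boundary terms, and the identity passes to the limit. The limits involve weak derivatives,
  which are exchanged for the classical derivatives of \<open>\<phi>\<close>.\<close>

lemma integral_radial_green_H0:
  fixes \<phi> :: "real ^ 'n::finite \<Rightarrow> real"
  assumes \<phi>: "\<phi> \<in> C_closure 4 unit_ball" "\<phi> \<in> H0 2 unit_ball" and f: "continuous_on {0..1} f"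
  shows "(LINT x|lebesgue_on unit_ball. radial_green CARD('n) f (norm x) * bilaplacian \<phi> x)
       = (LINT x|lebesgue_on unit_ball. f (norm x) * \<phi> x)"
proof -
  let ?M = "lebesgue_on (unit_ball :: (real ^ 'n) set)"
  let ?\<eta> = "radial_neumann CARD('n) f"
  have n: "0 < CARD('n)" by simp
  obtain g \<psi> where g: "\<And>is. length is \<le> 2 \<Longrightarrow> g is \<in> L2 unit_ball"
      "\<And>is. length is \<le> 2 \<Longrightarrow> weak_derivative unit_ball is \<phi> (g is)"
    and \<psi>: "\<And>m. \<psi> m \<in> test_functions unit_ball"
      "\<And>is. length is \<le> 2 \<Longrightarrow> (\<lambda>m. LINT x|?M. (partials is (\<psi> m) x - g is x)\<^sup>2) \<longlonglongrightarrow> 0"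
    using \<phi>(2) unfolding H0_def by blast
  note ext = C_closure_extension[OF \<phi>(1)] and te = test_functions_extension
  have \<eta>: "continuous_on {0..1} ?\<eta>" by (rule continuous_on_radial_neumann[OF f])
  have weak0: "(LINT x|?M. g [] x * a (norm x)) = (LINT x|?M. \<phi> x * a (norm x))"
    if "continuous_on {0..1} a" for a
    by (rule integral_radial_weak_eq[OF g(1) ext[of "[]", simplified] that])
       (use g(2)[of "[]"] in \<open>auto simp: weak_derivative_def\<close>)
  \<comment> \<open>Integrating by parts twice against a test function shows that the classical and
    the weak second derivative have the same pairings.\<close>
  have weak2: "(LINT x|?M. g [i, i] x * a (norm x)) = (LINT x|?M. partials [i, i] \<phi> x * a (norm x))"
    if "continuous_on {0..1} a" for a i
  proof (rule integral_radial_weak_eq[OF g(1) ext that])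
    fix \<tau> :: "real ^ 'n \<Rightarrow> real" assume \<tau>: "\<tau> \<in> test_functions unit_ball"
    have "(LINT x|?M. g [i, i] x * \<tau> x) = (LINT x|?M. \<phi> x * partials [i, i] \<tau> x)"
      using g(2)[of "[i, i]"] \<tau> by (simp add: weak_derivative_def)
    also have "\<dots> = - (LINT x|?M. partials [i] \<phi> x * partials [i] \<tau> x)"
      by (rule integral_by_parts_test[OF \<tau>])
         (use ext[of "[]"] ext[of "[i]"] C_closure_DERIV[OF \<phi>(1), of "[]"] in auto)
    also have "(LINT x|?M. partials [i] \<phi> x * partials [i] \<tau> x) = - (LINT x|?M. partials [i, i] \<phi> x * partials [] \<tau> x)"
      by (rule integral_by_parts_test[OF \<tau>])
         (use ext[of "[i]"] ext[of "[i, i]"] C_closure_DERIV[OF \<phi>(1), of "[i]"] in auto)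
    finally show "(LINT x|?M. g [i, i] x * \<tau> x) = (LINT x|?M. partials [i, i] \<phi> x * \<tau> x)" by simp
  qed auto
  have lim2: "(\<lambda>m. LINT x|?M. partials [i, i] (\<psi> m) x * ?\<eta> (norm x))
      \<longlonglongrightarrow> (LINT x|?M. partials [i, i] \<phi> x * ?\<eta> (norm x))" for i
    unfolding weak2[OF \<eta>, symmetric]
    by (rule integral_square_limit[OF g(1) te[OF \<psi>(1)] \<psi>(2) has_continuous_extension_radial[OF \<eta>]]) auto
  have lim0: "(\<lambda>m. LINT x|?M. partials [] (\<psi> m) x * f (norm x)) \<longlonglongrightarrow> (LINT x|?M. \<phi> x * f (norm x))"
    unfolding weak0[OF f, symmetric]
    by (rule integral_square_limit[OF g(1) te[OF \<psi>(1)] \<psi>(2) has_continuous_extension_radial[OF f]]) auto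
  have sumi: "(LINT x|?M. ?\<eta> (norm x) * (\<Sum>i\<in>UNIV. h i x)) = (\<Sum>i\<in>UNIV. LINT x|?M. h i x * ?\<eta> (norm x))"
    if "\<And>i::'n. has_continuous_extension (h i)" for h
  proof -
    have "integrable ?M (\<lambda>x. h i x * ?\<eta> (norm x))" for i
      by (intro has_continuous_extension_integrable has_continuous_extension_mult
          has_continuous_extension_radial \<eta> that)
    then show ?thesis by (simp add: sum_distrib_left mult.commute[of "?\<eta> _"] Bochner_Integration.integral_sum)
  qed
  have "(\<lambda>m. \<Sum>i\<in>UNIV. LINT x|?M. partials [i, i] (\<psi> m) x * ?\<eta> (norm x))
      \<longlonglongrightarrow> (\<Sum>i\<in>UNIV. LINT x|?M. partials [i, i] \<phi> x * ?\<eta> (norm x))"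
    by (intro tendsto_sum lim2)
  moreover have "(\<Sum>i\<in>UNIV. LINT x|?M. partials [i, i] (\<psi> m) x * ?\<eta> (norm x)) = (LINT x|?M. partials [] (\<psi> m) x * f (norm x))" for m
    using integral_radial_laplacian_test[OF \<psi>(1) radial_laplace_neumann[OF f n]]
    by (subst sumi[symmetric]) (auto intro: te \<psi>(1) simp: mult.commute)
  ultimately have "(\<Sum>i\<in>UNIV. LINT x|?M. partials [i, i] \<phi> x * ?\<eta> (norm x)) = (LINT x|?M. \<phi> x * f (norm x))"
    using LIMSEQ_unique[OF _ lim0] by simp
  moreover have "(LINT x|?M. ?\<eta> (norm x) * laplacian \<phi> x) = (\<Sum>i\<in>UNIV. LINT x|?M. partials [i, i] \<phi> x * ?\<eta> (norm x))"
    unfolding laplacian_eq by (rule sumi) (auto intro: ext)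
  ultimately show ?thesis
    unfolding integral_radial_bilaplacian[OF \<phi>(1) radial_laplace_green[OF f n] radial_green_1 ball_mean_neumann_1[OF f n]]
    by (simp add: mult.commute)
qed

section \<open>Monotone iteration\<close>

text \<open>The difference of the integrands is the divergence of the radial field x (l1 z2 - z1
  l2). Vanishing of z1 and l1 on the sphere is enough for this field to vanish there, so z2 may be a
  \<open>radial_neumann\<close>.\<close>

lemma integral_radial_green_symmetric:
  assumes rl1: "radial_laplace CARD('n::finite) z1 l1 m1" and rl2: "radial_laplace CARD('n) z2 l2 m2"
    and bd: "z1 1 = 0" "l1 1 = 0"
  shows "(LINT x|lebesgue_on (unit_ball :: (real ^ 'n) set). m1 (norm x) * z2 (norm x))
       = (LINT x|lebesgue_on (unit_ball :: (real ^ 'n) set). z1 (norm x) * m2 (norm x))"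
proof -
  note rl1' = rl1[unfolded radial_laplace_def] and rl2' = rl2[unfolded radial_laplace_def]
  let ?l = "\<lambda>r. l1 r * z2 r - z1 r * l2 r" and ?m = "\<lambda>r. m1 r * z2 r - z1 r * m2 r"
  have "(LINT x|lebesgue_on (unit_ball :: (real ^ 'n) set).
      (\<Sum>i\<in>UNIV. ?l (norm x) * (x $ i * 0)) + ?m (norm x) * 1) = 0"
  proof (rule integral_radial_divergence[where ?G1.0 = "\<lambda>_ _. 0"])
    show "continuous_on {0..1} ?l" "continuous_on {0..1} ?m"
      using rl1' rl2' by (auto intro!: continuous_intros)
    show "(?l has_real_derivative (?m r - real CARD('n) * ?l r) / r) (at r)" if r: "0 < r" "r < 1" for r
    proof -
      have "(?l has_real_derivative ((m1 r - real CARD('n) * l1 r) / r * z2 r + r * l2 r * l1 r)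
          - (r * l1 r * l2 r + (m2 r - real CARD('n) * l2 r) / r * z1 r)) (at r)"
        by (intro DERIV_diff DERIV_mult) (use rl1' rl2' r in auto)
      moreover have "((m1 r - real CARD('n) * l1 r) / r * z2 r + r * l2 r * l1 r)
          - (r * l1 r * l2 r + (m2 r - real CARD('n) * l2 r) / r * z1 r) = (?m r - real CARD('n) * ?l r) / r"
        using r by (simp add: field_simps)
      ultimately show ?thesis by simp
    qed
  qed (use bd in \<open>auto intro: has_continuous_extension_const\<close>)
  then have "(LINT x|lebesgue_on (unit_ball :: (real ^ 'n) set). m1 (norm x) * z2 (norm x) - z1 (norm x) * m2 (norm x)) = 0"
    by simp
  moreover have "integrable (lebesgue_on unit_ball) (\<lambda>x :: real ^ 'n. m1 (norm x) * z2 (norm x))"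
      "integrable (lebesgue_on unit_ball) (\<lambda>x :: real ^ 'n. z1 (norm x) * m2 (norm x))"
    using rl1' rl2' by (intro has_continuous_extension_integrable has_continuous_extension_mult
        has_continuous_extension_radial; simp)+
  ultimately show ?thesis by simp
qed

text \<open>Both sides equal the integral of the product of the two functions
  \<open>radial_neumann\<close>, obtained by moving one Laplacian in each.\<close>

lemma radial_green_symmetric:
  assumes f: "continuous_on {0..1} f" and g: "continuous_on {0..1} g"
  shows "(LINT x|lebesgue_on (unit_ball :: (real ^ 'n::finite) set). radial_green CARD('n) f (norm x) * g (norm x))
       = (LINT x|lebesgue_on (unit_ball :: (real ^ 'n) set). f (norm x) * radial_green CARD('n) g (norm x))"
proof -
  have n: "0 < CARD('n)" by simp
  note N = radial_laplace_neumann[OF _ n] and G = radial_laplace_green[OF _ n]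
  show ?thesis
    using integral_radial_green_symmetric[OF G[OF f] N[OF g] radial_green_1 ball_mean_neumann_1[OF f n]]
      integral_radial_green_symmetric[OF G[OF g] N[OF f] radial_green_1 ball_mean_neumann_1[OF g n]]
    by (simp add: mult.commute)
qed

lemma bounded_convergence_ball:
  fixes f :: "real ^ 'n::finite \<Rightarrow> real"
  assumes "\<And>k. g k \<in> borel_measurable (lebesgue_on unit_ball)"
    and B: "\<And>k x. norm x < 1 \<Longrightarrow> \<bar>g k x\<bar> \<le> B"
    and lim: "\<And>x. norm x < 1 \<Longrightarrow> (\<lambda>k. g k x) \<longlonglongrightarrow> f x"
  shows "f \<in> borel_measurable (lebesgue_on unit_ball)"
    "(\<lambda>k. LINT x|lebesgue_on unit_ball. g k x) \<longlonglongrightarrow> (LINT x|lebesgue_on unit_ball. f x)"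
proof -
  show fm: "f \<in> borel_measurable (lebesgue_on unit_ball)"
    by (rule borel_measurable_LIMSEQ_real[where u = g, OF _ assms(1)]) (auto simp: space_restrict_space lim)
  show "(\<lambda>k. LINT x|lebesgue_on unit_ball. g k x) \<longlonglongrightarrow> (LINT x|lebesgue_on unit_ball. f x)"
    by (rule integral_dominated_convergence[where w = "\<lambda>_. B", OF fm assms(1)])
       (use B lim in \<open>auto simp: space_restrict_space
          intro!: has_continuous_extension_integrable has_continuous_extension_const\<close>)
qed

text \<open>The points of the ball where the inequality fails form an open null set, which must be
  empty.\<close>

lemma AE_le_continuous:
  fixes f g :: "real ^ 'n::finite \<Rightarrow> real"
  assumes ae: "AE x in lebesgue_on unit_ball. f x \<le> g x"
    and f: "continuous_on unit_ball f" and g: "continuous_on unit_ball g" and x: "norm x < 1"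
  shows "f x \<le> g x"
proof (rule ccontr)
  assume n: "\<not> f x \<le> g x"
  let ?S = "{x \<in> unit_ball. f x - g x \<in> {0<..}}"
  obtain N where N: "{x \<in> space (lebesgue_on unit_ball). \<not> f x \<le> g x} \<subseteq> N" "N \<in> null_sets (lebesgue_on unit_ball)"
    using ae by (auto elim!: AE_E simp: null_sets_def)
  then have "negligible N" by (auto simp: null_sets_restrict_space negligible_iff_null_sets)
  then have "negligible ?S" by (rule negligible_subset) (use N(1) in \<open>auto simp: space_restrict_space\<close>)
  moreover have "open ?S"
    by (intro continuous_open_preimage[unfolded vimage_def Int_def mem_Collect_eq] continuous_intros f g) auto
  moreover have "x \<in> ?S" using n x by auto
  ultimately show False using open_not_negligible by blast
qed

section \<open>The iterates, their limit and their comparison with a solution\<close>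

primrec green_iter :: "nat \<Rightarrow> real \<Rightarrow> nat \<Rightarrow> real \<Rightarrow> real" where
  "green_iter n lam 0 = (\<lambda>_. 0)"
| "green_iter n lam (Suc k) = (\<lambda>r. lam * radial_green n (\<lambda>s. 1 / (1 - green_iter n lam k s)) r)"

lemma continuous_on_reciprocal:
  fixes v :: "real \<Rightarrow> real"
  assumes "continuous_on {0..1} v" "\<And>r. r \<in> {0..1} \<Longrightarrow> v r \<le> 1 - \<delta>" "0 < \<delta>"
  shows "continuous_on {0..1} (\<lambda>s. 1 / (1 - v s))"
  using assms(2,3) by (intro continuous_intros assms(1)) (force)

lemma continuous_on_green_iter_Suc:
  assumes "continuous_on {0..1} (green_iter n lam k)" "\<And>r. r \<in> {0..1} \<Longrightarrow> green_iter n lam k r \<le> 1 - \<delta>"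
    "0 < \<delta>" "0 < n"
  shows "continuous_on {0..1} (green_iter n lam (Suc k))"
  unfolding green_iter.simps
  by (intro continuous_intros continuous_on_radial_green continuous_on_reciprocal[OF assms(1-3)] assms(4))

lemma continuous_on_green_iter:
  assumes "\<And>k r. r \<in> {0..1} \<Longrightarrow> green_iter n lam k r \<le> 1 - \<delta>" "0 < \<delta>" "0 < n"
  shows "continuous_on {0..1} (green_iter n lam k)"
proof (induction k)
  case (Suc k)
  then show ?case using continuous_on_green_iter_Suc assms by blast
qed simp

lemma green_iter_mono_Suc:
  assumes b: "\<And>k r. r \<in> {0..1} \<Longrightarrow> green_iter n lam k r \<le> 1 - \<delta>" and \<delta>: "0 < \<delta>" and n: "0 < n" and lam: "0 \<le> lam"
    and r: "r \<in> {0..1}"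
  shows "green_iter n lam k r \<le> green_iter n lam (Suc k) r"
  using r
proof (induction k arbitrary: r)
  case 0
  then show ?case
    using lam by (auto intro!: mult_nonneg_nonneg radial_green_nonneg n)
next
  case (Suc k)
  note c = continuous_on_green_iter[OF b \<delta> n]
  have "radial_green n (\<lambda>s. 1 / (1 - green_iter n lam k s)) r \<le> radial_green n (\<lambda>s. 1 / (1 - green_iter n lam (Suc k) s)) r"
  proof (rule radial_green_mono)
    fix s :: real assume s: "s \<in> {0..1}"
    show "1 / (1 - green_iter n lam k s) \<le> 1 / (1 - green_iter n lam (Suc k) s)"
      using Suc.IH[OF s] b[OF s, of "Suc k"] \<delta> by (intro divide_left_mono mult_pos_pos) (simp_all del: green_iter.simps)
  qed (use continuous_on_reciprocal[OF c b \<delta>] Suc.prems n in \<open>simp_all del: green_iter.simps\<close>)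
  then show ?case using lam by (simp add: mult_left_mono)
qed

lemma bilaplacian_extension:
  fixes f :: "real ^ 'n::finite \<Rightarrow> real"
  assumes "f \<in> C_closure 4 unit_ball"
  shows "has_continuous_extension (bilaplacian f)"
proof (rule has_continuous_extension_cong)
  show "has_continuous_extension (\<lambda>x. \<Sum>i\<in>UNIV. \<Sum>j\<in>UNIV. partials [j, j, i, i] f x)"
    by (intro has_continuous_extension_sum C_closure_extension[OF assms]) auto
qed (simp add: bilaplacian_eq[OF assms])

text \<open>Each step of the iteration is an integral identity against members of C^4 and H_0^2. The
  uniform gap \<open>\<delta>\<close> bounds the nonlinearity by 1 / \<open>\<delta>\<close>, so
  both sides converge by bounded convergence, the left one along the index shifted by one.\<close>

lemma green_iter_weak_solution:
  assumes b: "\<And>k r. r \<in> {0..1} \<Longrightarrow> green_iter CARD('n::finite) lam k r \<le> 1 - \<delta>" and \<delta>: "0 < \<delta>" and lam: "0 \<le> lam"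
  obtains w :: "real ^ 'n \<Rightarrow> real" where "weak_solution lam w"
    "\<And>x. norm x < 1 \<Longrightarrow> (\<lambda>k. green_iter CARD('n) lam k (norm x)) \<longlonglongrightarrow> w x"
    "\<And>k x. norm x < 1 \<Longrightarrow> green_iter CARD('n) lam k (norm x) \<le> w x"
proof -
  let ?M = "lebesgue_on (unit_ball :: (real ^ 'n) set)"
  let ?v = "green_iter CARD('n) lam"
  have n: "0 < CARD('n)" by simp
  note c = continuous_on_green_iter[OF b \<delta> n]
  have inc: "incseq (\<lambda>k. ?v k r)" if "r \<in> {0..1}" for r
    by (rule incseq_SucI) (rule green_iter_mono_Suc[OF b \<delta> n lam that])
  have "\<exists>L. (\<lambda>k. ?v k r) \<longlonglongrightarrow> L \<and> (\<forall>k. ?v k r \<le> L)" if r: "r \<in> {0..1}" for r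
    using incseq_convergent[OF inc[OF r], of "1 - \<delta>"] b[OF r] by metis
  then obtain L where L: "\<And>r. r \<in> {0..1} \<Longrightarrow> (\<lambda>k. ?v k r) \<longlonglongrightarrow> L r" "\<And>r k. r \<in> {0..1} \<Longrightarrow> ?v k r \<le> L r"
    by metis
  define w where "w x = L (norm x)" for x :: "real ^ 'n"
  have wl: "(\<lambda>k. ?v k (norm x)) \<longlonglongrightarrow> w x" if "norm x < 1" for x :: "real ^ 'n"
    using L(1)[of "norm x"] that by (simp add: w_def)
  have vw: "?v k (norm x) \<le> w x" if "norm x < 1" for k and x :: "real ^ 'n"
    using L(2)[of "norm x"] that by (simp add: w_def)
  have w0: "0 \<le> w x" if "norm x < 1" for x using vw[OF that, of 0] by simp
  have w1: "w x \<le> 1 - \<delta>" if "norm x < 1" for x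
    by (rule LIMSEQ_le_const2[OF wl[OF that]]) (use b[of "norm x"] that in auto)
  have v0: "0 \<le> ?v k (norm x)" if "norm x < 1" for k and x :: "real ^ 'n"
    using incseqD[OF inc, of "norm x" 0 k] that by simp
  have vabs: "\<bar>?v k (norm x)\<bar> \<le> 1" if "norm x < 1" for k and x :: "real ^ 'n"
    using v0[OF that, of k] b[of "norm x" k] that \<delta> by simp
  have f_bound: "\<bar>1 / (1 - y)\<bar> \<le> 1 / \<delta>" if "y \<le> 1 - \<delta>" for y
    using that \<delta> by (simp add: frac_le)
  have wm: "w \<in> borel_measurable ?M"
    by (rule bounded_convergence_ball(1)[OF has_continuous_extension_measurable[OF has_continuous_extension_radial[OF c]] vabs wl])
  have wint: "integrable ?M w"
    by (rule integrable_ball_bounded[OF wm, of 1]) (use w0 w1 \<delta> in force)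
  have rint: "integrable ?M (\<lambda>x. 1 / (1 - w x))"
    by (rule integrable_ball_bounded[of _ "1 / \<delta>"]) (use wm w1 f_bound in auto)
  have "(LINT x|?M. w x * bilaplacian \<phi> x) = lam * (LINT x|?M. \<phi> x / (1 - w x))"
    if \<phi>: "\<phi> \<in> C_closure 4 unit_ball" "\<phi> \<in> H0 2 unit_ball" for \<phi>
  proof -
    note be = bilaplacian_extension[OF \<phi>(1)] and pe = C_closure_extension[OF \<phi>(1), of "[]", simplified]
    obtain D where D: "\<And>x. norm x < 1 \<Longrightarrow> \<bar>bilaplacian \<phi> x\<bar> \<le> D"
      by (rule has_continuous_extension_bounded[OF be]) blast
    obtain P where P: "\<And>x. norm x < 1 \<Longrightarrow> \<bar>\<phi> x\<bar> \<le> P"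
      by (rule has_continuous_extension_bounded[OF pe]) blast
    note rc = continuous_on_reciprocal[OF c b \<delta>]
    have 1: "(\<lambda>k. LINT x|?M. ?v k (norm x) * bilaplacian \<phi> x) \<longlonglongrightarrow> (LINT x|?M. w x * bilaplacian \<phi> x)"
    proof (rule bounded_convergence_ball(2))
      show "(\<lambda>x. ?v k (norm x) * bilaplacian \<phi> x) \<in> borel_measurable ?M" for k
        by (intro has_continuous_extension_measurable has_continuous_extension_mult has_continuous_extension_radial c be)
      show "\<bar>?v k (norm x) * bilaplacian \<phi> x\<bar> \<le> 1 * D" if "norm x < 1" for k x
        unfolding abs_mult by (rule mult_mono) (use vabs D that in auto)
      show "(\<lambda>k. ?v k (norm x) * bilaplacian \<phi> x) \<longlonglongrightarrow> w x * bilaplacian \<phi> x" if "norm x < 1" for x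
        by (intro tendsto_intros wl that)
    qed
    have 2: "(\<lambda>k. LINT x|?M. (1 / (1 - ?v k (norm x))) * \<phi> x) \<longlonglongrightarrow> (LINT x|?M. \<phi> x / (1 - w x))"
    proof (rule bounded_convergence_ball(2))
      show "(\<lambda>x. (1 / (1 - ?v k (norm x))) * \<phi> x) \<in> borel_measurable ?M" for k
        by (intro has_continuous_extension_measurable has_continuous_extension_mult
            has_continuous_extension_radial[OF rc] pe)
      show "\<bar>(1 / (1 - ?v k (norm x))) * \<phi> x\<bar> \<le> (1 / \<delta>) * P" if "norm x < 1" for k x
        unfolding abs_mult by (rule mult_mono[OF f_bound P]) (use that b \<delta> in auto)
      show "(\<lambda>k. (1 / (1 - ?v k (norm x))) * \<phi> x) \<longlonglongrightarrow> \<phi> x / (1 - w x)" if "norm x < 1" for x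
      proof -
        have "(\<lambda>k. (1 / (1 - ?v k (norm x))) * \<phi> x) \<longlonglongrightarrow> (1 / (1 - w x)) * \<phi> x"
          by (intro tendsto_intros wl that) (use w1[OF that] \<delta> in auto)
        then show ?thesis by simp
      qed
    qed
    have eq: "(LINT x|?M. ?v (Suc k) (norm x) * bilaplacian \<phi> x) = lam * (LINT x|?M. (1 / (1 - ?v k (norm x))) * \<phi> x)" for k
      using integral_radial_green_H0[OF \<phi> rc, of k] by (simp add: mult.assoc)
    show ?thesis
      using LIMSEQ_unique[OF LIMSEQ_Suc[OF 1, unfolded eq] tendsto_mult_left[OF 2, of lam]] .
  qed
  moreover have "AE x in ?M. 0 \<le> w x \<and> w x \<le> 1 \<and> w x \<noteq> 1"
  proof (rule AE_I2)
    fix x :: "real ^ 'n" assume "x \<in> space ?M"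
    then have "norm x < 1" by (simp add: space_restrict_space)
    then show "0 \<le> w x \<and> w x \<le> 1 \<and> w x \<noteq> 1" using w0[of x] w1[of x] \<delta> by simp
  qed
  ultimately have "weak_solution lam w"
    unfolding weak_solution_def using wint rint by blast
  then show ?thesis using that wl vw by blast
qed

text \<open>Comparison holds only after testing with radial functions: \<open>u\<close> itself is not known to be radial.
  Convexity of \<open>1 / (1 - t)\<close> carries the inequality from one iterate to the next.\<close>

lemma green_iter_comparison:
  fixes u :: "real ^ 'n::finite \<Rightarrow> real"
  assumes u: "classical_solution lam u" and lam: "0 < lam"
    and ub: "\<And>x. norm x \<le> 1 \<Longrightarrow> u x \<le> 1 - \<delta>" and \<delta>: "0 < \<delta>"
  shows "continuous_on {0..1} (green_iter CARD('n) lam k) \<and>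
    (\<forall>r\<in>{0..1}. green_iter CARD('n) lam k r \<le> 1 - \<delta>) \<and>
    (\<forall>\<xi>. continuous_on {0..1} \<xi> \<and> (\<forall>r\<in>{0..1}. 0 \<le> \<xi> r) \<longrightarrow>
      (LINT x|lebesgue_on (unit_ball :: (real ^ 'n) set). green_iter CARD('n) lam k (norm x) * \<xi> (norm x))
        \<le> (LINT x|lebesgue_on unit_ball. u x * \<xi> (norm x)))"
proof -
  let ?M = "lebesgue_on (unit_ball :: (real ^ 'n) set)"
  let ?v = "green_iter CARD('n) lam"
  have n: "0 < CARD('n)" by simp
  have uC: "u \<in> C_closure 4 unit_ball" and ubd: "\<And>x. norm x = 1 \<Longrightarrow> u x = 0"
    "\<And>x. norm x = 1 \<Longrightarrow> has_normal_derivative u 0 x"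
    and upos: "\<And>x. norm x < 1 \<Longrightarrow> 0 < u x"
    and ueq: "\<And>x. norm x < 1 \<Longrightarrow> bilaplacian u x = lam / (1 - u x)"
    using u by (auto simp: classical_solution_def)
  note uc = C_closure_continuous[OF uC]
  have ue: "has_continuous_extension u" by (rule has_continuous_extensionI[OF uc]) auto
  have re: "has_continuous_extension (\<lambda>x. 1 / (1 - u x))"
  proof (rule has_continuous_extensionI)
    have "1 - u x \<noteq> 0" if "x \<in> cball 0 1" for x using ub[of x] that \<delta> by auto
    then show "continuous_on (cball 0 1) (\<lambda>x. 1 / (1 - u x))" by (intro continuous_intros uc ballI)
  qed simp
  \<comment> \<open>The bound 1 - \<open>\<delta>\<close> must be nonnegative, as the iterates take
    the value 0: the initial one everywhere, the later ones on the sphere.\<close>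
  have \<delta>1: "\<delta> \<le> 1" using ub[of 0] upos[of 0] by simp
  note Rad = has_continuous_extension_radial and Int = has_continuous_extension_integrable
    and Mult = has_continuous_extension_mult
  show ?thesis
  proof (induction k)
    case 0
    have "0 \<le> (LINT x|?M. u x * \<xi> (norm x))" if "\<forall>r\<in>{0..1}. 0 \<le> \<xi> r" for \<xi>
    proof (rule integral_nonneg_AE, rule AE_I2)
      fix x :: "real ^ 'n" assume "x \<in> space ?M"
      then have "norm x < 1" by (simp add: space_restrict_space)
      then show "0 \<le> u x * \<xi> (norm x)" using that upos[of x] by (simp add: less_imp_le)
    qed
    then show ?case using \<delta>1 by simp
  next
    case (Suc k)
    then have c: "continuous_on {0..1} (?v k)" and b: "\<And>r. r \<in> {0..1} \<Longrightarrow> ?v k r \<le> 1 - \<delta>"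
      and le: "\<And>\<xi>. continuous_on {0..1} \<xi> \<Longrightarrow> (\<And>r. r \<in> {0..1} \<Longrightarrow> 0 \<le> \<xi> r) \<Longrightarrow>
        (LINT x|?M. ?v k (norm x) * \<xi> (norm x)) \<le> (LINT x|?M. u x * \<xi> (norm x))" by blast+
    let ?f = "\<lambda>s. 1 / (1 - ?v k s)"
    note fc = continuous_on_reciprocal[OF c b \<delta>]
    have cS: "continuous_on {0..1} (?v (Suc k))" by (rule continuous_on_green_iter_Suc[OF c b \<delta> n])
    have leS: "(LINT x|?M. ?v (Suc k) (norm x) * \<xi> (norm x)) \<le> (LINT x|?M. u x * \<xi> (norm x))"
      if \<xi>: "continuous_on {0..1} \<xi>" "\<And>r. r \<in> {0..1} \<Longrightarrow> 0 \<le> \<xi> r" for \<xi>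
    proof -
      let ?\<zeta> = "radial_green CARD('n) \<xi>"
      \<comment> \<open>The weight for the induction hypothesis: 1 / (1 - v)^2 is the slope of 1 /
        (1 - t) at t = v, so (u - v) times this weight is the tangent line estimate multiplied by
        \<open>radial_green\<close> of the given weight.\<close>
      let ?\<xi>' = "\<lambda>r. ?\<zeta> r * (?f r)\<^sup>2"
      have \<zeta>: "continuous_on {0..1} ?\<zeta>" by (rule continuous_on_radial_green[OF \<xi>(1) n])
      have \<zeta>0: "0 \<le> ?\<zeta> r" if "r \<in> {0..1}" for r by (rule radial_green_nonneg[OF \<xi> that n])
      have \<xi>'c: "continuous_on {0..1} ?\<xi>'" by (intro continuous_on_mult continuous_on_power \<zeta> fc)
      have IH: "(LINT x|?M. ?v k (norm x) * ?\<xi>' (norm x)) \<le> (LINT x|?M. u x * ?\<xi>' (norm x))"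
        by (rule le[OF \<xi>'c]) (use \<zeta>0 in auto)
      have 1: "(LINT x|?M. u x * \<xi> (norm x)) = lam * (LINT x|?M. ?\<zeta> (norm x) * (1 / (1 - u x)))"
      proof -
        have "(LINT x|?M. u x * \<xi> (norm x)) = (LINT x|?M. ?\<zeta> (norm x) * bilaplacian u x)"
          using integral_radial_green_classical[OF uC ubd \<xi>(1)] by (simp add: mult.commute)
        also have "\<dots> = (LINT x|?M. lam * (?\<zeta> (norm x) * (1 / (1 - u x))))"
          by (rule Bochner_Integration.integral_cong) (auto simp: space_restrict_space ueq)
        finally show ?thesis by (simp only: integral_mult_right_zero)
      qed
      have 2: "(LINT x|?M. ?v (Suc k) (norm x) * \<xi> (norm x)) = lam * (LINT x|?M. ?f (norm x) * ?\<zeta> (norm x))"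
        using radial_green_symmetric[where 'n = 'n, OF fc \<xi>(1)] by (simp add: mult.assoc)
      have i: "integrable ?M (\<lambda>x. u x * ?\<xi>' (norm x))" "integrable ?M (\<lambda>x. ?v k (norm x) * ?\<xi>' (norm x))"
        "integrable ?M (\<lambda>x. ?\<zeta> (norm x) * (1 / (1 - u x)))" "integrable ?M (\<lambda>x. ?f (norm x) * ?\<zeta> (norm x))"
        by (intro Int Mult Rad[OF \<xi>'c] Rad[OF \<zeta>] Rad[OF fc] Rad[OF c] ue re)+
      have "(LINT x|?M. u x * ?\<xi>' (norm x) - ?v k (norm x) * ?\<xi>' (norm x))
          \<le> (LINT x|?M. ?\<zeta> (norm x) * (1 / (1 - u x)) - ?f (norm x) * ?\<zeta> (norm x))"
      proof (rule integral_mono)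
        fix x :: "real ^ 'n" assume "x \<in> space ?M"
        then have x: "norm x < 1" by (simp add: space_restrict_space)
        define p q where "p = 1 - u x" and "q = 1 - ?v k (norm x)"
        have p: "0 < p" using ub[of x] x \<delta> by (simp add: p_def)
        have q: "0 < q" using b[of "norm x"] x \<delta> by (simp add: q_def)
        \<comment> \<open>The exact remainder of the tangent line of 1 / (1 - t); its sign is the
          convexity.\<close>
        have "1 / p - 1 / q - (q - p) * (1 / q)\<^sup>2 = (p - q)\<^sup>2 / (p * q\<^sup>2)"
          using p q by (simp add: field_simps power2_eq_square)
        moreover have "0 \<le> (p - q)\<^sup>2 / (p * q\<^sup>2)" using p q by simp
        ultimately have "(q - p) * (1 / q)\<^sup>2 \<le> 1 / p - 1 / q" by linarith
        then have "?\<zeta> (norm x) * ((q - p) * (1 / q)\<^sup>2) \<le> ?\<zeta> (norm x) * (1 / p - 1 / q)"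
          using \<zeta>0[of "norm x"] x by (intro mult_left_mono) auto
        moreover have "u x * ?\<xi>' (norm x) - ?v k (norm x) * ?\<xi>' (norm x) = ?\<zeta> (norm x) * ((q - p) * (1 / q)\<^sup>2)"
          unfolding q_def p_def by (simp only: algebra_simps)
        moreover have "?\<zeta> (norm x) * (1 / (1 - u x)) - ?f (norm x) * ?\<zeta> (norm x) = ?\<zeta> (norm x) * (1 / p - 1 / q)"
          unfolding q_def p_def by (simp only: algebra_simps)
        ultimately show "u x * ?\<xi>' (norm x) - ?v k (norm x) * ?\<xi>' (norm x)
          \<le> ?\<zeta> (norm x) * (1 / (1 - u x)) - ?f (norm x) * ?\<zeta> (norm x)" by simp
      qed (use i in auto)
      then have "(LINT x|?M. u x * ?\<xi>' (norm x)) - (LINT x|?M. ?v k (norm x) * ?\<xi>' (norm x))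
         \<le> (LINT x|?M. ?\<zeta> (norm x) * (1 / (1 - u x))) - (LINT x|?M. ?f (norm x) * ?\<zeta> (norm x))"
        by (simp only: Bochner_Integration.integral_diff i)
      then have "(LINT x|?M. ?f (norm x) * ?\<zeta> (norm x)) \<le> (LINT x|?M. ?\<zeta> (norm x) * (1 / (1 - u x)))"
        using IH by linarith
      then show ?thesis unfolding 1 2 using lam by (intro mult_left_mono) auto
    qed
    have bS: "?v (Suc k) r \<le> 1 - \<delta>" if r: "r \<in> {0..1}" for r
    proof (cases "r = 1")
      case True
      then show ?thesis using \<delta>1 by (simp add: radial_green_1)
    next
      case False
      \<comment> \<open>The excess over the claimed bound serves as its own weight. Where it is
        positive, u lies below 1 - \<open>\<delta>\<close>, so the square of the excess is at most
        (v - u) times the excess, whose integral is nonpositive.\<close>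
      define \<xi> where "\<xi> r = max 0 (?v (Suc k) r - (1 - \<delta>))" for r
      have \<xi>c: "continuous_on {0..1} \<xi>" unfolding \<xi>_def by (intro continuous_intros cS)
      have sq: "(\<xi> (norm x))\<^sup>2 \<le> ?v (Suc k) (norm x) * \<xi> (norm x) - u x * \<xi> (norm x)" if "norm x < 1" for x
      proof -
        have "\<xi> (norm x) * \<xi> (norm x) \<le> (?v (Suc k) (norm x) - u x) * \<xi> (norm x)"
        proof (cases "\<xi> (norm x) = 0")
          case False
          then have "\<xi> (norm x) = ?v (Suc k) (norm x) - (1 - \<delta>)" "0 \<le> \<xi> (norm x)"
            by (auto simp: \<xi>_def max_def simp del: green_iter.simps split: if_splits)
          then show ?thesis using ub[of x] that by (intro mult_right_mono) linarith+
        qed simp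
        then show ?thesis by (simp only: power2_eq_square left_diff_distrib)
      qed
      have ints: "integrable ?M (\<lambda>x. ?v (Suc k) (norm x) * \<xi> (norm x))" "integrable ?M (\<lambda>x. u x * \<xi> (norm x))"
        "integrable ?M (\<lambda>x. \<xi> (norm x) * \<xi> (norm x))"
        by (intro Int Mult Rad[OF \<xi>c] Rad[OF cS] ue)+
      have "(LINT x|?M. \<xi> (norm x) * \<xi> (norm x)) \<le> (LINT x|?M. ?v (Suc k) (norm x) * \<xi> (norm x) - u x * \<xi> (norm x))"
        by (rule integral_mono) (use ints sq in \<open>auto simp: space_restrict_space power2_eq_square simp del: green_iter.simps\<close>)
      also have "\<dots> = (LINT x|?M. ?v (Suc k) (norm x) * \<xi> (norm x)) - (LINT x|?M. u x * \<xi> (norm x))"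
        by (rule Bochner_Integration.integral_diff[OF ints(1,2)])
      also have "\<dots> \<le> 0" using leS[OF \<xi>c] by (simp add: \<xi>_def del: green_iter.simps)
      finally have "(LINT x|?M. \<xi> (norm x) * \<xi> (norm x)) \<le> 0" .
      moreover have "0 \<le> (LINT x|?M. \<xi> (norm x) * \<xi> (norm x))" by (rule integral_nonneg_AE) simp
      ultimately have "(LINT x|?M. \<xi> (norm x) * \<xi> (norm x)) = 0" by simp
      then have "AE x in ?M. \<xi> (norm x) * \<xi> (norm x) = 0"
        by (subst (asm) integral_nonneg_eq_0_iff_AE[OF ints(3)]) auto
      then have ae: "AE x in ?M. \<xi> (norm x) \<le> 0" by (auto elim!: eventually_mono)
      define x where "x = r *\<^sub>R (axis undefined 1 :: real ^ 'n)"
      have x: "norm x = r" using r by (simp add: x_def norm_axis_1)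
      have "\<xi> (norm x) \<le> 0"
        by (rule AE_le_continuous[OF ae continuous_on_subset[OF continuous_on_radial[OF \<xi>c]]])
           (use r False x in auto)
      then show ?thesis by (simp add: \<xi>_def x del: green_iter.simps)
    qed
    show ?case
    proof (intro conjI allI impI)
      show "continuous_on {0..1} (?v (Suc k))" by (rule cS)
      show "\<forall>r\<in>{0..1}. ?v (Suc k) r \<le> 1 - \<delta>" using bS by (rule ballI)
      fix \<xi> :: "real \<Rightarrow> real" assume \<xi>: "continuous_on {0..1} \<xi> \<and> (\<forall>r\<in>{0..1}. 0 \<le> \<xi> r)"
      show "(LINT x|?M. ?v (Suc k) (norm x) * \<xi> (norm x)) \<le> (LINT x|?M. u x * \<xi> (norm x))"
        by (rule leS) (use \<xi> in blast)+
    qed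
  qed
qed

text \<open>The limit \<open>w\<close> of the iterates agrees with \<open>u\<close> almost
  everywhere, but continuity of \<open>w\<close> is not established. Hence \<open>w\<close> is
  eliminated: lower bounds by iterates and upper bounds by a continuous radial function hold for
  \<open>u\<close> almost everywhere, and then at every point by continuity of both sides.\<close>

lemma minimal_solution_green_iter:
  fixes u :: "real ^ 'n::finite \<Rightarrow> real"
  assumes min: "minimal_solution lam u" and cl: "classical_solution lam u" and lam: "0 < lam"
  shows "\<exists>\<delta>>0. \<forall>k. \<forall>r\<in>{0..1}. green_iter CARD('n) lam k r \<le> 1 - \<delta>"
    and "norm x < 1 \<Longrightarrow> green_iter CARD('n) lam k (norm x) \<le> u x"
    and "norm x < 1 \<Longrightarrow> (\<And>k y. norm y < 1 \<Longrightarrow> green_iter CARD('n) lam k (norm (y :: real ^ 'n)) \<le> B (norm y)) \<Longrightarrow>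
      continuous_on {0..1} B \<Longrightarrow> u x \<le> B (norm x)"
proof -
  let ?M = "lebesgue_on (unit_ball :: (real ^ 'n) set)"
  let ?v = "green_iter CARD('n) lam"
  have n: "0 < CARD('n)" by simp
  have uc: "continuous_on (cball 0 1) u"
    using cl by (intro C_closure_continuous) (auto simp: classical_solution_def)
  have u1: "u x < 1" if "norm x \<le> 1" for x
  proof (cases "norm x = 1")
    case True
    then show ?thesis using cl by (simp add: classical_solution_def)
  next
    case False
    then have "x \<in> unit_ball" using that by simp
    then have "u x \<le> 1" "u x \<noteq> 1" using cl by (auto simp: classical_solution_def)
    then show ?thesis by simp
  qed
  obtain z where z: "z \<in> cball 0 1" "\<And>y. y \<in> cball 0 1 \<Longrightarrow> u y \<le> u z"
    using continuous_attains_sup[OF compact_cball _ uc] by auto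
  \<comment> \<open>Positive because the maximum is attained on the closed ball: u is below 1 inside
    and 0 on the sphere.\<close>
  define \<delta> where "\<delta> = 1 - u z"
  have \<delta>: "0 < \<delta>" using u1[of z] z(1) by (simp add: \<delta>_def)
  have ub: "u x \<le> 1 - \<delta>" if "norm x \<le> 1" for x using z(2)[of x] that by (simp add: \<delta>_def)
  note comp = green_iter_comparison[OF cl lam ub \<delta>]
  have b: "?v k r \<le> 1 - \<delta>" if "r \<in> {0..1}" for k r using comp[of k] that by blast
  show "\<exists>\<delta>>0. \<forall>k. \<forall>r\<in>{0..1}. ?v k r \<le> 1 - \<delta>" using \<delta> b by blast
  note c = continuous_on_green_iter[OF b \<delta> n]
  have le: "(LINT x|?M. ?v k (norm x)) \<le> (LINT x|?M. u x)" for k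
  proof -
    have "(LINT x|?M. ?v k (norm x) * (\<lambda>_. 1) (norm x)) \<le> (LINT x|?M. u x * (\<lambda>_. 1) (norm x))"
      by (intro conjunct2[OF conjunct2[OF comp[of k]], rule_format]) auto
    then show ?thesis by simp
  qed
  obtain w :: "real ^ 'n \<Rightarrow> real" where w: "weak_solution lam w"
    "\<And>x. norm x < 1 \<Longrightarrow> (\<lambda>k. ?v k (norm x)) \<longlonglongrightarrow> w x" "\<And>k x. norm x < 1 \<Longrightarrow> ?v k (norm x) \<le> w x"
  proof (rule green_iter_weak_solution[where 'n = 'n, OF _ \<delta> less_imp_le[OF lam]])
    fix w :: "real ^ 'n \<Rightarrow> real"
    assume w: "weak_solution lam w" "\<And>x. norm x < 1 \<Longrightarrow> (\<lambda>k. ?v k (norm x)) \<longlonglongrightarrow> w x"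
      "\<And>k x. norm x < 1 \<Longrightarrow> ?v k (norm x) \<le> w x"
    show thesis by (rule that[OF w])
  qed (rule b)
  have iw: "integrable ?M w" using w(1) by (simp add: weak_solution_def)
  have iu: "integrable ?M u" using min by (simp add: minimal_solution_def weak_solution_def)
  have uw: "AE x in ?M. u x \<le> w x" using min w(1) by (simp add: minimal_solution_def)
  have w1: "w x \<le> 1" if "norm x < 1" for x
  proof -
    have "?v k (norm x) \<le> 1" for k using b[of "norm x" k] that \<delta> by simp
    then show ?thesis by (intro LIMSEQ_le_const2[OF w(2)[OF that]]) auto
  qed
  have w0: "0 \<le> w x" if "norm x < 1" for x using w(3)[OF that, of 0] by simp
  have "(\<lambda>k. LINT x|?M. ?v k (norm x)) \<longlonglongrightarrow> (LINT x|?M. w x)"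
  proof (rule bounded_convergence_ball(2))
    show "\<bar>?v k (norm x)\<bar> \<le> 1" if "norm x < 1" for k and x :: "real ^ 'n"
    proof -
      have "incseq (\<lambda>k. ?v k (norm x))"
        by (rule incseq_SucI, rule green_iter_mono_Suc[OF b \<delta> n]) (use lam that in auto)
      from incseqD[OF this, of 0 k] have "0 \<le> ?v k (norm x)" by simp
      then show ?thesis using w(3)[OF that, of k] w1[OF that] by simp
    qed
  qed (use w(2) in \<open>auto intro!: has_continuous_extension_measurable has_continuous_extension_radial c\<close>)
  then have wu: "(LINT x|?M. w x) \<le> (LINT x|?M. u x)" by (rule LIMSEQ_le_const2) (use le in auto)
  have "(LINT x|?M. w x - u x) = 0"
  proof -
    have "0 \<le> (LINT x|?M. w x - u x)" by (rule integral_nonneg_AE) (use uw in auto)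
    then show ?thesis using wu iw iu by simp
  qed
  then have "AE x in ?M. w x - u x = 0"
    by (subst (asm) integral_nonneg_eq_0_iff_AE) (use uw iw iu in auto)
  then have eq: "AE x in ?M. w x = u x" by (auto elim!: eventually_mono)
  have uc': "continuous_on unit_ball u" by (rule continuous_on_subset[OF uc]) auto
  have rc: "continuous_on unit_ball (\<lambda>x :: real ^ 'n. h (norm x))" if "continuous_on {0..1} h" for h :: "real \<Rightarrow> real"
    by (rule continuous_on_subset[OF continuous_on_radial[OF that]]) auto
  have ball: "AE x in ?M. norm x < 1" by (rule AE_I2) (auto simp: space_restrict_space)
  show "?v k (norm x) \<le> u x" if "norm x < 1"
  proof (rule AE_le_continuous[OF _ rc[OF c] uc' that])
    show "AE x in ?M. ?v k (norm x) \<le> u x"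
      using eq ball by eventually_elim (use w(3) in metis)
  qed
  show "u x \<le> B (norm x)" if x: "norm x < 1"
    and B: "\<And>k y. norm y < 1 \<Longrightarrow> ?v k (norm (y :: real ^ 'n)) \<le> B (norm y)" "continuous_on {0..1} B"
  proof (rule AE_le_continuous[OF _ uc' rc[OF B(2)] x])
    show "AE x in ?M. u x \<le> B (norm x)"
      using eq ball
    proof eventually_elim
      case (elim y)
      then have "w y \<le> B (norm y)" by (intro LIMSEQ_le_const2[OF w(2)]) (use B(1) in auto)
      then show ?case using elim by simp
    qed
  qed
qed

section \<open>Explicit bounds and small values of the parameter\<close>

lemma green_iter_1:
  assumes "r \<in> {0..1}" "0 < n"
  shows "green_iter n lam (Suc 0) r = lam / (8 * real n * (real n + 2)) * (1 - r\<^sup>2)\<^sup>2"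
  using radial_green_const_1[OF assms] by simp

text \<open>The bound reproduces itself: lam / 12 is at most 1/2, so the next right-hand side is at
  most 2, and \<open>radial_green\<close> of the constant 1 is at most 1/24, because 8 n (n + 2) is
  at least 24 for n at least 1. This gives 2 lam / 24 = lam / 12.\<close>

lemma green_iter_small:
  assumes lam: "0 \<le> lam" "lam \<le> 1" and n: "0 < n"
  shows "continuous_on {0..1} (green_iter n lam k) \<and> (\<forall>r\<in>{0..1}. green_iter n lam k r \<le> lam / 12)"
proof (induction k)
  case 0
  then show ?case using lam by simp
next
  case (Suc k)
  then have c: "continuous_on {0..1} (green_iter n lam k)"
    and b: "\<And>r. r \<in> {0..1} \<Longrightarrow> green_iter n lam k r \<le> 1 - 1 / 2"
    using lam by (blast, force)
  have rc: "continuous_on {0..1} (\<lambda>s. 1 / (1 - green_iter n lam k s))"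
    by (rule continuous_on_reciprocal[OF c b]) auto
  have "continuous_on {0..1} (green_iter n lam (Suc k))"
    by (rule continuous_on_green_iter_Suc[OF c b _ n]) auto
  moreover have "green_iter n lam (Suc k) r \<le> lam / 12" if r: "r \<in> {0..1}" for r
  proof -
    have "radial_green n (\<lambda>s. 1 / (1 - green_iter n lam k s)) r \<le> radial_green n (\<lambda>s. 2 * 1) r"
    proof (rule radial_green_mono[OF rc _ _ r n])
      fix s :: real assume "s \<in> {0..1}"
      from b[OF this] show "1 / (1 - green_iter n lam k s) \<le> 2 * 1" by (simp add: field_simps)
    qed simp
    also have "\<dots> = 2 * ((1 - r\<^sup>2)\<^sup>2 / (8 * real n * (real n + 2)))"
      unfolding radial_green_scale radial_green_const_1[OF r n] ..
    also have "\<dots> \<le> 2 * (1 / 24)"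
    proof -
      have "0 \<le> 1 - r\<^sup>2" "1 - r\<^sup>2 \<le> 1" using r by (auto simp: power_le_one)
      then have "(1 - r\<^sup>2)\<^sup>2 \<le> 1" by (simp add: power_le_one)
      moreover have "24 \<le> 8 * real n * (real n + 2)"
      proof -
        have "1 * 3 \<le> real n * (real n + 2)" using n by (intro mult_mono) auto
        then show ?thesis by simp
      qed
      ultimately show ?thesis by (intro mult_left_mono frac_le) auto
    qed
    finally have "lam * radial_green n (\<lambda>s. 1 / (1 - green_iter n lam k s)) r \<le> lam * (2 * (1 / 24))"
      using lam by (intro mult_left_mono) auto
    then show ?thesis by simp
  qed
  ultimately show ?case by blast
qed

lemma lambda_star_ge_1: "1 \<le> lambda_star TYPE('n::finite)"
proof -
  have b: "green_iter CARD('n) 1 k r \<le> 1 - 1 / 2" if "r \<in> {0..1}" for k r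
    using green_iter_small[of 1 "CARD('n)" k] that by force
  obtain w :: "real ^ 'n \<Rightarrow> real" where "weak_solution 1 w"
    by (rule green_iter_weak_solution[where 'n = 'n, OF b]) auto
  then have "ereal 1 \<in> {ereal lam |lam. 0 \<le> lam \<and> (\<exists>u :: real ^ 'n \<Rightarrow> real. weak_solution lam u)}"
    by (auto intro!: exI[of _ "1::real"])
  then have "ereal 1 \<le> lambda_star TYPE('n)" unfolding lambda_star_def by (rule Sup_upper)
  then show ?thesis by (simp add: one_ereal_def)
qed

lemma V_less_minimal_solution:
  fixes u :: "real ^ 'n::finite \<Rightarrow> real"
  assumes min: "minimal_solution lam u" and cl: "classical_solution lam u" and lam: "0 < lam" and x: "norm x < 1"
  shows "V lam x < u x"
proof -
  let ?v = "green_iter CARD('n) lam"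
  have n: "0 < CARD('n)" by simp
  obtain \<delta> where \<delta>: "0 < \<delta>" "\<And>k r. r \<in> {0..1} \<Longrightarrow> ?v k r \<le> 1 - \<delta>"
    using minimal_solution_green_iter(1)[OF min cl lam] by blast
  note c = continuous_on_green_iter[OF \<delta>(2,1) n]
  have v1: "0 < ?v (Suc 0) s" if s: "0 \<le> s" "s < 1" for s
  proof -
    have "s\<^sup>2 < 1" using s by (simp add: power_less_one_iff)
    then show ?thesis using s lam by (subst green_iter_1) auto
  qed
  have "radial_green CARD('n) (\<lambda>s. 1 / (1 - ?v 0 s)) (norm x) < radial_green CARD('n) (\<lambda>s. 1 / (1 - ?v (Suc 0) s)) (norm x)"
  proof (rule radial_green_strict_mono)
    fix s :: real assume s: "0 \<le> s" "s < 1"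
    show "1 / (1 - ?v 0 s) < 1 / (1 - ?v (Suc 0) s)"
      using v1[OF s] \<delta>(2)[of s "Suc 0"] \<delta>(1) s
      by (intro divide_strict_left_mono mult_pos_pos) (simp_all del: green_iter.simps(2))
  qed (use continuous_on_reciprocal[OF c \<delta>(2,1)] x n in \<open>simp_all del: green_iter.simps\<close>)
  then have "?v (Suc 0) (norm x) < ?v (Suc (Suc 0)) (norm x)"
    using lam by simp
  also have "\<dots> \<le> u x" by (rule minimal_solution_green_iter(2)[OF min cl lam x])
  finally show ?thesis using x by (subst (asm) green_iter_1) (auto simp: V_def)
qed

text \<open>Once every iterate is known to be at most lam / 12, each right-hand side is below the
  constant 1 / (1 - lam / 12), and lam times \<open>radial_green\<close> of this constant is
  \<open>B\<close>. A case distinction on the index therefore replaces an induction.\<close>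

lemma minimal_solution_le_V:
  fixes u :: "real ^ 'n::finite \<Rightarrow> real"
  assumes min: "minimal_solution lam u" and cl: "classical_solution lam u" and lam: "0 < lam" "lam \<le> 1" and x: "norm x < 1"
  shows "u x \<le> V lam x / (1 - lam / 12)"
proof -
  let ?n = "CARD('n)"
  let ?v = "green_iter ?n lam"
  have n: "0 < ?n" by simp
  define B where "B r = lam / (8 * real ?n * (real ?n + 2)) * (1 - r\<^sup>2)\<^sup>2 / (1 - lam / 12)" for r :: real
  have c: "continuous_on {0..1} (?v k)" and b: "\<And>r. r \<in> {0..1} \<Longrightarrow> ?v k r \<le> lam / 12" for k
    using green_iter_small[of lam ?n k] lam by auto
  have vB: "?v k r \<le> B r" if r: "r \<in> {0..1}" for k r
  proof (cases k)
    case 0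
    then show ?thesis using lam by (simp add: B_def)
  next
    case (Suc j)
    let ?f = "\<lambda>s. 1 / (1 - ?v j s)"
    have rc: "continuous_on {0..1} ?f"
      by (rule continuous_on_reciprocal[OF c, of _ "1 / 2"]) (use b[of _ j] lam in force)+
    have "radial_green ?n ?f r \<le> radial_green ?n (\<lambda>s. 1 / (1 - lam / 12) * 1) r"
    proof (rule radial_green_mono[OF rc _ _ r n])
      fix s :: real assume "s \<in> {0..1}"
      from b[OF this, of j] show "?f s \<le> 1 / (1 - lam / 12) * 1" using lam by (simp add: frac_le)
    qed simp
    also have "\<dots> = 1 / (1 - lam / 12) * ((1 - r\<^sup>2)\<^sup>2 / (8 * real ?n * (real ?n + 2)))"
      unfolding radial_green_scale radial_green_const_1[OF r n] ..
    finally have "lam * radial_green ?n ?f r \<le> lam * (1 / (1 - lam / 12) * ((1 - r\<^sup>2)\<^sup>2 / (8 * real ?n * (real ?n + 2))))"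
      using lam by (intro mult_left_mono) auto
    also have "\<dots> = B r" by (simp add: B_def mult_ac)
    finally show ?thesis by (simp add: Suc)
  qed
  have "u x \<le> B (norm x)"
  proof (rule minimal_solution_green_iter(3)[OF min cl lam(1) x])
    show "continuous_on {0..1} B" unfolding B_def by (intro continuous_intros) (use lam in auto)
  qed (use vB in auto)
  then show ?thesis by (simp add: B_def V_def)
qed

theorem theorem1p4:
  fixes u :: "real \<Rightarrow> real ^ 'n::finite \<Rightarrow> real"
  assumes "\<And>lam. 0 < lam \<Longrightarrow> ereal lam < lambda_star TYPE('n) \<Longrightarrow> minimal_solution lam (u lam)"
    and "\<And>lam. 0 < lam \<Longrightarrow> ereal lam < lambda_star TYPE('n) \<Longrightarrow> classical_solution lam (u lam)"
  shows "(\<forall>lam x. 0 < lam \<and> ereal lam < lambda_star TYPE('n) \<and> norm x < 1 \<longrightarrow> u lam x > V lam x) \<and>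
    uniform_limit unit_ball (\<lambda>lam x. u lam x / V lam x) (\<lambda>x. 1) (at_right 0)"
proof (intro conjI allI impI)
  fix lam and x :: "real ^ 'n"
  assume "0 < lam \<and> ereal lam < lambda_star TYPE('n) \<and> norm x < 1"
  then show "u lam x > V lam x" using V_less_minimal_solution assms by blast
next
  show "uniform_limit unit_ball (\<lambda>lam x. u lam x / V lam x) (\<lambda>x. 1) (at_right 0)"
  proof (rule uniform_limitI)
    fix e :: real assume e: "0 < e"
    have "((\<lambda>lam. 1 / (1 - lam / 12)) \<longlongrightarrow> 1 / (1 - 0 / 12)) (at_right (0::real))"
      by (intro tendsto_intros) auto
    then have "\<forall>\<^sub>F lam in at_right (0::real). 1 / (1 - lam / 12) < 1 + e"
      by (rule order_tendstoD) (use e in simp)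
    moreover have "\<forall>\<^sub>F lam in at_right (0::real). lam \<in> {0<..<1}"
      by (rule eventually_at_right_real) simp
    ultimately show "\<forall>\<^sub>F lam in at_right 0. \<forall>x\<in>unit_ball. dist (u lam x / V lam x) 1 < e"
    proof eventually_elim
      case (elim lam)
      have "ereal lam < 1" using elim by (simp add: one_ereal_def)
      \<comment> \<open>The hypotheses on \<open>u\<close> hold only below
        \<open>lambda_star\<close>, so the limit at 0 requires a positive lower bound for
        it.\<close>
      then have ls: "ereal lam < lambda_star TYPE('n)" using lambda_star_ge_1 by (rule less_le_trans)
      have lam: "0 < lam" "lam \<le> 1" using elim by auto
      note sol = assms[OF lam(1) ls]
      show ?case
      proof
        fix x :: "real ^ 'n" assume "x \<in> unit_ball"
        then have x: "norm x < 1" by simp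
        have "(norm x)\<^sup>2 < 1" using x by (simp add: power_less_one_iff)
        then have V: "0 < V lam x" using lam by (simp add: V_def)
        have "1 < u lam x / V lam x" using V_less_minimal_solution[OF sol lam(1) x] V by simp
        moreover have "u lam x / V lam x \<le> 1 / (1 - lam / 12)"
          using minimal_solution_le_V[OF sol lam x] V by (simp add: field_simps)
        ultimately show "dist (u lam x / V lam x) 1 < e" using elim by (simp add: dist_real_def)
      qed
    qed
  qed
qed

end
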